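(* For $i\ge0$ and any bound function $\mathsf{b}$, $\mathsf{T}^i_2+\mathsf{LIND}(\mathsf{s}\Sigma^b_{i+1},\mathsf{b})\vdash\mathsf{BB}(\mathsf{b}\Sigma^b_{i+1},\mathsf{b})$.
   Context: Work in the language of $\mathsf{PV}$ (symbols for all polynomial-time functions); $|x|$ is binary length. $\mathsf{T}^i_2=\mathsf{BASIC}+\mathsf{IND}(\Sigma^b_i)$ is Buss's theory ($\mathsf{T}^0_2$ equivalent to $\mathsf{PV}_1$ in this language). A bound function $\mathsf{b}$ is an increasing $\mathsf{PV}$ function symbol with $\mathsf{PV}_1\vdash\mathsf{b}(x)\le x$. Quantifiers bounded by $\mathsf{b}(|t|)$ are $\mathsf{b}$-sharply bounded, by $|t|$ sharply bounded, by $t$ bounded. $\mathsf{s}\Sigma^b_{i+1}$ (strict) formulas have the form $\exists^b\forall^b\exists^b\cdots\phi$ with $i+1$ alternating bounded quantifiers and $\phi$ sharply bounded. $\mathsf{b}\Sigma^b_{i+1}$ is the closure of $\mathsf{s}\Sigma^b_{i+1}$ under $\mathsf{b}$-sharply bounded quantification, conjunction and disjunction. $\mathsf{LIND}(\varphi,\mathsf{b}):=\forall x[(\varphi(0)\wedge\forall n<\mathsf{b}(|x|)(\varphi(n)\to\varphi(n+1)))\to\varphi(\mathsf{b}(|x|))]$ and $\mathsf{BB}(\varphi,\mathsf{b}):=\forall x,t[(\forall j\le\mathsf{b}(|x|)\,\exists y\le t\,\varphi(j,y))\to(\exists w\,\forall j\le\mathsf{b}(|x|)\,\varphi(j,w_j))]$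 ($w$ codes a sequence with $j$-th element $w_j$); for a class $\Gamma$, $\mathsf{LIND}(\Gamma,\mathsf{b})$ and $\mathsf{BB}(\Gamma,\mathsf{b})$ are the schemes over all $\varphi\in\Gamma$ (with parameters). *)

theory Defs
  imports Complex_Main "HOL-Library.Log_Nat"
begin

section \<open>The symbols of PV\<close>

text \<open>
  The function symbols of PV name the functions of Cobham's algebra: the functions of Buss's
  language, a conditional and the projections, closed under composition and limited recursion on
  notation. Here \<open>Proj n i\<close> is the \<open>n\<close>-ary projection to argument \<open>i\<close> (counted from \<open>0\<close>),
  \<open>Comp n f gs\<close> is the \<open>n\<close>-ary composition of \<open>f\<close> with the \<open>n\<close>-ary functions \<open>gs\<close>, and
  \<open>F = Rec g h0 h1 k\<close> is given, recursion argument first, by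
    \<open>F(0, x) = g(x)\<close>,
    \<open>F(2y, x) = min (h0 (y, F(y, x), x)) (k (2y, x))\<close> for \<open>y \<noteq> 0\<close>, and
    \<open>F(2y+1, x) = min (h1 (y, F(y, x), x)) (k (2y+1, x))\<close>.
  Truncating at \<open>k\<close> enforces the bound that Cobham's schema imposes as a side condition,
  so that being a symbol is decidable and does not refer to provability.
\<close>

datatype pv =
    Zero | Succ | Add | Mul | Half | Len | Smash
  | CondLe \<comment> \<open>\<open>CondLe(x, y, u, v)\<close> is \<open>u\<close> if \<open>x \<le> y\<close>, and \<open>v\<close> otherwise\<close>
  | Proj nat nat
  | Comp nat pv "pv list"
  | Rec pv pv pv pv

fun arity :: "pv \<Rightarrow> nat" where
  "arity Zero = 0"
| "arity Succ = 1"
| "arity Add = 2"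
| "arity Mul = 2"
| "arity Half = 1"
| "arity Len = 1"
| "arity Smash = 2"
| "arity CondLe = 4"
| "arity (Proj n i) = n"
| "arity (Comp n f gs) = n"
| "arity (Rec g h0 h1 k) = Suc (arity g)"

fun wf_pv :: "pv \<Rightarrow> bool" where
  "wf_pv (Proj n i) \<longleftrightarrow> i < n"
| "wf_pv (Comp n f gs) \<longleftrightarrow>
     wf_pv f \<and> length gs = arity f \<and> (\<forall>g \<in> set gs. wf_pv g \<and> arity g = n)"
| "wf_pv (Rec g h0 h1 k) \<longleftrightarrow>
     wf_pv g \<and> wf_pv h0 \<and> wf_pv h1 \<and> wf_pv k \<and>
     arity h0 = arity g + 2 \<and> arity h1 = arity g + 2 \<and> arity k = arity g + 1"
| "wf_pv _ \<longleftrightarrow> True"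

text \<open>The intended interpretation in the natural numbers; \<open>floorlog 2\<close> is binary length.\<close>

fun limrec ::
  "nat \<Rightarrow> (nat \<Rightarrow> nat \<Rightarrow> nat) \<Rightarrow> (nat \<Rightarrow> nat \<Rightarrow> nat) \<Rightarrow> (nat \<Rightarrow> nat) \<Rightarrow> nat \<Rightarrow> nat" where
  "limrec a h0 h1 k y =
     (if y = 0 then a
      else min ((if even y then h0 else h1) (y div 2) (limrec a h0 h1 k (y div 2))) (k y))"

declare limrec.simps [simp del]

fun pv_eval :: "pv \<Rightarrow> nat list \<Rightarrow> nat" where
  "pv_eval Zero xs = 0"
| "pv_eval Succ xs = Suc (xs ! 0)"
| "pv_eval Add xs = xs ! 0 + xs ! 1"
| "pv_eval Mul xs = xs ! 0 * xs ! 1"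
| "pv_eval Half xs = xs ! 0 div 2"
| "pv_eval Len xs = floorlog 2 (xs ! 0)"
| "pv_eval Smash xs = 2 ^ (floorlog 2 (xs ! 0) * floorlog 2 (xs ! 1))"
| "pv_eval CondLe xs = (if xs ! 0 \<le> xs ! 1 then xs ! 2 else xs ! 3)"
| "pv_eval (Proj n i) xs = xs ! i"
| "pv_eval (Comp n f gs) xs = pv_eval f (map (\<lambda>g. pv_eval g xs) gs)"
| "pv_eval (Rec g h0 h1 k) xs =
     limrec (pv_eval g (tl xs))
       (\<lambda>y z. pv_eval h0 (y # z # tl xs)) (\<lambda>y z. pv_eval h1 (y # z # tl xs))
       (\<lambda>y. pv_eval k (y # tl xs)) (hd xs)"


section \<open>First-order syntax\<close>

text \<open>
  Variables are de Bruijn indices. The raw datatypes do not enforce arities; well-formedness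
  is required of all axioms and of all the formula classes below.
\<close>

datatype tm = Var nat | App pv "tm list"

datatype fm =
    Eq tm tm (infix "\<doteq>" 55)
  | Le tm tm (infix "\<preceq>" 55)
  | Fls
  | Conj fm fm (infixr "\<^bold>\<and>" 48)
  | Disj fm fm (infixr "\<^bold>\<or>" 47)
  | Imp fm fm (infixr "\<^bold>\<longrightarrow>" 46)
  | Forall fm
  | Exists fm

abbreviation Neg :: "fm \<Rightarrow> fm" ("\<^bold>\<not> _" [50] 50) where "\<^bold>\<not> \<phi> \<equiv> \<phi> \<^bold>\<longrightarrow> Fls"
abbreviation Iff :: "fm \<Rightarrow> fm \<Rightarrow> fm" (infix "\<^bold>\<longleftrightarrow>" 45)
  where "\<phi> \<^bold>\<longleftrightarrow> \<psi> \<equiv> (\<phi> \<^bold>\<longrightarrow> \<psi>) \<^bold>\<and> (\<psi> \<^bold>\<longrightarrow> \<phi>)"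

abbreviation zero_tm :: tm ("\<zero>") where "\<zero> \<equiv> App Zero []"
abbreviation suc_tm :: "tm \<Rightarrow> tm" ("\<S>") where "\<S> t \<equiv> App Succ [t]"
abbreviation one_tm :: tm ("\<one>") where "\<one> \<equiv> \<S> \<zero>"
abbreviation two_tm :: tm ("\<two>") where "\<two> \<equiv> \<S> \<one>"
abbreviation add_tm :: "tm \<Rightarrow> tm \<Rightarrow> tm" (infixl "\<oplus>" 65) where "s \<oplus> t \<equiv> App Add [s, t]"
abbreviation mul_tm :: "tm \<Rightarrow> tm \<Rightarrow> tm" (infixl "\<otimes>" 70) where "s \<otimes> t \<equiv> App Mul [s, t]"
abbreviation smash_tm :: "tm \<Rightarrow> tm \<Rightarrow> tm" (infixl "\<sharp>" 70) where "s \<sharp> t \<equiv> App Smash [s, t]"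
abbreviation half_tm :: "tm \<Rightarrow> tm" where "half_tm t \<equiv> App Half [t]"
abbreviation len_tm :: "tm \<Rightarrow> tm" where "len_tm t \<equiv> App Len [t]"
abbreviation cond_tm :: "tm \<Rightarrow> tm \<Rightarrow> tm \<Rightarrow> tm \<Rightarrow> tm"
  where "cond_tm s t u v \<equiv> App CondLe [s, t, u, v]"

abbreviation Less :: "tm \<Rightarrow> tm \<Rightarrow> fm" (infix "\<prec>" 55)
  where "s \<prec> t \<equiv> s \<preceq> t \<^bold>\<and> \<^bold>\<not> (s \<doteq> t)"

fun wf_tm :: "tm \<Rightarrow> bool" where
  "wf_tm (Var n) \<longleftrightarrow> True"
| "wf_tm (App f ts) \<longleftrightarrow> wf_pv f \<and> length ts = arity f \<and> (\<forall>t \<in> set ts. wf_tm t)"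

fun fv_tm :: "tm \<Rightarrow> nat set" where
  "fv_tm (Var n) = {n}"
| "fv_tm (App f ts) = (\<Union>t \<in> set ts. fv_tm t)"

primrec fv :: "fm \<Rightarrow> nat set" where
  "fv (s \<doteq> t) = fv_tm s \<union> fv_tm t"
| "fv (s \<preceq> t) = fv_tm s \<union> fv_tm t"
| "fv Fls = {}"
| "fv (\<phi> \<^bold>\<and> \<psi>) = fv \<phi> \<union> fv \<psi>"
| "fv (\<phi> \<^bold>\<or> \<psi>) = fv \<phi> \<union> fv \<psi>"
| "fv (\<phi> \<^bold>\<longrightarrow> \<psi>) = fv \<phi> \<union> fv \<psi>"
| "fv (Forall \<phi>) = {n. Suc n \<in> fv \<phi>}"
| "fv (Exists \<phi>) = {n. Suc n \<in> fv \<phi>}"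

text \<open>Simultaneous substitution\<close>

fun subst_tm :: "(nat \<Rightarrow> tm) \<Rightarrow> tm \<Rightarrow> tm" where
  "subst_tm \<sigma> (Var n) = \<sigma> n"
| "subst_tm \<sigma> (App f ts) = App f (map (subst_tm \<sigma>) ts)"

definition lift_tm :: "tm \<Rightarrow> tm" where
  "lift_tm = subst_tm (\<lambda>n. Var (Suc n))"

definition up :: "(nat \<Rightarrow> tm) \<Rightarrow> nat \<Rightarrow> tm" where
  "up \<sigma> n = (case n of 0 \<Rightarrow> Var 0 | Suc m \<Rightarrow> lift_tm (\<sigma> m))"

primrec subst :: "(nat \<Rightarrow> tm) \<Rightarrow> fm \<Rightarrow> fm" where
  "subst \<sigma> (s \<doteq> t) = (subst_tm \<sigma> s \<doteq> subst_tm \<sigma> t)"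
| "subst \<sigma> (s \<preceq> t) = (subst_tm \<sigma> s \<preceq> subst_tm \<sigma> t)"
| "subst \<sigma> Fls = Fls"
| "subst \<sigma> (\<phi> \<^bold>\<and> \<psi>) = (subst \<sigma> \<phi> \<^bold>\<and> subst \<sigma> \<psi>)"
| "subst \<sigma> (\<phi> \<^bold>\<or> \<psi>) = (subst \<sigma> \<phi> \<^bold>\<or> subst \<sigma> \<psi>)"
| "subst \<sigma> (\<phi> \<^bold>\<longrightarrow> \<psi>) = (subst \<sigma> \<phi> \<^bold>\<longrightarrow> subst \<sigma> \<psi>)"
| "subst \<sigma> (Forall \<phi>) = Forall (subst (up \<sigma>) \<phi>)"
| "subst \<sigma> (Exists \<phi>) = Exists (subst (up \<sigma>) \<phi>)"

definition lift :: "fm \<Rightarrow> fm" where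
  "lift = subst (\<lambda>n. Var (Suc n))"

text \<open>
  \<open>inst ts k \<phi>\<close> puts the terms \<open>ts\<close> for the first variables of \<open>\<phi>\<close>; the remaining variables,
  the parameters of \<open>\<phi>\<close>, are shifted to \<open>k, k + 1, \<dots>\<close>, so that the result can be placed below
  \<open>k\<close> new quantifiers without capture.
\<close>

definition inst :: "tm list \<Rightarrow> nat \<Rightarrow> fm \<Rightarrow> fm" where
  "inst ts k = subst (\<lambda>n. if n < length ts then ts ! n else Var (n - length ts + k))"

text \<open>Bounded quantification; the bound does not contain the bound variable.\<close>

definition BEx :: "tm \<Rightarrow> fm \<Rightarrow> fm" where
  "BEx t \<phi> = Exists (Var 0 \<preceq> lift_tm t \<^bold>\<and> \<phi>)"

definition BAll :: "tm \<Rightarrow> fm \<Rightarrow> fm" where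
  "BAll t \<phi> = Forall (Var 0 \<preceq> lift_tm t \<^bold>\<longrightarrow> \<phi>)"


section \<open>Provability\<close>

text \<open>Classical natural deduction with equality\<close>

inductive derives :: "fm set \<Rightarrow> fm \<Rightarrow> bool" where
  Assm: "\<phi> \<in> \<Gamma> \<Longrightarrow> derives \<Gamma> \<phi>"
| ImpI: "derives (insert \<phi> \<Gamma>) \<psi> \<Longrightarrow> derives \<Gamma> (\<phi> \<^bold>\<longrightarrow> \<psi>)"
| ImpE: "derives \<Gamma> (\<phi> \<^bold>\<longrightarrow> \<psi>) \<Longrightarrow> derives \<Gamma> \<phi> \<Longrightarrow> derives \<Gamma> \<psi>"
| Raa: "derives (insert (\<^bold>\<not> \<phi>) \<Gamma>) Fls \<Longrightarrow> derives \<Gamma> \<phi>"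
| ConjI: "derives \<Gamma> \<phi> \<Longrightarrow> derives \<Gamma> \<psi> \<Longrightarrow> derives \<Gamma> (\<phi> \<^bold>\<and> \<psi>)"
| ConjE1: "derives \<Gamma> (\<phi> \<^bold>\<and> \<psi>) \<Longrightarrow> derives \<Gamma> \<phi>"
| ConjE2: "derives \<Gamma> (\<phi> \<^bold>\<and> \<psi>) \<Longrightarrow> derives \<Gamma> \<psi>"
| DisjI1: "derives \<Gamma> \<phi> \<Longrightarrow> derives \<Gamma> (\<phi> \<^bold>\<or> \<psi>)"
| DisjI2: "derives \<Gamma> \<psi> \<Longrightarrow> derives \<Gamma> (\<phi> \<^bold>\<or> \<psi>)"
| DisjE: "derives \<Gamma> (\<phi> \<^bold>\<or> \<psi>) \<Longrightarrow> derives (insert \<phi> \<Gamma>) \<chi> \<Longrightarrow> derives (insert \<psi> \<Gamma>) \<chi> \<Longrightarrow> derives \<Gamma> \<chi>"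
| ForallI: "derives (lift ` \<Gamma>) \<phi> \<Longrightarrow> derives \<Gamma> (Forall \<phi>)"
| ForallE: "derives \<Gamma> (Forall \<phi>) \<Longrightarrow> derives \<Gamma> (inst [t] 0 \<phi>)"
| ExistsI: "derives \<Gamma> (inst [t] 0 \<phi>) \<Longrightarrow> derives \<Gamma> (Exists \<phi>)"
| ExistsE: "derives \<Gamma> (Exists \<phi>) \<Longrightarrow> derives (insert \<phi> (lift ` \<Gamma>)) (lift \<psi>) \<Longrightarrow> derives \<Gamma> \<psi>"
| EqRefl: "derives \<Gamma> (t \<doteq> t)"
| EqSubst: "derives \<Gamma> (s \<doteq> t) \<Longrightarrow> derives \<Gamma> (inst [s] 0 \<phi>) \<Longrightarrow> derives \<Gamma> (inst [t] 0 \<phi>)"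

text \<open>A theory is given by a set of formulas, whose free variables are read universally.\<close>

definition universal_closures :: "fm set \<Rightarrow> fm set" where
  "universal_closures A = {(Forall ^^ n) \<phi> | n \<phi>. \<phi> \<in> A \<and> fv \<phi> \<subseteq> {..<n}}"

definition proves :: "fm set \<Rightarrow> fm \<Rightarrow> bool" (infix "\<turnstile>" 40) where
  "A \<turnstile> \<phi> \<longleftrightarrow> derives (universal_closures A) \<phi>"


section \<open>Classes of formulas\<close>

primrec quantifier_free :: "fm \<Rightarrow> bool" where
  "quantifier_free (s \<doteq> t) \<longleftrightarrow> wf_tm s \<and> wf_tm t"
| "quantifier_free (s \<preceq> t) \<longleftrightarrow> wf_tm s \<and> wf_tm t"
| "quantifier_free Fls \<longleftrightarrow> True"
| "quantifier_free (\<phi> \<^bold>\<and> \<psi>) \<longleftrightarrow> quantifier_free \<phi> \<and> quantifier_free \<psi>"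
| "quantifier_free (\<phi> \<^bold>\<or> \<psi>) \<longleftrightarrow> quantifier_free \<phi> \<and> quantifier_free \<psi>"
| "quantifier_free (\<phi> \<^bold>\<longrightarrow> \<psi>) \<longleftrightarrow> quantifier_free \<phi> \<and> quantifier_free \<psi>"
| "quantifier_free (Forall \<phi>) \<longleftrightarrow> False"
| "quantifier_free (Exists \<phi>) \<longleftrightarrow> False"

inductive sharply_bounded :: "fm \<Rightarrow> bool" where
  "wf_tm s \<Longrightarrow> wf_tm t \<Longrightarrow> sharply_bounded (s \<doteq> t)"
| "wf_tm s \<Longrightarrow> wf_tm t \<Longrightarrow> sharply_bounded (s \<preceq> t)"
| "sharply_bounded Fls"
| "sharply_bounded \<phi> \<Longrightarrow> sharply_bounded \<psi> \<Longrightarrow> sharply_bounded (\<phi> \<^bold>\<and> \<psi>)"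
| "sharply_bounded \<phi> \<Longrightarrow> sharply_bounded \<psi> \<Longrightarrow> sharply_bounded (\<phi> \<^bold>\<or> \<psi>)"
| "sharply_bounded \<phi> \<Longrightarrow> sharply_bounded \<psi> \<Longrightarrow> sharply_bounded (\<phi> \<^bold>\<longrightarrow> \<psi>)"
| "wf_tm t \<Longrightarrow> sharply_bounded \<phi> \<Longrightarrow> sharply_bounded (BAll (len_tm t) \<phi>)"
| "wf_tm t \<Longrightarrow> sharply_bounded \<phi> \<Longrightarrow> sharply_bounded (BEx (len_tm t) \<phi>)"

text \<open>
  Buss's hierarchy of bounded formulas. Closure under negation, \<open>\<phi>\<close> being \<open>\<Pi>\<close> and \<open>\<^bold>\<not> \<phi>\<close>
  then \<open>\<Sigma>\<close>, is the case of implication where the conclusion is \<open>Fls\<close>.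
\<close>

inductive Sigma_b :: "nat \<Rightarrow> fm \<Rightarrow> bool" and Pi_b :: "nat \<Rightarrow> fm \<Rightarrow> bool" where
  "sharply_bounded \<phi> \<Longrightarrow> Sigma_b 0 \<phi>"
| "Pi_b i \<phi> \<Longrightarrow> Sigma_b (Suc i) \<phi>"
| "Sigma_b (Suc i) \<phi> \<Longrightarrow> Sigma_b (Suc i) \<psi> \<Longrightarrow> Sigma_b (Suc i) (\<phi> \<^bold>\<and> \<psi>)"
| "Sigma_b (Suc i) \<phi> \<Longrightarrow> Sigma_b (Suc i) \<psi> \<Longrightarrow> Sigma_b (Suc i) (\<phi> \<^bold>\<or> \<psi>)"
| "Pi_b (Suc i) \<phi> \<Longrightarrow> Sigma_b (Suc i) \<psi> \<Longrightarrow> Sigma_b (Suc i) (\<phi> \<^bold>\<longrightarrow> \<psi>)"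
| "wf_tm t \<Longrightarrow> Sigma_b (Suc i) \<phi> \<Longrightarrow> Sigma_b (Suc i) (BEx t \<phi>)"
| "wf_tm t \<Longrightarrow> Sigma_b (Suc i) \<phi> \<Longrightarrow> Sigma_b (Suc i) (BAll (len_tm t) \<phi>)"
| "sharply_bounded \<phi> \<Longrightarrow> Pi_b 0 \<phi>"
| "Sigma_b i \<phi> \<Longrightarrow> Pi_b (Suc i) \<phi>"
| "Pi_b (Suc i) \<phi> \<Longrightarrow> Pi_b (Suc i) \<psi> \<Longrightarrow> Pi_b (Suc i) (\<phi> \<^bold>\<and> \<psi>)"
| "Pi_b (Suc i) \<phi> \<Longrightarrow> Pi_b (Suc i) \<psi> \<Longrightarrow> Pi_b (Suc i) (\<phi> \<^bold>\<or> \<psi>)"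
| "Sigma_b (Suc i) \<phi> \<Longrightarrow> Pi_b (Suc i) \<psi> \<Longrightarrow> Pi_b (Suc i) (\<phi> \<^bold>\<longrightarrow> \<psi>)"
| "wf_tm t \<Longrightarrow> Pi_b (Suc i) \<phi> \<Longrightarrow> Pi_b (Suc i) (BAll t \<phi>)"
| "wf_tm t \<Longrightarrow> Pi_b (Suc i) \<phi> \<Longrightarrow> Pi_b (Suc i) (BEx (len_tm t) \<phi>)"

text \<open>
  Strict formulas: exactly \<open>i\<close> alternating single bounded quantifiers in front of a sharply
  bounded formula.
\<close>

inductive sSigma_b :: "nat \<Rightarrow> fm \<Rightarrow> bool" and sPi_b :: "nat \<Rightarrow> fm \<Rightarrow> bool" where
  "sharply_bounded \<phi> \<Longrightarrow> sSigma_b 0 \<phi>"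
| "wf_tm t \<Longrightarrow> sPi_b i \<phi> \<Longrightarrow> sSigma_b (Suc i) (BEx t \<phi>)"
| "sharply_bounded \<phi> \<Longrightarrow> sPi_b 0 \<phi>"
| "wf_tm t \<Longrightarrow> sSigma_b i \<phi> \<Longrightarrow> sPi_b (Suc i) (BAll t \<phi>)"

text \<open>The term \<open>b(|t|)\<close>\<close>

abbreviation blen_tm :: "pv \<Rightarrow> tm \<Rightarrow> tm" where
  "blen_tm b t \<equiv> App b [len_tm t]"

inductive bSigma_b :: "pv \<Rightarrow> nat \<Rightarrow> fm \<Rightarrow> bool" for b :: pv and i :: nat where
  "sSigma_b i \<phi> \<Longrightarrow> bSigma_b b i \<phi>"
| "bSigma_b b i \<phi> \<Longrightarrow> bSigma_b b i \<psi> \<Longrightarrow> bSigma_b b i (\<phi> \<^bold>\<and> \<psi>)"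
| "bSigma_b b i \<phi> \<Longrightarrow> bSigma_b b i \<psi> \<Longrightarrow> bSigma_b b i (\<phi> \<^bold>\<or> \<psi>)"
| "wf_tm t \<Longrightarrow> bSigma_b b i \<phi> \<Longrightarrow> bSigma_b b i (BEx (blen_tm b t) \<phi>)"
| "wf_tm t \<Longrightarrow> bSigma_b b i \<phi> \<Longrightarrow> bSigma_b b i (BAll (blen_tm b t) \<phi>)"


section \<open>Theories\<close>

text \<open>Buss's 32 axioms, in Buss's order\<close>

definition Buss_axioms :: "fm set" where
  "Buss_axioms = (let x = Var 0; y = Var 1; z = Var 2; u = Var 3; v = Var 4 in {
     y \<preceq> x \<^bold>\<longrightarrow> y \<preceq> \<S> x,
     \<^bold>\<not> (x \<doteq> \<S> x),
     \<zero> \<preceq> x,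
     (x \<preceq> y \<^bold>\<and> \<^bold>\<not> (x \<doteq> y)) \<^bold>\<longleftrightarrow> \<S> x \<preceq> y,
     \<^bold>\<not> (x \<doteq> \<zero>) \<^bold>\<longrightarrow> \<^bold>\<not> (\<two> \<otimes> x \<doteq> \<zero>),
     y \<preceq> x \<^bold>\<or> x \<preceq> y,
     (x \<preceq> y \<^bold>\<and> y \<preceq> x) \<^bold>\<longrightarrow> x \<doteq> y,
     (x \<preceq> y \<^bold>\<and> y \<preceq> z) \<^bold>\<longrightarrow> x \<preceq> z,
     len_tm \<zero> \<doteq> \<zero>,
     \<^bold>\<not> (x \<doteq> \<zero>) \<^bold>\<longrightarrow> (len_tm (\<two> \<otimes> x) \<doteq> \<S> (len_tm x) \<^bold>\<and> len_tm (\<S> (\<two> \<otimes> x)) \<doteq> \<S> (len_tm x)),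
     len_tm \<one> \<doteq> \<one>,
     x \<preceq> y \<^bold>\<longrightarrow> len_tm x \<preceq> len_tm y,
     len_tm (x \<sharp> y) \<doteq> \<S> (len_tm x \<otimes> len_tm y),
     \<zero> \<sharp> y \<doteq> \<one>,
     \<^bold>\<not> (x \<doteq> \<zero>) \<^bold>\<longrightarrow> (\<one> \<sharp> (\<two> \<otimes> x) \<doteq> \<two> \<otimes> (\<one> \<sharp> x) \<^bold>\<and> \<one> \<sharp> \<S> (\<two> \<otimes> x) \<doteq> \<two> \<otimes> (\<one> \<sharp> x)),
     x \<sharp> y \<doteq> y \<sharp> x,
     len_tm x \<doteq> len_tm y \<^bold>\<longrightarrow> x \<sharp> z \<doteq> y \<sharp> z,
     len_tm x \<doteq> len_tm u \<oplus> len_tm v \<^bold>\<longrightarrow> x \<sharp> y \<doteq> (u \<sharp> y) \<otimes> (v \<sharp> y),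
     x \<preceq> x \<oplus> y,
     (x \<preceq> y \<^bold>\<and> \<^bold>\<not> (x \<doteq> y)) \<^bold>\<longrightarrow> (\<S> (\<two> \<otimes> x) \<preceq> \<two> \<otimes> y \<^bold>\<and> \<^bold>\<not> (\<S> (\<two> \<otimes> x) \<doteq> \<two> \<otimes> y)),
     x \<oplus> y \<doteq> y \<oplus> x,
     x \<oplus> \<zero> \<doteq> x,
     x \<oplus> \<S> y \<doteq> \<S> (x \<oplus> y),
     (x \<oplus> y) \<oplus> z \<doteq> x \<oplus> (y \<oplus> z),
     x \<oplus> y \<preceq> x \<oplus> z \<^bold>\<longleftrightarrow> y \<preceq> z,
     x \<otimes> \<zero> \<doteq> \<zero>,
     x \<otimes> \<S> y \<doteq> (x \<otimes> y) \<oplus> x,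
     x \<otimes> y \<doteq> y \<otimes> x,
     x \<otimes> (y \<oplus> z) \<doteq> (x \<otimes> y) \<oplus> (x \<otimes> z),
     \<one> \<preceq> x \<^bold>\<longrightarrow> (x \<otimes> y \<preceq> x \<otimes> z \<^bold>\<longleftrightarrow> y \<preceq> z),
     \<^bold>\<not> (x \<doteq> \<zero>) \<^bold>\<longrightarrow> len_tm x \<doteq> \<S> (len_tm (half_tm x)),
     x \<doteq> half_tm y \<^bold>\<longleftrightarrow> (\<two> \<otimes> x \<doteq> y \<^bold>\<or> \<S> (\<two> \<otimes> x) \<doteq> y)})"

text \<open>The defining axioms of the remaining symbols; \<open>is_min r s t\<close> says that \<open>r = min s t\<close>.\<close>

definition is_min :: "tm \<Rightarrow> tm \<Rightarrow> tm \<Rightarrow> fm" where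
  "is_min r s t = ((s \<preceq> t \<^bold>\<longrightarrow> r \<doteq> s) \<^bold>\<and> (\<^bold>\<not> (s \<preceq> t) \<^bold>\<longrightarrow> r \<doteq> t))"

fun defining_axioms :: "pv \<Rightarrow> fm set" where
  "defining_axioms CondLe =
     (let x = Var 0; y = Var 1; u = Var 2; v = Var 3 in
       {x \<preceq> y \<^bold>\<longrightarrow> cond_tm x y u v \<doteq> u, \<^bold>\<not> (x \<preceq> y) \<^bold>\<longrightarrow> cond_tm x y u v \<doteq> v})"
| "defining_axioms (Proj n i) = {App (Proj n i) (map Var [0..<n]) \<doteq> Var i}"
| "defining_axioms (Comp n f gs) =
     (let xs = map Var [0..<n] in {App (Comp n f gs) xs \<doteq> App f (map (\<lambda>g. App g xs) gs)})"
| "defining_axioms (Rec g h0 h1 k) =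
     (let F = Rec g h0 h1 k; y = Var 0; xs = map Var [1..<Suc (arity g)] in
       {App F (\<zero> # xs) \<doteq> App g xs,
        \<^bold>\<not> (y \<doteq> \<zero>) \<^bold>\<longrightarrow>
          is_min (App F (\<two> \<otimes> y # xs)) (App h0 (y # App F (y # xs) # xs)) (App k (\<two> \<otimes> y # xs)),
        is_min (App F (\<S> (\<two> \<otimes> y) # xs))
          (App h1 (y # App F (y # xs) # xs)) (App k (\<S> (\<two> \<otimes> y) # xs))})"
| "defining_axioms _ = {}"

definition BASIC :: "fm set" where
  "BASIC = Buss_axioms \<union> (\<Union>f \<in> {f. wf_pv f}. defining_axioms f)"

text \<open>In the schemes, the distinguished variable of \<open>\<phi>\<close> is \<open>Var 0\<close>, all others are parameters.\<close>

definition IND :: "fm \<Rightarrow> fm" where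
  "IND \<phi> = (inst [\<zero>] 0 \<phi> \<^bold>\<and> Forall (\<phi> \<^bold>\<longrightarrow> inst [\<S> (Var 0)] 1 \<phi>) \<^bold>\<longrightarrow> Forall \<phi>)"

definition PIND :: "fm \<Rightarrow> fm" where
  "PIND \<phi> = (inst [\<zero>] 0 \<phi> \<^bold>\<and> Forall (inst [half_tm (Var 0)] 1 \<phi> \<^bold>\<longrightarrow> \<phi>) \<^bold>\<longrightarrow> Forall \<phi>)"

definition PV1 :: "fm set" where
  "PV1 = BASIC \<union> PIND ` {\<phi>. quantifier_free \<phi>}"

definition T2 :: "nat \<Rightarrow> fm set" where
  "T2 i = BASIC \<union> IND ` {\<phi>. Sigma_b i \<phi>}"

definition bound_function :: "pv \<Rightarrow> bool" where
  "bound_function b \<longleftrightarrow>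
     wf_pv b \<and> arity b = 1 \<and> mono (\<lambda>x. pv_eval b [x]) \<and> (PV1 \<turnstile> App b [Var 0] \<preceq> Var 0)"

text \<open>
  \<open>\<forall>x. \<phi>(0) \<and> (\<forall>n < b(|x|). \<phi>(n) \<longrightarrow> \<phi>(n + 1)) \<longrightarrow> \<phi>(b(|x|))\<close>
\<close>

definition LIND :: "pv \<Rightarrow> fm \<Rightarrow> fm" where
  "LIND b \<phi> = Forall (
     inst [\<zero>] 1 \<phi> \<^bold>\<and>
     Forall (Var 0 \<prec> blen_tm b (Var 1) \<^bold>\<longrightarrow> inst [Var 0] 2 \<phi> \<^bold>\<longrightarrow> inst [\<S> (Var 0)] 2 \<phi>)
     \<^bold>\<longrightarrow> inst [blen_tm b (Var 0)] 1 \<phi>)"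


section \<open>Coding of sequences\<close>

text \<open>
  A number \<open>w\<close> whose binary expansion is \<open>s\<^sub>m \<dots> s\<^sub>1 s\<^sub>0 1 0 \<dots> 0\<close>, with \<open>l\<close> trailing zeros and
  blocks \<open>s\<^sub>j\<close> of \<open>l\<close> bits each, codes the sequence of the \<open>s\<^sub>j\<close>, that is,
  \<open>w\<^sub>j = \<lfloor>w / 2 ^ (l + 1 + j * l)\<rfloor> mod 2 ^ l\<close>.
\<close>

text \<open>The \<open>n\<close>-ary function given by a term in the variables \<open>Var 0, \<dots>, Var (n - 1)\<close>\<close>

fun fun_of_tm :: "nat \<Rightarrow> tm \<Rightarrow> pv" where
  "fun_of_tm n (Var i) = Proj n i"
| "fun_of_tm n (App f ts) = Comp n f (map (fun_of_tm n) ts)"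

text \<open>\<open>y mod 2\<close>\<close>

definition parity_pv :: pv where
  "parity_pv = Rec Zero (fun_of_tm 2 \<zero>) (fun_of_tm 2 \<one>) (fun_of_tm 1 \<one>)"

text \<open>The number of trailing zeros of \<open>y > 0\<close>\<close>

definition trailing_zeros_pv :: pv where
  "trailing_zeros_pv = Rec Zero (fun_of_tm 2 (\<S> (Var 1))) (fun_of_tm 2 \<zero>) (fun_of_tm 1 (Var 0))"

text \<open>
  \<open>\<lfloor>a / 2 ^ j\<rfloor>\<close> by halving \<open>a\<close> once in each of the first \<open>j\<close> steps of a recursion on \<open>a\<close>.
  The number of the current step is \<open>|y| + 1\<close>. In the step functions the variables are
  \<open>y\<close>, the previous value, \<open>a\<close> and \<open>j\<close>.
\<close>

definition msp_pv :: pv where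
  "msp_pv =
     (let y = Var 0; r = Var 1; j = Var 3;
          h = fun_of_tm 4 (cond_tm (\<S> (len_tm y)) j (half_tm r) r)
      in fun_of_tm 2 (App (Rec (Proj 2 0) h h (Proj 3 1)) [Var 0, Var 0, Var 1]))"

text \<open>
  \<open>a mod 2 ^ j\<close>, by adding the bit of weight \<open>2 ^ |y|\<close> of \<open>a\<close> in step \<open>|y| + 1\<close>, for the first
  \<open>j\<close> steps; note that \<open>2 ^ |y| = \<one> \<sharp> y\<close>.
\<close>

definition lsp_pv :: pv where
  "lsp_pv =
     (let y = Var 0; r = Var 1; a = Var 2; j = Var 3;
          bit = App parity_pv [App msp_pv [a, len_tm y]];
          h = fun_of_tm 4 (cond_tm (\<S> (len_tm y)) j (r \<oplus> (\<one> \<sharp> y) \<otimes> bit) r)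
      in fun_of_tm 2 (App (Rec (Comp 2 Zero []) h h (Proj 3 1)) [Var 0, Var 0, Var 1]))"

definition elem_pv :: pv where
  "elem_pv =
     (let w = Var 0; j = Var 1; l = App trailing_zeros_pv [w]
      in fun_of_tm 2 (App lsp_pv [App msp_pv [w, \<S> l \<oplus> j \<otimes> l], l]))"

text \<open>
  \<open>\<forall>x t. (\<forall>j \<le> b(|x|). \<exists>y \<le> t. \<phi>(j, y)) \<longrightarrow> (\<exists>w. \<forall>j \<le> b(|x|). \<phi>(j, w\<^sub>j))\<close>,
  where \<open>j\<close> and \<open>y\<close> are the variables \<open>Var 0\<close> and \<open>Var 1\<close> of \<open>\<phi>\<close>
\<close>

definition BB :: "pv \<Rightarrow> fm \<Rightarrow> fm" where
  "BB b \<phi> = Forall (Forall (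
     BAll (blen_tm b (Var 1)) (BEx (Var 1) (inst [Var 1, Var 0] 4 \<phi>)) \<^bold>\<longrightarrow>
     Exists (BAll (blen_tm b (Var 2)) (inst [Var 0, App elem_pv [Var 1, Var 0]] 4 \<phi>))))"

end

theory Submission
  imports Defs "HOL-Library.Countable_Set"
begin

text \<open>
  By completeness it suffices to show \<open>BB b \<phi>\<close> in every model. For \<open>\<phi>\<close> in \<open>s\<Pi>\<^sub>i\<close>, the formula saying
  that some bounded \<open>w\<close> codes witnesses for all \<open>j < n\<close> is equivalent to one in \<open>s\<Sigma>\<^sub>i\<^sub>+\<^sub>1\<close>, because
  adjacent quantifiers of the same kind can be merged by pairing, and it passes from \<open>n\<close> to \<open>n + 1\<close>
  by changing one block of \<open>w\<close>. Hence \<open>LIND\<close> yields collection for \<open>s\<Pi>\<^sub>i\<close>. This in turn shows that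
  the predicates definable by \<open>s\<Sigma>\<^sub>i\<^sub>+\<^sub>1\<close> formulas are closed under b-sharply bounded universal
  quantification, so they include those definable in \<open>b\<Sigma>\<^sub>i\<^sub>+\<^sub>1\<close>; now the same induction applies to
  \<open>b\<Sigma>\<^sub>i\<^sub>+\<^sub>1\<close> formulas directly.
\<close>

section \<open>Substitution and the calculus\<close>

text \<open>Several obstacles shape the proof. Membership in a strict class depends on the exact
  form of a formula, while conjunctions, disjunctions and extra bounded quantifiers can only be
  absorbed up to equivalence. Definability is therefore a property of predicates on the valuations
  of one fixed model. Running the induction for b\<Sigma> at once would be circular: its induction
  formula has a b-sharply bounded \<forall> in front of an \<exists>, and absorbing that quantifier
  is what collection is for. A \<Pi> matrix absorbs it directly, which breaks the circle. The
  symbols of PV come with recursion equations only. Quotients and remainders by powers of two,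
  pairing and the change of a block must be proved in the model from BASIC and sharply bounded
  induction; since the recursions run on notation, induction on notation has to be recovered
  beforehand. Exponentiation need not be total in the model, so a power of two is indexed by a
  number whose length is the exponent. A theorem of HOL cannot quantify over all carrier types; the
  language being countable, models on \<open>nat\<close> are enough for completeness.\<close>

instance pv :: countable by countable_datatype
instance tm :: countable by countable_datatype
instance fm :: countable by countable_datatype

lemma subst_tm_cong: "(\<And>n. n \<in> fv_tm t \<Longrightarrow> \<sigma> n = \<tau> n) \<Longrightarrow> subst_tm \<sigma> t = subst_tm \<tau> t"
  by (induction t) auto

lemma subst_cong: "(\<And>n. n \<in> fv \<phi> \<Longrightarrow> \<sigma> n = \<tau> n) \<Longrightarrow> subst \<sigma> \<phi> = subst \<tau> \<phi>"
proof (induction \<phi> arbitrary: \<sigma> \<tau>)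
  case (Forall \<phi>)
  have "subst (up \<sigma>) \<phi> = subst (up \<tau>) \<phi>"
    by (rule Forall.IH) (auto simp: up_def Forall.prems split: nat.split)
  then show ?case by simp
next
  case (Exists \<phi>)
  have "subst (up \<sigma>) \<phi> = subst (up \<tau>) \<phi>"
    by (rule Exists.IH) (auto simp: up_def Exists.prems split: nat.split)
  then show ?case by simp
next
  case (Eq s t) then show ?case by (auto intro!: subst_tm_cong)
next
  case (Le s t) then show ?case by (auto intro!: subst_tm_cong)
next
  case (Conj \<phi> \<psi>)
  from Conj.IH(1)[of \<sigma> \<tau>] Conj.IH(2)[of \<sigma> \<tau>] Conj.prems show ?case by simp
next
  case (Disj \<phi> \<psi>)
  from Disj.IH(1)[of \<sigma> \<tau>] Disj.IH(2)[of \<sigma> \<tau>] Disj.prems show ?case by simp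
next
  case (Imp \<phi> \<psi>)
  from Imp.IH(1)[of \<sigma> \<tau>] Imp.IH(2)[of \<sigma> \<tau>] Imp.prems show ?case by simp
qed auto

lemma subst_tm_Var [simp]: "subst_tm Var t = t"
  by (induction t) (auto intro: map_idI)

lemma up_Var [simp]: "up Var = Var"
  by (auto simp: up_def lift_tm_def split: nat.split)

lemma subst_Var [simp]: "subst Var \<phi> = \<phi>"
  by (induction \<phi>) auto

lemma subst_tm_subst_tm: "subst_tm \<sigma> (subst_tm \<tau> t) = subst_tm (\<lambda>n. subst_tm \<sigma> (\<tau> n)) t"
  by (induction t) auto

lemma up_comp: "up (\<lambda>n. subst_tm \<sigma> (\<tau> n)) = (\<lambda>n. subst_tm (up \<sigma>) (up \<tau> n))"
  by (auto simp: up_def lift_tm_def subst_tm_subst_tm split: nat.split)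

lemma subst_subst: "subst \<sigma> (subst \<tau> \<phi>) = subst (\<lambda>n. subst_tm \<sigma> (\<tau> n)) \<phi>"
  by (induction \<phi> arbitrary: \<sigma> \<tau>) (auto simp: subst_tm_subst_tm up_comp)

lemma inst1: "inst [t] 0 \<phi> = subst (case_nat t Var) \<phi>"
  unfolding inst_def by (rule subst_cong) (auto split: nat.split)

lemma subst_inst1: "subst \<sigma> (inst [t] 0 \<phi>) = inst [subst_tm \<sigma> t] 0 (subst (up \<sigma>) \<phi>)"
  unfolding inst1 subst_subst
  by (rule subst_cong) (auto simp: up_def lift_tm_def subst_tm_subst_tm split: nat.split)

lemma subst_lift: "subst (up \<sigma>) (lift \<phi>) = lift (subst \<sigma> \<phi>)"
  unfolding lift_def subst_subst by (rule subst_cong) (auto simp: up_def lift_tm_def)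

section \<open>Structural properties of derivability\<close>

lemma derives_mono: "derives \<Gamma> \<phi> \<Longrightarrow> \<Gamma> \<subseteq> \<Delta> \<Longrightarrow> derives \<Delta> \<phi>"
proof (induction arbitrary: \<Delta> rule: derives.induct)
  case (Assm \<phi> \<Gamma>) then show ?case by (auto intro: derives.Assm)
next
  case (ImpI \<phi> \<Gamma> \<psi>) show ?case by (rule derives.ImpI, rule ImpI.IH) (use ImpI.prems in auto)
next
  case (Raa \<phi> \<Gamma>) show ?case by (rule derives.Raa, rule Raa.IH) (use Raa.prems in auto)
next
  case (DisjE \<Gamma> \<phi> \<psi> \<chi>)
  show ?case by (rule derives.DisjE[of _ \<phi> \<psi>]; rule DisjE.IH) (use DisjE.prems in auto)
next
  case (ForallI \<Gamma> \<phi>) show ?case by (rule derives.ForallI, rule ForallI.IH) (use ForallI.prems in auto)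
next
  case (ExistsE \<Gamma> \<phi> \<psi>)
  show ?case by (rule derives.ExistsE[of _ \<phi>]; rule ExistsE.IH) (use ExistsE.prems in auto)
next
  case (ImpE \<Gamma> \<phi> \<psi>) then show ?case by (metis derives.ImpE)
next
  case (ConjI \<Gamma> \<phi> \<psi>) then show ?case by (metis derives.ConjI)
next
  case (ConjE1 \<Gamma> \<phi> \<psi>) then show ?case by (metis derives.ConjE1)
next
  case (ConjE2 \<Gamma> \<phi> \<psi>) then show ?case by (metis derives.ConjE2)
next
  case (DisjI1 \<Gamma> \<phi> \<psi>) then show ?case by (metis derives.DisjI1)
next
  case (DisjI2 \<Gamma> \<phi> \<psi>) then show ?case by (metis derives.DisjI2)
next
  case (ForallE \<Gamma> \<phi> t) then show ?case by (metis derives.ForallE)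
next
  case (ExistsI \<Gamma> \<phi> t) then show ?case by (metis derives.ExistsI)
next
  case (EqRefl \<Gamma> t) show ?case by (rule derives.EqRefl)
next
  case (EqSubst \<Gamma> s t \<phi>) then show ?case by (metis derives.EqSubst)
qed

text \<open>Each rule has finitely many premises, so the finite sets found for them can be united.
  Under the quantifier rules the set lies in the image of the context under \<open>lift\<close> and
  is pulled back to a finite set of preimages. This locates an inconsistency of the union of a chain
  at a single stage.\<close>

lemma derives_finite: "derives \<Gamma> \<phi> \<Longrightarrow> \<exists>\<Delta>. finite \<Delta> \<and> \<Delta> \<subseteq> \<Gamma> \<and> derives \<Delta> \<phi>"
proof (induction rule: derives.induct)
  case (Assm \<phi> \<Gamma>) then show ?case by (intro exI[of _ "{\<phi>}"]) (auto intro: derives.Assm)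
next
  case (ImpI \<phi> \<Gamma> \<psi>)
  then obtain \<Delta> where "finite \<Delta>" "\<Delta> \<subseteq> insert \<phi> \<Gamma>" "derives \<Delta> \<psi>" by blast
  then show ?case
    by (intro exI[of _ "\<Delta> - {\<phi>}"] conjI)
      ((rule derives.ImpI; (erule derives_mono, blast)) | blast | simp)+
next
  case (Raa \<phi> \<Gamma>)
  then obtain \<Delta> where "finite \<Delta>" "\<Delta> \<subseteq> insert (\<^bold>\<not> \<phi>) \<Gamma>" "derives \<Delta> Fls" by blast
  then show ?case
    by (intro exI[of _ "\<Delta> - {\<^bold>\<not> \<phi>}"] conjI)
      ((rule derives.Raa; (erule derives_mono, blast)) | blast | simp)+
next
  case (DisjE \<Gamma> \<phi> \<psi> \<chi>)
  then obtain A B C where "finite A" "A \<subseteq> \<Gamma>" "derives A (\<phi> \<^bold>\<or> \<psi>)"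
    "finite B" "B \<subseteq> insert \<phi> \<Gamma>" "derives B \<chi>" "finite C" "C \<subseteq> insert \<psi> \<Gamma>" "derives C \<chi>" by blast
  then show ?case
    by (intro exI[of _ "A \<union> (B - {\<phi>}) \<union> (C - {\<psi>})"] conjI)
      ((rule derives.DisjE[of _ \<phi> \<psi>]; (erule derives_mono, blast)) | blast | simp)+
next
  case (ForallI \<Gamma> \<phi>)
  then obtain A where A: "finite A" "A \<subseteq> lift ` \<Gamma>" "derives A \<phi>" by blast
  then obtain B where "finite B" "B \<subseteq> \<Gamma>" "A = lift ` B" by (metis finite_subset_image)
  with A show ?case by (auto intro: derives.ForallI)
next
  case (ExistsE \<Gamma> \<phi> \<psi>)
  then obtain A B where A: "finite A" "A \<subseteq> \<Gamma>" "derives A (Exists \<phi>)"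
    and B: "finite B" "B \<subseteq> insert \<phi> (lift ` \<Gamma>)" "derives B (lift \<psi>)" by blast
  from B have "finite (B - {\<phi>})" "B - {\<phi>} \<subseteq> lift ` \<Gamma>" by auto
  then obtain C where C: "finite C" "C \<subseteq> \<Gamma>" "B - {\<phi>} = lift ` C" by (metis finite_subset_image)
  have "B \<subseteq> insert \<phi> (lift ` (A \<union> C))" using C(3) by blast
  with A B C show ?case
    by (intro exI[of _ "A \<union> C"] conjI)
      ((rule derives.ExistsE[of _ \<phi>]; (erule derives_mono, blast)) | blast | simp)+
next
  case (ImpE \<Gamma> \<phi> \<psi>)
  then obtain A B where "finite A" "A \<subseteq> \<Gamma>" "derives A (\<phi> \<^bold>\<longrightarrow> \<psi>)" "finite B" "B \<subseteq> \<Gamma>" "derives B \<phi>"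
    by blast
  then show ?case
    by (intro exI[of _ "A \<union> B"] conjI)
      ((rule derives.ImpE[of _ \<phi>]; (erule derives_mono, blast)) | blast | simp)+
next
  case (ConjI \<Gamma> \<phi> \<psi>)
  then obtain A B where "finite A" "A \<subseteq> \<Gamma>" "derives A \<phi>" "finite B" "B \<subseteq> \<Gamma>" "derives B \<psi>"
    by blast
  then show ?case
    by (intro exI[of _ "A \<union> B"] conjI)
      ((rule derives.ConjI; (erule derives_mono, blast)) | blast | simp)+
next
  case (EqSubst \<Gamma> s t \<phi>)
  then obtain A B where "finite A" "A \<subseteq> \<Gamma>" "derives A (s \<doteq> t)"
    "finite B" "B \<subseteq> \<Gamma>" "derives B (inst [s] 0 \<phi>)" by blast
  then show ?case
    by (intro exI[of _ "A \<union> B"] conjI)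
      ((rule derives.EqSubst[of _ s]; (erule derives_mono, blast)) | blast | simp)+
next
  case (ConjE1 \<Gamma> \<phi> \<psi>) then show ?case by (metis derives.ConjE1)
next
  case (ConjE2 \<Gamma> \<phi> \<psi>) then show ?case by (metis derives.ConjE2)
next
  case (DisjI1 \<Gamma> \<phi> \<psi>) then show ?case by (metis derives.DisjI1)
next
  case (DisjI2 \<Gamma> \<phi> \<psi>) then show ?case by (metis derives.DisjI2)
next
  case (ForallE \<Gamma> \<phi> t) then show ?case by (metis derives.ForallE)
next
  case (ExistsI \<Gamma> \<phi> t) then show ?case by (metis derives.ExistsI)
next
  case (EqRefl \<Gamma> t) show ?case by (metis derives.EqRefl finite.emptyI empty_subsetI)
qed

text \<open>The eigenvariable condition is expressed by lifting the context, so a substitution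
  passes a quantifier rule as \<open>up \<sigma>\<close>, which commutes with \<open>lift\<close>.
  It serves to rename witnesses in the Henkin construction and to instantiate axioms.\<close>

lemma derives_subst: "derives \<Gamma> \<phi> \<Longrightarrow> derives (subst \<sigma> ` \<Gamma>) (subst \<sigma> \<phi>)"
proof (induction arbitrary: \<sigma> rule: derives.induct)
  case (ForallI \<Gamma> \<phi>)
  have "subst (up \<sigma>) ` lift ` \<Gamma> = lift ` subst \<sigma> ` \<Gamma>" by (simp add: image_image subst_lift)
  with ForallI.IH[of "up \<sigma>"] show ?case by (auto intro: derives.ForallI)
next
  case (ExistsE \<Gamma> \<phi> \<psi>)
  have "subst (up \<sigma>) ` lift ` \<Gamma> = lift ` subst \<sigma> ` \<Gamma>" by (simp add: image_image subst_lift)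
  with ExistsE.IH(1)[of \<sigma>] ExistsE.IH(2)[of "up \<sigma>"] show ?case
    by (auto intro: derives.ExistsE simp: subst_lift)
next
  case (ForallE \<Gamma> \<phi> t) then show ?case by (simp add: subst_inst1 derives.ForallE)
next
  case (ExistsI \<Gamma> \<phi> t) then show ?case by (simp add: subst_inst1) (metis derives.ExistsI)
next
  case (EqSubst \<Gamma> s t \<phi>) then show ?case by (simp add: subst_inst1) (metis derives.EqSubst)
next
  case (DisjE \<Gamma> \<phi> \<psi> \<chi>)
  from DisjE.IH(1)[of \<sigma>] DisjE.IH(2)[of \<sigma>] DisjE.IH(3)[of \<sigma>] show ?case
    by (auto intro: derives.DisjE)
next
  case (Assm \<phi> \<Gamma>) then show ?case by (auto intro: derives.Assm)
next
  case (ImpI \<phi> \<Gamma> \<psi>) then show ?case by (auto intro: derives.ImpI)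
next
  case (ImpE \<Gamma> \<phi> \<psi>) then show ?case by (metis derives.ImpE subst.simps(6))
next
  case (Raa \<phi> \<Gamma>) then show ?case by (auto intro: derives.Raa)
next
  case (ConjI \<Gamma> \<phi> \<psi>) then show ?case by (auto intro: derives.ConjI)
next
  case (ConjE1 \<Gamma> \<phi> \<psi>) then show ?case by (metis derives.ConjE1 subst.simps(4))
next
  case (ConjE2 \<Gamma> \<phi> \<psi>) then show ?case by (metis derives.ConjE2 subst.simps(4))
next
  case (DisjI1 \<Gamma> \<phi> \<psi>) then show ?case by (auto intro: derives.DisjI1)
next
  case (DisjI2 \<Gamma> \<phi> \<psi>) then show ?case by (auto intro: derives.DisjI2)
next
  case (EqRefl \<Gamma> t) show ?case by (simp add: derives.EqRefl)
qed

section \<open>Semantics and soundness\<close>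

primrec eval :: "(pv \<Rightarrow> 'a list \<Rightarrow> 'a) \<Rightarrow> (nat \<Rightarrow> 'a) \<Rightarrow> tm \<Rightarrow> 'a" where
  "eval I \<nu> (Var n) = \<nu> n"
| "eval I \<nu> (App f ts) = I f (map (eval I \<nu>) ts)"

abbreviation ext :: "'a \<Rightarrow> (nat \<Rightarrow> 'a) \<Rightarrow> nat \<Rightarrow> 'a" (infixr "##" 65)
  where "x ## \<nu> \<equiv> case_nat x \<nu>"

primrec sat :: "(pv \<Rightarrow> 'a list \<Rightarrow> 'a) \<Rightarrow> ('a \<Rightarrow> 'a \<Rightarrow> bool) \<Rightarrow> (nat \<Rightarrow> 'a) \<Rightarrow> fm \<Rightarrow> bool" where
  "sat I L \<nu> (s \<doteq> t) \<longleftrightarrow> eval I \<nu> s = eval I \<nu> t"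
| "sat I L \<nu> (s \<preceq> t) \<longleftrightarrow> L (eval I \<nu> s) (eval I \<nu> t)"
| "sat I L \<nu> Fls \<longleftrightarrow> False"
| "sat I L \<nu> (\<phi> \<^bold>\<and> \<psi>) \<longleftrightarrow> sat I L \<nu> \<phi> \<and> sat I L \<nu> \<psi>"
| "sat I L \<nu> (\<phi> \<^bold>\<or> \<psi>) \<longleftrightarrow> sat I L \<nu> \<phi> \<or> sat I L \<nu> \<psi>"
| "sat I L \<nu> (\<phi> \<^bold>\<longrightarrow> \<psi>) \<longleftrightarrow> (sat I L \<nu> \<phi> \<longrightarrow> sat I L \<nu> \<psi>)"
| "sat I L \<nu> (Forall \<phi>) \<longleftrightarrow> (\<forall>x. sat I L (x ## \<nu>) \<phi>)"
| "sat I L \<nu> (Exists \<phi>) \<longleftrightarrow> (\<exists>x. sat I L (x ## \<nu>) \<phi>)"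

lemma eval_subst: "eval I \<nu> (subst_tm \<sigma> t) = eval I (\<lambda>n. eval I \<nu> (\<sigma> n)) t"
  by (induction t) (auto simp: comp_def cong: map_cong)

lemma eval_lift [simp]: "eval I (x ## \<nu>) (lift_tm t) = eval I \<nu> t"
  by (simp add: lift_tm_def eval_subst)

lemma eval_up: "(\<lambda>n. eval I (x ## \<nu>) (up \<sigma> n)) = x ## (\<lambda>n. eval I \<nu> (\<sigma> n))"
  by (auto simp: up_def split: nat.split)

lemma sat_subst: "sat I L \<nu> (subst \<sigma> \<phi>) = sat I L (\<lambda>n. eval I \<nu> (\<sigma> n)) \<phi>"
  by (induction \<phi> arbitrary: \<nu> \<sigma>) (auto simp: eval_subst eval_up)

lemma sat_lift [simp]: "sat I L (x ## \<nu>) (lift \<phi>) = sat I L \<nu> \<phi>"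
  by (simp add: lift_def sat_subst)

lemma sat_inst1: "sat I L \<nu> (inst [t] 0 \<phi>) = sat I L (eval I \<nu> t ## \<nu>) \<phi>"
proof -
  have "(\<lambda>n. eval I \<nu> (case n of 0 \<Rightarrow> t | Suc m \<Rightarrow> Var m)) = eval I \<nu> t ## \<nu>"
    by (auto split: nat.split)
  then show ?thesis by (simp add: inst1 sat_subst)
qed

lemma soundness: "derives \<Gamma> \<phi> \<Longrightarrow> (\<And>\<psi>. \<psi> \<in> \<Gamma> \<Longrightarrow> sat I L \<nu> \<psi>) \<Longrightarrow> sat I L \<nu> \<phi>"
proof (induction arbitrary: \<nu> rule: derives.induct)
  case (ForallI \<Gamma> \<phi>)
  have "sat I L (x ## \<nu>) \<phi>" for x
    by (rule ForallI.IH) (use ForallI.prems in auto)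
  then show ?case by simp
next
  case (ExistsE \<Gamma> \<phi> \<psi>)
  then obtain x where "sat I L (x ## \<nu>) \<phi>" by fastforce
  then have "sat I L (x ## \<nu>) (lift \<psi>)"
    by (intro ExistsE.IH(2)) (use ExistsE.prems in auto)
  then show ?case by simp
next
  case (Raa \<phi> \<Gamma>)
  show ?case
  proof (rule ccontr)
    assume "\<not> sat I L \<nu> \<phi>"
    then have "sat I L \<nu> Fls"
      by (intro Raa.IH) (use Raa.prems in auto)
    then show False by simp
  qed
qed (auto simp: sat_inst1)

section \<open>Universal closures\<close>

lemma finite_fv_tm [simp]: "finite (fv_tm t)"
  by (induction t) auto

lemma finite_fv [simp]: "finite (fv \<phi>)"
proof (induction \<phi>)
  case (Forall \<phi>)
  have "{n. Suc n \<in> fv \<phi>} = Suc -` fv \<phi>" by auto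
  with Forall show ?case by (simp add: finite_vimageI)
next
  case (Exists \<phi>)
  have "{n. Suc n \<in> fv \<phi>} = Suc -` fv \<phi>" by auto
  with Exists show ?case by (simp add: finite_vimageI)
qed auto

lemma fv_funpow_Forall: "fv ((Forall ^^ n) \<phi>) = {m. m + n \<in> fv \<phi>}"
  by (induction n) auto

lemma universal_closures_fv: "\<phi> \<in> universal_closures A \<Longrightarrow> fv \<phi> = {}"
  by (fastforce simp: universal_closures_def fv_funpow_Forall)

text \<open>Every valuation is its value at 0 put in front of its tail, so a quantifier over all
  valuations absorbs a leading universal quantifier.\<close>

lemma sat_funpow_Forall: "(\<forall>\<nu>. sat I L \<nu> ((Forall ^^ n) \<phi>)) \<longleftrightarrow> (\<forall>\<nu>. sat I L \<nu> \<phi>)"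
proof (induction n)
  case (Suc n)
  have *: "\<nu> = \<nu> 0 ## (\<lambda>n. \<nu> (Suc n))" for \<nu> :: "nat \<Rightarrow> 'a" by (auto split: nat.split)
  have "(\<forall>\<nu>. sat I L \<nu> (Forall ((Forall ^^ n) \<phi>))) \<longleftrightarrow> (\<forall>\<nu>. sat I L \<nu> ((Forall ^^ n) \<phi>))"
    by (simp, metis *)
  with Suc show ?case by simp
qed simp

lemma sat_universal_closures:
  "(\<forall>\<phi> \<in> universal_closures A. \<forall>\<nu>. sat I L \<nu> \<phi>) \<longleftrightarrow> (\<forall>\<phi> \<in> A. \<forall>\<nu>. sat I L \<nu> \<phi>)"
proof
  assume *: "\<forall>\<phi> \<in> universal_closures A. \<forall>\<nu>. sat I L \<nu> \<phi>"
  show "\<forall>\<phi> \<in> A. \<forall>\<nu>. sat I L \<nu> \<phi>"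
  proof
    fix \<phi> assume "\<phi> \<in> A"
    obtain n where "fv \<phi> \<subseteq> {..<n}" using finite_fv by (metis finite_nat_iff_bounded)
    with \<open>\<phi> \<in> A\<close> have "(Forall ^^ n) \<phi> \<in> universal_closures A" by (auto simp: universal_closures_def)
    with * show "\<forall>\<nu>. sat I L \<nu> \<phi>" using sat_funpow_Forall by blast
  qed
next
  assume "\<forall>\<phi> \<in> A. \<forall>\<nu>. sat I L \<nu> \<phi>"
  then show "\<forall>\<phi> \<in> universal_closures A. \<forall>\<nu>. sat I L \<nu> \<phi>"
    unfolding universal_closures_def using sat_funpow_Forall by blast
qed

section \<open>Completeness\<close>

lemma derives_weaken: "derives \<Gamma> \<phi> \<Longrightarrow> derives (insert \<psi> \<Gamma>) \<phi>"
  by (erule derives_mono) blast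

lemma derives_cut: "derives \<Gamma> \<phi> \<Longrightarrow> derives (insert \<phi> \<Gamma>) \<psi> \<Longrightarrow> derives \<Gamma> \<psi>"
  by (metis derives.ImpI derives.ImpE)

lemma derives_Fls: "derives \<Gamma> Fls \<Longrightarrow> derives \<Gamma> \<phi>"
  by (metis derives.Raa derives_weaken)

text \<open>The substitution that sends \<open>m\<close> to \<open>Var 0\<close> and shifts all
  other variables turns the witnessing instance back into \<open>\<psi>\<close> and acts as
  \<open>lift\<close> on every formula in which \<open>m\<close> is not free. The given refutation
  thereby becomes the second premise of \<open>ExistsE\<close>.\<close>

lemma consistent_witness:
  assumes "derives (insert (inst [Var m] 0 \<psi>) (insert (Exists \<psi>) \<Gamma>)) Fls"
    and fresh: "m \<notin> fv (Exists \<psi>)" "\<And>\<phi>. \<phi> \<in> \<Gamma> \<Longrightarrow> m \<notin> fv \<phi>"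
  shows "derives (insert (Exists \<psi>) \<Gamma>) Fls"
proof -
  define \<sigma> where "\<sigma> = (\<lambda>n. if n = m then Var 0 else Var (Suc n))"
  have *: "subst \<sigma> \<phi> = lift \<phi>" if "m \<notin> fv \<phi>" for \<phi>
    unfolding lift_def by (rule subst_cong) (use that in \<open>auto simp: \<sigma>_def\<close>)
  have "subst \<sigma> (inst [Var m] 0 \<psi>) = subst Var \<psi>"
    unfolding inst1 subst_subst by (rule subst_cong) (use fresh(1) in \<open>auto simp: \<sigma>_def split: nat.split\<close>)
  then have inst: "subst \<sigma> (inst [Var m] 0 \<psi>) = \<psi>" by simp
  have "subst \<sigma> ` insert (Exists \<psi>) \<Gamma> = lift ` insert (Exists \<psi>) \<Gamma>"
    by (rule image_cong) (use fresh * in \<open>auto simp del: fv.simps\<close>)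
  then have "derives (insert \<psi> (lift ` insert (Exists \<psi>) \<Gamma>)) (lift Fls)"
    using derives_subst[OF assms(1), of \<sigma>] inst by (simp add: lift_def)
  then show ?thesis by (rule derives.ExistsE[OF derives.Assm, rotated]) simp
qed

section \<open>Provable equality as a congruence\<close>

lemma derives_subst_eq:
  "derives \<Gamma> (s \<doteq> t) \<Longrightarrow> derives \<Gamma> (subst (case_nat s Var) \<phi>) \<Longrightarrow> derives \<Gamma> (subst (case_nat t Var) \<phi>)"
  using derives.EqSubst by (simp add: inst1)

lemma lift_tm_inst [simp]: "subst_tm (case_nat s Var) (lift_tm t) = t"
  by (simp add: lift_tm_def subst_tm_subst_tm)

lemma derives_sym: "derives \<Gamma> (s \<doteq> t) \<Longrightarrow> derives \<Gamma> (t \<doteq> s)"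
  using derives_subst_eq[of \<Gamma> s t "Var 0 \<doteq> lift_tm s"] by (simp add: derives.EqRefl)

lemma derives_trans: "derives \<Gamma> (s \<doteq> t) \<Longrightarrow> derives \<Gamma> (t \<doteq> u) \<Longrightarrow> derives \<Gamma> (s \<doteq> u)"
  using derives_subst_eq[of \<Gamma> t u "lift_tm s \<doteq> Var 0"] by simp

lemma derives_Le_cong:
  assumes "derives \<Gamma> (s \<doteq> s')" "derives \<Gamma> (t \<doteq> t')" "derives \<Gamma> (s \<preceq> t)"
  shows "derives \<Gamma> (s' \<preceq> t')"
  using derives_subst_eq[of \<Gamma> s s' "Var 0 \<preceq> lift_tm t"]
    derives_subst_eq[of \<Gamma> t t' "lift_tm s' \<preceq> Var 0"] assms by simp

text \<open>The arguments are exchanged one at a time from the left; the prefix \<open>us\<close>,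
  which holds those already exchanged, makes the induction go through.\<close>

lemma derives_App_cong:
  assumes "list_all2 (\<lambda>s t. derives \<Gamma> (s \<doteq> t)) ss ts"
  shows "derives \<Gamma> (App f (us @ ss) \<doteq> App f (us @ ts))"
  using assms
proof (induction arbitrary: us rule: list_all2_induct)
  case Nil show ?case by (simp add: derives.EqRefl)
next
  case (Cons s ss t ts)
  have "derives \<Gamma> (App f (us @ s # ss) \<doteq> App f (us @ t # ss))"
    using derives_subst_eq[OF Cons.hyps(1),
        of "lift_tm (App f (us @ s # ss)) \<doteq> App f (map lift_tm us @ Var 0 # map lift_tm ss)"]
    by (simp add: comp_def derives.EqRefl)
  with Cons.IH[of "us @ [t]"] show ?case by (auto intro: derives_trans)
qed

text \<open>Completion and witnessing in one step. The witness is a free variable of the unchanged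
  language, namely the least one that is not free in any formula present.\<close>

definition extend :: "fm set \<Rightarrow> fm \<Rightarrow> fm set" where
  "extend \<Gamma> \<phi> = (if derives (insert \<phi> \<Gamma>) Fls then \<Gamma>
     else insert \<phi> \<Gamma> \<union>
       {inst [Var m] 0 \<psi> |\<psi> m. \<phi> = Exists \<psi> \<and> m = (LEAST m. \<forall>\<chi> \<in> insert \<phi> \<Gamma>. m \<notin> fv \<chi>)})"

text \<open>Guarantees a fresh variable at each stage. It holds at the start, where all but one
  formula are closed, and each stage adds at most two formulas; the limit need not satisfy
  it.\<close>

definition bounded_fv :: "fm set \<Rightarrow> bool" where
  "bounded_fv \<Gamma> \<longleftrightarrow> (\<exists>N. \<forall>\<phi> \<in> \<Gamma>. fv \<phi> \<subseteq> {..<N})"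

lemma bounded_fv_insert: "bounded_fv \<Gamma> \<Longrightarrow> bounded_fv (insert \<phi> \<Gamma>)"
proof -
  assume "bounded_fv \<Gamma>"
  then obtain N where "\<forall>\<phi> \<in> \<Gamma>. fv \<phi> \<subseteq> {..<N}" by (auto simp: bounded_fv_def)
  moreover obtain M where "fv \<phi> \<subseteq> {..<M}" using finite_fv by (metis finite_nat_iff_bounded)
  ultimately have "\<forall>\<chi> \<in> insert \<phi> \<Gamma>. fv \<chi> \<subseteq> {..<max M N}" by fastforce
  then show ?thesis unfolding bounded_fv_def by blast
qed

lemma extend_Exists:
  assumes "bounded_fv \<Gamma>" "\<not> derives (insert (Exists \<psi>) \<Gamma>) Fls"
  obtains m where "extend \<Gamma> (Exists \<psi>) = insert (inst [Var m] 0 \<psi>) (insert (Exists \<psi>) \<Gamma>)"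
    "m \<notin> fv (Exists \<psi>)" "\<And>\<phi>. \<phi> \<in> \<Gamma> \<Longrightarrow> m \<notin> fv \<phi>"
proof -
  let ?P = "\<lambda>m. \<forall>\<chi> \<in> insert (Exists \<psi>) \<Gamma>. m \<notin> fv \<chi>"
  obtain N where "\<forall>\<chi> \<in> insert (Exists \<psi>) \<Gamma>. fv \<chi> \<subseteq> {..<N}"
    using bounded_fv_insert[OF assms(1)] unfolding bounded_fv_def by blast
  then have "?P N" by fastforce
  then have "?P (LEAST m. ?P m)" by (rule LeastI)
  moreover have "extend \<Gamma> (Exists \<psi>) = insert (inst [Var (LEAST m. ?P m)] 0 \<psi>) (insert (Exists \<psi>) \<Gamma>)"
    using assms(2) by (auto simp: extend_def)
  ultimately show ?thesis using that by blast
qed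

lemma extend:
  assumes "bounded_fv \<Gamma>" "\<not> derives \<Gamma> Fls"
  shows "\<Gamma> \<subseteq> extend \<Gamma> \<phi>" "bounded_fv (extend \<Gamma> \<phi>)" "\<not> derives (extend \<Gamma> \<phi>) Fls"
proof -
  show "\<Gamma> \<subseteq> extend \<Gamma> \<phi>" by (auto simp: extend_def)
  have "bounded_fv (extend \<Gamma> \<phi>) \<and> \<not> derives (extend \<Gamma> \<phi>) Fls"
  proof (cases "derives (insert \<phi> \<Gamma>) Fls")
    case True then show ?thesis using assms by (simp add: extend_def)
  next
    case False
    show ?thesis
    proof (cases "\<exists>\<psi>. \<phi> = Exists \<psi>")
      case True
      then obtain \<psi> where [simp]: "\<phi> = Exists \<psi>" by blast
      obtain m where "extend \<Gamma> \<phi> = insert (inst [Var m] 0 \<psi>) (insert (Exists \<psi>) \<Gamma>)"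
        "m \<notin> fv (Exists \<psi>)" "\<And>\<chi>. \<chi> \<in> \<Gamma> \<Longrightarrow> m \<notin> fv \<chi>"
        using extend_Exists[OF assms(1), of \<psi>] False by (metis True \<open>\<phi> = Exists \<psi>\<close>)
      with consistent_witness[of m \<psi> \<Gamma>] False show ?thesis
        using assms(1) by (auto intro!: bounded_fv_insert simp del: fv.simps)
    next
      case no: False
      with \<open>\<not> derives (insert \<phi> \<Gamma>) Fls\<close> have "extend \<Gamma> \<phi> = insert \<phi> \<Gamma>" by (auto simp: extend_def)
      with False assms show ?thesis by (simp add: bounded_fv_insert)
    qed
  qed
  then show "bounded_fv (extend \<Gamma> \<phi>)" "\<not> derives (extend \<Gamma> \<phi>) Fls" by auto
qed

lemma Henkin_extension:
  assumes "bounded_fv \<Gamma>" "\<not> derives \<Gamma> Fls"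
  obtains H where "\<Gamma> \<subseteq> H" "\<not> derives H Fls" "\<And>\<phi>. \<phi> \<in> H \<or> (\<^bold>\<not> \<phi>) \<in> H"
    "\<And>\<phi>. derives H \<phi> \<Longrightarrow> \<phi> \<in> H" "\<And>\<psi>. Exists \<psi> \<in> H \<Longrightarrow> \<exists>t. inst [t] 0 \<psi> \<in> H"
proof -
  \<comment> \<open>The formula \<open>\<phi>\<close> is decided at stage
    \<open>to_nat \<phi>\<close>, so the outcome can be read off the following stage.\<close>
  define F where "F n = rec_nat \<Gamma> (\<lambda>n \<Delta>. extend \<Delta> (from_nat n)) n" for n
  have F0: "F 0 = \<Gamma>" and FS: "F (Suc n) = extend (F n) (from_nat n)" for n by (simp_all add: F_def)
  have inv: "bounded_fv (F n) \<and> \<not> derives (F n) Fls" for n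
    by (induction n) (use assms extend in \<open>auto simp: F0 FS\<close>)
  have "F n \<subseteq> F (Suc n)" for n using inv[of n] extend(1) by (simp add: FS)
  then have mono: "m \<le> n \<Longrightarrow> F m \<subseteq> F n" for m n by (rule lift_Suc_mono_le)
  define H where "H = (\<Union>n. F n)"
  have FH: "F n \<subseteq> H" for n by (auto simp: H_def)
  have cons: "\<not> derives H Fls"
  proof
    assume "derives H Fls"
    then obtain \<Delta> where \<Delta>: "finite \<Delta>" "\<Delta> \<subseteq> H" "derives \<Delta> Fls" using derives_finite by blast
    from \<Delta>(1,2) have "\<exists>n. \<Delta> \<subseteq> F n"
    proof induction
      case (insert \<phi> \<Delta>)
      then obtain n m where "\<Delta> \<subseteq> F n" "\<phi> \<in> F m" by (auto simp: H_def)
      then show ?case using mono[of n "max m n"] mono[of m "max m n"] by (intro exI[of _ "max m n"]) auto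
    qed simp
    with \<Delta>(3) inv derives_mono show False by blast
  qed
  have closed: "\<phi> \<in> H" if "derives H \<phi>" for \<phi>
  proof (cases "derives (insert \<phi> (F (to_nat \<phi>))) Fls")
    case True
    then have "derives (insert \<phi> H) Fls" using FH by (blast intro: derives_mono)
    with that cons derives_cut show ?thesis by blast
  next
    case False
    then have "\<phi> \<in> F (Suc (to_nat \<phi>))" by (simp add: FS extend_def)
    with FH show ?thesis by blast
  qed
  have neg: "\<phi> \<in> H \<or> (\<^bold>\<not> \<phi>) \<in> H" for \<phi>
  proof (cases "derives (insert \<phi> (F (to_nat \<phi>))) Fls")
    case True
    then have "derives (insert \<phi> H) Fls" using FH by (blast intro: derives_mono)
    with closed derives.ImpI show ?thesis by blast
  next
    case False
    then have "\<phi> \<in> F (Suc (to_nat \<phi>))" by (simp add: FS extend_def)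
    with FH show ?thesis by blast
  qed
  have "\<exists>t. inst [t] 0 \<psi> \<in> H" if "Exists \<psi> \<in> H" for \<psi>
  proof -
    have nd: "\<not> derives (insert (Exists \<psi>) (F (to_nat (Exists \<psi>)))) Fls"
      using derives_mono[of "insert (Exists \<psi>) (F (to_nat (Exists \<psi>)))" Fls H] cons that FH by blast
    from extend_Exists[OF _ nd] inv obtain m where
      "extend (F (to_nat (Exists \<psi>))) (Exists \<psi>) = insert (inst [Var m] 0 \<psi>) (insert (Exists \<psi>) (F (to_nat (Exists \<psi>))))"
      by metis
    then have "inst [Var m] 0 \<psi> \<in> F (Suc (to_nat (Exists \<psi>)))" by (simp add: FS)
    with FH show ?thesis by blast
  qed
  with that[of H] FH[of 0] F0 cons closed neg show ?thesis by blast
qed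

text \<open>The numerals are required to be distinct so that the term model is infinite and can be moved to \<^typ>\<open>nat\<close>.\<close>

theorem completeness:
  fixes \<Gamma> :: "fm set"
  assumes closed: "\<And>\<phi>. \<phi> \<in> \<Gamma> \<Longrightarrow> fv \<phi> = {}"
    and infinite: "\<And>m n. m < n \<Longrightarrow> derives \<Gamma> (\<^bold>\<not> ((\<S> ^^ m) \<zero> \<doteq> (\<S> ^^ n) \<zero>))"
    and valid: "\<And>(I :: pv \<Rightarrow> nat list \<Rightarrow> nat) L \<nu>. (\<And>\<psi> \<nu>. \<psi> \<in> \<Gamma> \<Longrightarrow> sat I L \<nu> \<psi>) \<Longrightarrow> sat I L \<nu> \<phi>"
  shows "derives \<Gamma> \<phi>"
proof (rule ccontr)
  assume nd: "\<not> derives \<Gamma> \<phi>"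
  then have "\<not> derives (insert (\<^bold>\<not> \<phi>) \<Gamma>) Fls" using derives.Raa by blast
  moreover have "bounded_fv (insert (\<^bold>\<not> \<phi>) \<Gamma>)"
    by (rule bounded_fv_insert) (use closed in \<open>auto simp: bounded_fv_def\<close>)
  ultimately obtain H where H: "insert (\<^bold>\<not> \<phi>) \<Gamma> \<subseteq> H" and cons: "\<not> derives H Fls"
    and max: "\<And>\<phi>. \<phi> \<in> H \<or> (\<^bold>\<not> \<phi>) \<in> H" and ded: "\<And>\<phi>. derives H \<phi> \<Longrightarrow> \<phi> \<in> H"
    and wit: "\<And>\<psi>. Exists \<psi> \<in> H \<Longrightarrow> \<exists>t. inst [t] 0 \<psi> \<in> H"
    using Henkin_extension by metis
  have dH: "derives H \<psi> \<longleftrightarrow> \<psi> \<in> H" for \<psi> using ded derives.Assm by blast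
  have negH: "(\<^bold>\<not> \<psi>) \<in> H \<longleftrightarrow> \<psi> \<notin> H" for \<psi> using max cons derives.ImpE derives.Assm by blast
  \<comment> \<open>\<open>c t\<close> is a canonical representative of the class of
    \<open>t\<close> under equality in \<open>H\<close>: for equal terms the predicates under
    \<open>SOME\<close> coincide.\<close>
  define c where "c t = (SOME s. (s \<doteq> t) \<in> H)" for t
  have c1: "(c t \<doteq> t) \<in> H" for t
    unfolding c_def by (rule someI[of _ t]) (simp add: ded derives.EqRefl)
  have sym: "(s \<doteq> t) \<in> H \<Longrightarrow> (t \<doteq> s) \<in> H" for s t using derives_sym dH by blast
  have trans: "(s \<doteq> t) \<in> H \<Longrightarrow> (t \<doteq> u) \<in> H \<Longrightarrow> (s \<doteq> u) \<in> H" for s t u using derives_trans dH by blast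
  have ceq: "c s = c t \<longleftrightarrow> (s \<doteq> t) \<in> H" for s t
  proof
    assume "c s = c t" then show "(s \<doteq> t) \<in> H" using c1 sym trans by metis
  next
    assume *: "(s \<doteq> t) \<in> H"
    have "(u \<doteq> s) \<in> H \<longleftrightarrow> (u \<doteq> t) \<in> H" for u using * sym trans by blast
    then show "c s = c t" by (simp add: c_def)
  qed
  have "infinite (range c)"
  proof -
    have "c ((\<S> ^^ m) \<zero>) \<noteq> c ((\<S> ^^ n) \<zero>)" if "m < n" for m n
    proof -
      have "\<Gamma> \<subseteq> H" using H by blast
      from derives_mono[OF infinite[OF that] this] show ?thesis unfolding dH negH ceq .
    qed
    then have "inj (\<lambda>n. c ((\<S> ^^ n) \<zero>))"
      by (intro injI) (metis linorder_neqE_nat)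
    then have "infinite (range (\<lambda>n. c ((\<S> ^^ n) \<zero>)))" by (rule range_inj_infinite)
    then show ?thesis by (rule contrapos_nn) (erule finite_subset[rotated], blast)
  qed
  \<comment> \<open>The set of representatives is countable and infinite, so it can be numbered by
    \<open>nat\<close>. \<open>r\<close> takes a number to its representative, and \<open>e\<close>
    takes a term to the number of its class.\<close>
  then obtain r :: "nat \<Rightarrow> tm" where r: "bij_betw r UNIV (range c)"
    using bij_betw_from_nat_into[of "range c"] by auto
  then have rr: "range r = range c" by (simp add: bij_betw_def)
  define e where "e t = inv r (c t)" for t
  have re: "r (e t) = c t" for t
    unfolding e_def by (rule f_inv_into_f) (unfold rr, rule rangeI)
  have ee: "e s = e t \<longleftrightarrow> (s \<doteq> t) \<in> H" for s t
  proof -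
    have "e s = e t \<longleftrightarrow> c s = c t"
    proof
      assume "e s = e t"
      then have "r (e s) = r (e t)" by simp
      then show "c s = c t" by (simp only: re)
    qed (simp only: e_def)
    with ceq show ?thesis by blast
  qed
  have er: "e (r n) = n" for n
  proof -
    obtain t where t: "r n = c t" using rr by (metis rangeE rangeI)
    have "e (c t) = e t" using ee c1 by blast
    then have "r (e (r n)) = r n" by (simp only: t re)
    then show ?thesis using bij_betw_imp_inj_on[OF r] by (simp only: inj_eq)
  qed
  define I where "I f ns = e (App f (map r ns))" for f ns
  define L where "L m n \<longleftrightarrow> (r m \<preceq> r n) \<in> H" for m n
  have reH: "(r (e t) \<doteq> t) \<in> H" for t using re c1 by simp
  have ev: "eval I (\<lambda>n. e (\<sigma> n)) t = e (subst_tm \<sigma> t)" for \<sigma> t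
  proof (induction t)
    case (App f ts)
    have "map (eval I (\<lambda>n. e (\<sigma> n))) ts = map (\<lambda>t. e (subst_tm \<sigma> t)) ts"
      using App by (intro map_cong) simp_all
    then have "eval I (\<lambda>n. e (\<sigma> n)) (App f ts) = e (App f (map (\<lambda>t. r (e (subst_tm \<sigma> t))) ts))"
      by (simp only: eval.simps I_def map_map comp_def)
    also have "\<dots> = e (App f (map (subst_tm \<sigma>) ts))"
      unfolding ee dH[symmetric]
      using derives_App_cong[of H "map (\<lambda>t. r (e (subst_tm \<sigma> t))) ts" "map (subst_tm \<sigma>) ts" f "[]"]
      by (simp add: list_all2_conv_all_nth dH reH)
    finally show ?case by simp
  qed simp
  have truth: "sat I L (\<lambda>n. e (\<sigma> n)) \<psi> \<longleftrightarrow> subst \<sigma> \<psi> \<in> H" for \<sigma> \<psi>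
  proof (induction \<psi> arbitrary: \<sigma>)
    case (Eq s t) then show ?case by (simp add: ev ee)
  next
    case (Le s t)
    have "(r (e s) \<preceq> r (e t)) \<in> H \<longleftrightarrow> (s \<preceq> t) \<in> H" for s t
      using derives_Le_cong[of H "r (e s)" s "r (e t)" t] derives_Le_cong[of H s "r (e s)" t "r (e t)"]
      unfolding dH using reH[of s] reH[of t] sym[OF reH[of s]] sym[OF reH[of t]] by blast
    then show ?case by (simp add: ev L_def)
  next
    case Fls then show ?case using cons dH by simp
  next
    case (Conj \<phi> \<psi>)
    then show ?case by simp (metis dH derives.ConjI derives.ConjE1 derives.ConjE2)
  next
    case (Disj \<phi> \<psi>)
    have *: "(a \<^bold>\<or> b) \<in> H \<longleftrightarrow> a \<in> H \<or> b \<in> H" for a b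
    proof
      assume "(a \<^bold>\<or> b) \<in> H"
      then have d: "derives H (a \<^bold>\<or> b)" using dH by blast
      show "a \<in> H \<or> b \<in> H"
      proof (rule ccontr)
        assume "\<not> (a \<in> H \<or> b \<in> H)"
        then have "derives H (\<^bold>\<not> a)" "derives H (\<^bold>\<not> b)" using dH negH by blast+
        then have "derives (insert a H) Fls" "derives (insert b H) Fls"
          by (meson derives.ImpE derives.Assm derives_weaken insertI1)+
        with d cons show False using derives.DisjE by blast
      qed
    next
      assume "a \<in> H \<or> b \<in> H" then show "(a \<^bold>\<or> b) \<in> H"
        using dH derives.DisjI1 derives.DisjI2 by metis
    qed
    from Disj show ?case by (simp add: *)
  next
    case (Imp \<phi> \<psi>)
    have *: "(a \<^bold>\<longrightarrow> b) \<in> H \<longleftrightarrow> (a \<in> H \<longrightarrow> b \<in> H)" for a b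
    proof
      assume "(a \<^bold>\<longrightarrow> b) \<in> H"
      then show "a \<in> H \<longrightarrow> b \<in> H" using dH derives.ImpE by metis
    next
      assume *: "a \<in> H \<longrightarrow> b \<in> H"
      have "derives (insert a H) b"
      proof (cases "a \<in> H")
        case True
        with * dH derives_weaken show ?thesis by blast
      next
        case False
        then have "derives H (\<^bold>\<not> a)" using dH negH by blast
        then have "derives (insert a H) Fls"
          by (meson derives.ImpE derives.Assm derives_weaken insertI1)
        then show ?thesis by (rule derives_Fls)
      qed
      then show "(a \<^bold>\<longrightarrow> b) \<in> H" using dH derives.ImpI by blast
    qed
    from Imp show ?case by (simp add: *)
  next
    case (Exists \<psi>)
    have env: "(x ## (\<lambda>n. e (\<sigma> n))) = (\<lambda>n. e ((case_nat (r x) \<sigma>) n))" for x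
      by (auto simp: er split: nat.split)
    have inst: "subst (case_nat t \<sigma>) \<psi> = inst [t] 0 (subst (up \<sigma>) \<psi>)" for t
      unfolding inst1 subst_subst by (rule subst_cong) (auto simp: up_def split: nat.split)
    have "sat I L (\<lambda>n. e (\<sigma> n)) (Exists \<psi>) \<longleftrightarrow> (\<exists>x. inst [r x] 0 (subst (up \<sigma>) \<psi>) \<in> H)"
      unfolding sat.simps env Exists.IH inst ..
    also have "\<dots> \<longleftrightarrow> Exists (subst (up \<sigma>) \<psi>) \<in> H"
    proof
      assume "\<exists>x. inst [r x] 0 (subst (up \<sigma>) \<psi>) \<in> H"
      then show "Exists (subst (up \<sigma>) \<psi>) \<in> H" using derives.ExistsI dH by blast
    next
      assume "Exists (subst (up \<sigma>) \<psi>) \<in> H"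
      then obtain t where "inst [t] 0 (subst (up \<sigma>) \<psi>) \<in> H" using wit by blast
      then have "inst [r (e t)] 0 (subst (up \<sigma>) \<psi>) \<in> H"
        using derives.EqSubst dH reH sym by blast
      then show "\<exists>x. inst [r x] 0 (subst (up \<sigma>) \<psi>) \<in> H" by blast
    qed
    finally show ?case by simp
  next
    case (Forall \<psi>)
    have env: "(x ## (\<lambda>n. e (\<sigma> n))) = (\<lambda>n. e ((case_nat (r x) \<sigma>) n))" for x
      by (auto simp: er split: nat.split)
    have inst: "subst (case_nat t \<sigma>) \<psi> = inst [t] 0 (subst (up \<sigma>) \<psi>)" for t
      unfolding inst1 subst_subst by (rule subst_cong) (auto simp: up_def split: nat.split)
    define \<chi> where "\<chi> = subst (up \<sigma>) \<psi>"
    have "sat I L (\<lambda>n. e (\<sigma> n)) (Forall \<psi>) \<longleftrightarrow> (\<forall>x. inst [r x] 0 \<chi> \<in> H)"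
      unfolding sat.simps env Forall.IH inst \<chi>_def ..
    also have "\<dots> \<longleftrightarrow> Forall \<chi> \<in> H"
    proof
      assume all: "\<forall>x. inst [r x] 0 \<chi> \<in> H"
      have all': "inst [t] 0 \<chi> \<in> H" for t
        using all[rule_format, of "e t"] derives.EqSubst dH reH by blast
      show "Forall \<chi> \<in> H"
      proof (cases "Exists (\<^bold>\<not> \<chi>) \<in> H")
        case True
        then obtain t where "inst [t] 0 (\<^bold>\<not> \<chi>) \<in> H" using wit by blast
        then have "(\<^bold>\<not> (inst [t] 0 \<chi>)) \<in> H" by (simp add: inst_def)
        with all' negH show ?thesis by blast
      next
        case False
        \<comment> \<open>\<open>H\<close> contains the negation of the existential formula. Over
          the lifted context, the negation of \<open>\<chi>\<close> yields that existential formula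
          with \<open>Var 0\<close> as witness, a contradiction; hence \<open>\<chi>\<close> holds
          with \<open>Var 0\<close> as eigenvariable and can be generalized.\<close>
        let ?\<Delta> = "lift ` insert (\<^bold>\<not> (Exists (\<^bold>\<not> \<chi>))) H"
        have "inst [Var 0] 0 (subst (up (\<lambda>n. Var (Suc n))) \<chi>) = subst Var \<chi>"
          unfolding inst1 subst_subst
          by (rule subst_cong) (auto simp: up_def lift_tm_def split: nat.split)
        then have *: "inst [Var 0] 0 (subst (up (\<lambda>n. Var (Suc n))) (\<^bold>\<not> \<chi>)) = (\<^bold>\<not> \<chi>)"
          by (simp add: inst1)
        have "derives (insert (\<^bold>\<not> \<chi>) ?\<Delta>) (lift (Exists (\<^bold>\<not> \<chi>)))"
          unfolding lift_def subst.simps(8)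
          by (rule derives.ExistsI[of _ "Var 0"], unfold *) (simp add: derives.Assm)
        moreover have "derives (insert (\<^bold>\<not> \<chi>) ?\<Delta>) (\<^bold>\<not> (lift (Exists (\<^bold>\<not> \<chi>))))"
          by (rule derives.Assm) (simp add: lift_def)
        ultimately have "derives (insert (\<^bold>\<not> \<chi>) ?\<Delta>) Fls" by (metis derives.ImpE)
        then have "derives (insert (\<^bold>\<not> (Exists (\<^bold>\<not> \<chi>))) H) (Forall \<chi>)"
          by (rule derives.ForallI[OF derives.Raa])
        moreover have "insert (\<^bold>\<not> (Exists (\<^bold>\<not> \<chi>))) H = H" using False negH by blast
        ultimately show ?thesis using dH by simp
      qed
    next
      assume "Forall \<chi> \<in> H"
      then show "\<forall>x. inst [r x] 0 \<chi> \<in> H" using derives.ForallE dH by blast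
    qed
    finally show ?case by (simp add: \<chi>_def)
  qed
  have "sat I L \<nu> \<psi>" if "\<psi> \<in> \<Gamma>" for \<psi> \<nu>
  proof -
    have "\<nu> = (\<lambda>n. e (r (\<nu> n)))" by (simp add: er)
    moreover have "subst (\<lambda>n. r (\<nu> n)) \<psi> = subst Var \<psi>"
      by (rule subst_cong) (simp add: closed[OF that])
    ultimately show ?thesis using truth[of "\<lambda>n. r (\<nu> n)" \<psi>] H that by auto
  qed
  from valid[OF this] have "sat I L (\<lambda>n. e (Var n)) \<phi>" .
  with truth[of Var \<phi>] H negH show False by auto
qed

section \<open>Structures and definability\<close>

lemma sat_inst:
  "sat I L \<nu> (inst ts k \<phi>) =
     sat I L (\<lambda>n. if n < length ts then eval I \<nu> (ts ! n) else \<nu> (n - length ts + k)) \<phi>"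
  by (simp add: inst_def sat_subst if_distrib cong: if_cong)

lemma lift_subst_tm: "lift_tm (subst_tm \<sigma> t) = subst_tm (up \<sigma>) (lift_tm t)"
  by (simp add: lift_tm_def subst_tm_subst_tm up_def)

lemma subst_BAll: "subst \<sigma> (BAll t \<phi>) = BAll (subst_tm \<sigma> t) (subst (up \<sigma>) \<phi>)"
  by (simp add: BAll_def lift_subst_tm) (simp add: up_def)

lemma subst_BEx: "subst \<sigma> (BEx t \<phi>) = BEx (subst_tm \<sigma> t) (subst (up \<sigma>) \<phi>)"
  by (simp add: BEx_def lift_subst_tm) (simp add: up_def)

lemma wf_subst_tm: "wf_tm t \<Longrightarrow> (\<And>n. wf_tm (\<sigma> n)) \<Longrightarrow> wf_tm (subst_tm \<sigma> t)"
  by (induction t) auto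

lemma wf_up: "(\<And>n. wf_tm (\<sigma> n)) \<Longrightarrow> wf_tm (up \<sigma> n)"
  by (auto simp: up_def lift_tm_def intro: wf_subst_tm split: nat.split)

lemma sharply_bounded_subst:
  "sharply_bounded \<phi> \<Longrightarrow> (\<And>n. wf_tm (\<sigma> n)) \<Longrightarrow> sharply_bounded (subst \<sigma> \<phi>)"
  by (induction arbitrary: \<sigma> rule: sharply_bounded.induct)
    (auto simp: subst_BAll subst_BEx wf_subst_tm wf_up intro!: sharply_bounded.intros)

lemma sSigma_b_subst:
  "sSigma_b i \<phi> \<Longrightarrow> (\<And>n. wf_tm (\<sigma> n)) \<Longrightarrow> sSigma_b i (subst \<sigma> \<phi>)"
  "sPi_b i \<phi> \<Longrightarrow> (\<And>n. wf_tm (\<sigma> n)) \<Longrightarrow> sPi_b i (subst \<sigma> \<phi>)"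
  by (induction arbitrary: \<sigma> and \<sigma> rule: sSigma_b_sPi_b.inducts)
    (auto simp: subst_BAll subst_BEx wf_subst_tm wf_up sharply_bounded_subst
      intro!: sSigma_b_sPi_b.intros)

lemma sharply_bounded_Sigma_b:
  "sharply_bounded \<phi> \<Longrightarrow> Sigma_b i \<phi>" "sharply_bounded \<phi> \<Longrightarrow> Pi_b i \<phi>"
  by (induction i) (auto intro: Sigma_b_Pi_b.intros)

lemma quantifier_free_sharply_bounded: "quantifier_free \<phi> \<Longrightarrow> sharply_bounded \<phi>"
  by (induction \<phi>) (auto intro: sharply_bounded.intros)

locale pv_structure =
  fixes I :: "pv \<Rightarrow> 'a list \<Rightarrow> 'a" and L :: "'a \<Rightarrow> 'a \<Rightarrow> bool" (infix "\<sqsubseteq>" 50)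
begin

definition nul :: 'a where "nul = I Zero []"
definition suc :: "'a \<Rightarrow> 'a" where "suc x = I Succ [x]"
definition add :: "'a \<Rightarrow> 'a \<Rightarrow> 'a" (infixl "\<boxplus>" 65) where "x \<boxplus> y = I Add [x, y]"
definition mul :: "'a \<Rightarrow> 'a \<Rightarrow> 'a" (infixl "\<boxtimes>" 70) where "x \<boxtimes> y = I Mul [x, y]"
definition half :: "'a \<Rightarrow> 'a" where "half x = I Half [x]"
definition len :: "'a \<Rightarrow> 'a" where "len x = I Len [x]"
definition smash :: "'a \<Rightarrow> 'a \<Rightarrow> 'a" where "smash x y = I Smash [x, y]"
definition lt :: "'a \<Rightarrow> 'a \<Rightarrow> bool" (infix "\<sqsubset>" 50) where "x \<sqsubset> y \<longleftrightarrow> x \<sqsubseteq> y \<and> x \<noteq> y"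

abbreviation one :: 'a where "one \<equiv> suc nul"

lemmas ops = nul_def suc_def add_def mul_def half_def len_def smash_def
lemmas ops_fold [simp] = ops[symmetric]

text \<open>\<open>dt\<close> and \<open>sb\<close> concern functions and predicates of a whole
  valuation. Definability is then proved by introduction rules that follow a HOL expression, with
  all parameters carried along and no de Bruijn formulas written down.\<close>

definition dt :: "((nat \<Rightarrow> 'a) \<Rightarrow> 'a) \<Rightarrow> bool" where
  "dt T \<longleftrightarrow> (\<exists>t. wf_tm t \<and> (\<forall>\<nu>. eval I \<nu> t = T \<nu>))"

definition sb :: "((nat \<Rightarrow> 'a) \<Rightarrow> bool) \<Rightarrow> bool" where
  "sb P \<longleftrightarrow> (\<exists>\<phi>. sharply_bounded \<phi> \<and> (\<forall>\<nu>. sat I L \<nu> \<phi> = P \<nu>))"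

lemma dt_var: "dt (\<lambda>\<nu>. \<nu> n)"
  unfolding dt_def by (rule exI[of _ "Var n"]) simp

lemma dt_app:
  assumes "wf_pv f" "arity f = length Ts" "\<And>T. T \<in> set Ts \<Longrightarrow> dt T"
  shows "dt (\<lambda>\<nu>. I f (map (\<lambda>T. T \<nu>) Ts))"
proof -
  obtain g where "wf_tm (g T) \<and> (\<forall>\<nu>. eval I \<nu> (g T) = T \<nu>)" if "T \<in> set Ts" for T
    using assms(3) unfolding dt_def by metis
  with assms(1,2) show ?thesis
    unfolding dt_def by (intro exI[of _ "App f (map g Ts)"]) (auto intro!: arg_cong[of _ _ "I f"])
qed

lemma dt_app0: "wf_pv f \<Longrightarrow> arity f = 0 \<Longrightarrow> dt (\<lambda>\<nu>. I f [])"
  using dt_app[of f "[]"] by simp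

lemma dt_app1: "wf_pv f \<Longrightarrow> arity f = 1 \<Longrightarrow> dt A \<Longrightarrow> dt (\<lambda>\<nu>. I f [A \<nu>])"
  using dt_app[of f "[A]"] by simp

lemma dt_app2: "wf_pv f \<Longrightarrow> arity f = 2 \<Longrightarrow> dt A \<Longrightarrow> dt B \<Longrightarrow> dt (\<lambda>\<nu>. I f [A \<nu>, B \<nu>])"
  using dt_app[of f "[A, B]"] by auto

lemma dt_app3:
  "wf_pv f \<Longrightarrow> arity f = 3 \<Longrightarrow> dt A \<Longrightarrow> dt B \<Longrightarrow> dt C \<Longrightarrow> dt (\<lambda>\<nu>. I f [A \<nu>, B \<nu>, C \<nu>])"
  using dt_app[of f "[A, B, C]"] by auto

lemma dt_nul: "dt (\<lambda>\<nu>. nul)" unfolding ops by (rule dt_app0) auto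
lemma dt_suc: "dt A \<Longrightarrow> dt (\<lambda>\<nu>. suc (A \<nu>))" unfolding ops by (rule dt_app1) auto
lemma dt_half: "dt A \<Longrightarrow> dt (\<lambda>\<nu>. half (A \<nu>))" unfolding ops by (rule dt_app1) auto
lemma dt_len: "dt A \<Longrightarrow> dt (\<lambda>\<nu>. len (A \<nu>))" unfolding ops by (rule dt_app1) auto
lemma dt_add: "dt A \<Longrightarrow> dt B \<Longrightarrow> dt (\<lambda>\<nu>. A \<nu> \<boxplus> B \<nu>)" unfolding ops by (rule dt_app2) auto
lemma dt_mul: "dt A \<Longrightarrow> dt B \<Longrightarrow> dt (\<lambda>\<nu>. A \<nu> \<boxtimes> B \<nu>)" unfolding ops by (rule dt_app2) auto
lemma dt_smash: "dt A \<Longrightarrow> dt B \<Longrightarrow> dt (\<lambda>\<nu>. smash (A \<nu>) (B \<nu>))" unfolding ops by (rule dt_app2) auto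

lemma dt_subst: "dt T \<Longrightarrow> (\<And>i. dt (\<sigma> i)) \<Longrightarrow> dt (\<lambda>\<nu>. T (\<lambda>i. \<sigma> i \<nu>))"
proof -
  assume T: "dt T" and *: "\<And>i. dt (\<sigma> i)"
  then obtain s where "\<And>i. wf_tm (s i) \<and> (\<forall>\<nu>. eval I \<nu> (s i) = \<sigma> i \<nu>)" unfolding dt_def by metis
  moreover obtain t where "wf_tm t" "\<And>\<nu>. eval I \<nu> t = T \<nu>" using T unfolding dt_def by auto
  ultimately show ?thesis
    unfolding dt_def by (intro exI[of _ "subst_tm s t"]) (auto simp: eval_subst wf_subst_tm)
qed

lemma sb_subst: "sb P \<Longrightarrow> (\<And>i. dt (\<sigma> i)) \<Longrightarrow> sb (\<lambda>\<nu>. P (\<lambda>i. \<sigma> i \<nu>))"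
proof -
  assume P: "sb P" and *: "\<And>i. dt (\<sigma> i)"
  then obtain s where "\<And>i. wf_tm (s i) \<and> (\<forall>\<nu>. eval I \<nu> (s i) = \<sigma> i \<nu>)" unfolding dt_def by metis
  moreover obtain \<phi> where "sharply_bounded \<phi>" "\<And>\<nu>. sat I L \<nu> \<phi> = P \<nu>" using P unfolding sb_def by auto
  ultimately show ?thesis
    unfolding sb_def by (intro exI[of _ "subst s \<phi>"]) (auto simp: sat_subst sharply_bounded_subst)
qed

lemma sb_eq: "dt A \<Longrightarrow> dt B \<Longrightarrow> sb (\<lambda>\<nu>. A \<nu> = B \<nu>)"
  unfolding dt_def sb_def by (metis sat.simps(1) sharply_bounded.intros(1))

lemma sb_le: "dt A \<Longrightarrow> dt B \<Longrightarrow> sb (\<lambda>\<nu>. A \<nu> \<sqsubseteq> B \<nu>)"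
  unfolding dt_def sb_def by (metis sat.simps(2) sharply_bounded.intros(2))

lemma sb_False: "sb (\<lambda>\<nu>. False)"
  unfolding sb_def by (metis sat.simps(3) sharply_bounded.intros(3))

lemma sb_conj: "sb P \<Longrightarrow> sb Q \<Longrightarrow> sb (\<lambda>\<nu>. P \<nu> \<and> Q \<nu>)"
  unfolding sb_def by (metis sat.simps(4) sharply_bounded.intros(4))

lemma sb_disj: "sb P \<Longrightarrow> sb Q \<Longrightarrow> sb (\<lambda>\<nu>. P \<nu> \<or> Q \<nu>)"
  unfolding sb_def by (metis sat.simps(5) sharply_bounded.intros(5))

lemma sb_imp: "sb P \<Longrightarrow> sb Q \<Longrightarrow> sb (\<lambda>\<nu>. P \<nu> \<longrightarrow> Q \<nu>)"
  unfolding sb_def by (metis sat.simps(6) sharply_bounded.intros(6))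

lemma sb_not: "sb P \<Longrightarrow> sb (\<lambda>\<nu>. \<not> P \<nu>)"
  using sb_imp[OF _ sb_False] by simp

lemma sb_lt: "dt A \<Longrightarrow> dt B \<Longrightarrow> sb (\<lambda>\<nu>. A \<nu> \<sqsubset> B \<nu>)"
  unfolding lt_def by (intro sb_conj sb_not sb_le sb_eq)

lemma sat_BAll: "sat I L \<nu> (BAll t \<phi>) \<longleftrightarrow> (\<forall>x. x \<sqsubseteq> eval I \<nu> t \<longrightarrow> sat I L (x ## \<nu>) \<phi>)"
  by (simp add: BAll_def)

lemma sat_BEx: "sat I L \<nu> (BEx t \<phi>) \<longleftrightarrow> (\<exists>x. x \<sqsubseteq> eval I \<nu> t \<and> sat I L (x ## \<nu>) \<phi>)"
  by (simp add: BEx_def)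

lemma sb_BAll: "dt T \<Longrightarrow> sb P \<Longrightarrow> sb (\<lambda>\<nu>. \<forall>x. x \<sqsubseteq> len (T \<nu>) \<longrightarrow> P (x ## \<nu>))"
proof -
  assume "dt T" "sb P"
  then obtain t \<phi> where "wf_tm t" "\<And>\<nu>. eval I \<nu> t = T \<nu>" "sharply_bounded \<phi>" "\<And>\<nu>. sat I L \<nu> \<phi> = P \<nu>"
    unfolding dt_def sb_def by auto
  then show ?thesis
    unfolding sb_def by (intro exI[of _ "BAll (len_tm t) \<phi>"]) (auto simp: sat_BAll intro: sharply_bounded.intros)
qed

lemmas dt_intros = dt_var dt_nul dt_suc dt_half dt_len dt_add dt_mul dt_smash
lemmas sb_intros = sb_eq sb_le sb_lt sb_conj sb_disj sb_imp sb_not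

end

section \<open>Models of BASIC with sharply bounded induction\<close>

locale arith_model = pv_structure +
  assumes basic: "\<phi> \<in> BASIC \<Longrightarrow> sat I L \<nu> \<phi>"
    and IND: "sharply_bounded \<phi> \<Longrightarrow> sat I L \<nu> (IND \<phi>)"
begin

lemma Buss:
  shows le_suc: "y \<sqsubseteq> x \<Longrightarrow> y \<sqsubseteq> suc x"
    and neq_suc: "x \<noteq> suc x"
    and nul_le: "nul \<sqsubseteq> x"
    and lt_iff_suc_le0: "(x \<sqsubseteq> y \<and> x \<noteq> y) \<longleftrightarrow> suc x \<sqsubseteq> y"
    and le_total: "y \<sqsubseteq> x \<or> x \<sqsubseteq> y"
    and le_antisym: "x \<sqsubseteq> y \<Longrightarrow> y \<sqsubseteq> x \<Longrightarrow> x = y"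
    and le_trans: "x \<sqsubseteq> y \<Longrightarrow> y \<sqsubseteq> z \<Longrightarrow> x \<sqsubseteq> z"
    and len_nul: "len nul = nul"
    and len_double0: "x \<noteq> nul \<Longrightarrow> len (suc one \<boxtimes> x) = suc (len x) \<and> len (suc (suc one \<boxtimes> x)) = suc (len x)"
    and len_one: "len one = one"
    and len_mono: "x \<sqsubseteq> y \<Longrightarrow> len x \<sqsubseteq> len y"
    and len_smash: "len (smash x y) = suc (len x \<boxtimes> len y)"
    and smash_nul: "smash nul y = one"
    and smash_one0: "x \<noteq> nul \<Longrightarrow> smash one (suc one \<boxtimes> x) = suc one \<boxtimes> smash one x
          \<and> smash one (suc (suc one \<boxtimes> x)) = suc one \<boxtimes> smash one x"
    and smash_comm: "smash x y = smash y x"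
    and smash_cong: "len x = len y \<Longrightarrow> smash x z = smash y z"
    and smash_add: "len x = len u \<boxplus> len v \<Longrightarrow> smash x y = smash u y \<boxtimes> smash v y"
    and add_comm0: "x \<boxplus> y = y \<boxplus> x"
    and add_nul0: "x \<boxplus> nul = x"
    and add_suc: "x \<boxplus> suc y = suc (x \<boxplus> y)"
    and add_assoc0: "(x \<boxplus> y) \<boxplus> z = x \<boxplus> (y \<boxplus> z)"
    and add_le_cancel0: "x \<boxplus> y \<sqsubseteq> x \<boxplus> z \<longleftrightarrow> y \<sqsubseteq> z"
    and mul_nul0: "x \<boxtimes> nul = nul"
    and mul_suc: "x \<boxtimes> suc y = x \<boxtimes> y \<boxplus> x"
    and mul_comm0: "x \<boxtimes> y = y \<boxtimes> x"
    and distrib0: "x \<boxtimes> (y \<boxplus> z) = x \<boxtimes> y \<boxplus> x \<boxtimes> z"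
    and mul_le_cancel0: "one \<sqsubseteq> x \<Longrightarrow> x \<boxtimes> y \<sqsubseteq> x \<boxtimes> z \<longleftrightarrow> y \<sqsubseteq> z"
    and len_half: "x \<noteq> nul \<Longrightarrow> len x = suc (len (half x))"
    and half0: "x = half y \<longleftrightarrow> suc one \<boxtimes> x = y \<or> suc (suc one \<boxtimes> x) = y"
proof -
  have "\<forall>\<phi> \<in> Buss_axioms. sat I L (x ## y ## z ## u ## v ## \<nu>) \<phi>" for \<nu>
    using basic unfolding BASIC_def by blast
  note * = this[unfolded Buss_axioms_def Let_def, simplified eval_nat_numeral, simplified]
  show "y \<sqsubseteq> x \<Longrightarrow> y \<sqsubseteq> suc x" using * by blast
  show "x \<noteq> suc x" using * by blast
  show "nul \<sqsubseteq> x" using * by blast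
  show "(x \<sqsubseteq> y \<and> x \<noteq> y) \<longleftrightarrow> suc x \<sqsubseteq> y" using * by blast
  show "y \<sqsubseteq> x \<or> x \<sqsubseteq> y" using * by blast
  show "x \<sqsubseteq> y \<Longrightarrow> y \<sqsubseteq> x \<Longrightarrow> x = y" using * by blast
  show "x \<sqsubseteq> y \<Longrightarrow> y \<sqsubseteq> z \<Longrightarrow> x \<sqsubseteq> z" using * by blast
  show "len nul = nul" using * by blast
  show "x \<noteq> nul \<Longrightarrow> len (suc one \<boxtimes> x) = suc (len x) \<and> len (suc (suc one \<boxtimes> x)) = suc (len x)"
    using * by blast
  show "len one = one" using * by blast
  show "x \<sqsubseteq> y \<Longrightarrow> len x \<sqsubseteq> len y" using * by blast
  show "len (smash x y) = suc (len x \<boxtimes> len y)" using * by blast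
  show "smash nul y = one" using * by blast
  show "x \<noteq> nul \<Longrightarrow> smash one (suc one \<boxtimes> x) = suc one \<boxtimes> smash one x
          \<and> smash one (suc (suc one \<boxtimes> x)) = suc one \<boxtimes> smash one x" using * by blast
  show "smash x y = smash y x" using * by blast
  show "len x = len y \<Longrightarrow> smash x z = smash y z" using * by blast
  show "len x = len u \<boxplus> len v \<Longrightarrow> smash x y = smash u y \<boxtimes> smash v y" using * by blast
  show "x \<boxplus> y = y \<boxplus> x" using * by blast
  show "x \<boxplus> nul = x" using * by blast
  show "x \<boxplus> suc y = suc (x \<boxplus> y)" using * by blast
  show "(x \<boxplus> y) \<boxplus> z = x \<boxplus> (y \<boxplus> z)" using * by blast
  show "x \<boxplus> y \<sqsubseteq> x \<boxplus> z \<longleftrightarrow> y \<sqsubseteq> z" using * by blast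
  show "x \<boxtimes> nul = nul" using * by blast
  show "x \<boxtimes> suc y = x \<boxtimes> y \<boxplus> x" using * by blast
  show "x \<boxtimes> y = y \<boxtimes> x" using * by blast
  show "x \<boxtimes> (y \<boxplus> z) = x \<boxtimes> y \<boxplus> x \<boxtimes> z" using * by blast
  show "one \<sqsubseteq> x \<Longrightarrow> x \<boxtimes> y \<sqsubseteq> x \<boxtimes> z \<longleftrightarrow> y \<sqsubseteq> z" using * by blast
  show "x \<noteq> nul \<Longrightarrow> len x = suc (len (half x))" using * by blast
  show "x = half y \<longleftrightarrow> suc one \<boxtimes> x = y \<or> suc (suc one \<boxtimes> x) = y" using * by (elim conjE, intro iffI) (metis+)
qed

lemma induct0:
  assumes "sb P" "P (nul ## \<nu>)" "\<And>x. P (x ## \<nu>) \<Longrightarrow> P (suc x ## \<nu>)"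
  shows "P (x ## \<nu>)"
proof -
  obtain \<phi> where \<phi>: "sharply_bounded \<phi>" "\<And>\<nu>. sat I L \<nu> \<phi> = P \<nu>"
    using assms(1) unfolding sb_def by auto
  have "(\<lambda>n. if n = 0 then nul else \<nu> (n - 1)) = nul ## \<nu>"
    "(\<lambda>n. if n = 0 then suc x else case n of 0 \<Rightarrow> x | Suc m \<Rightarrow> \<nu> m) = suc x ## \<nu>" for x
    by (auto split: nat.split)
  with IND[OF \<phi>(1), of \<nu>] assms(2,3) show ?thesis
    by (simp add: IND_def sat_inst \<phi>(2) if_distrib cong: if_cong)
qed

text \<open>A form with three named parameters: the definability premise speaks of the variables 0
  to 3 and is closed by the introduction rules. Spare places are filled with
  \<open>undefined\<close>.\<close>

lemma induct:
  fixes Q :: "'a \<Rightarrow> 'a \<Rightarrow> 'a \<Rightarrow> 'a \<Rightarrow> bool"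
  assumes "sb (\<lambda>\<nu>. Q (\<nu> 0) (\<nu> (Suc 0)) (\<nu> (Suc (Suc 0))) (\<nu> (Suc (Suc (Suc 0)))))"
    "Q nul a b c" "\<And>x. Q x a b c \<Longrightarrow> Q (suc x) a b c"
  shows "Q x a b c"
  using induct0[OF assms(1), of "a ## b ## c ## undefined" x] assms(2,3) by simp

end

section \<open>Arithmetic in a model\<close>

context arith_model
begin

lemma lt_suc_iff: "x \<sqsubset> y \<longleftrightarrow> suc x \<sqsubseteq> y"
  by (simp add: lt_def lt_iff_suc_le0)

lemma suc_eq: "suc x = x \<boxplus> one"
  by (simp add: add_suc add_nul0)

lemma mul_assoc0: "(a \<boxtimes> b) \<boxtimes> x = a \<boxtimes> (b \<boxtimes> x)"
  by (rule induct[where Q = "\<lambda>x a b _. (a \<boxtimes> b) \<boxtimes> x = a \<boxtimes> (b \<boxtimes> x)" and c = undefined])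
    (intro sb_intros dt_intros, simp_all add: mul_nul0 mul_suc distrib0)

text \<open>The existence of a difference is not a sharply bounded statement, so it is not proved by
  induction directly. If no difference existed, \<open>x \<boxplus> z \<sqsubseteq> y\<close> would
  never be an equality and would pass from \<open>z\<close> to its successor, hence hold for
  \<open>z = suc y\<close>, which is absurd.\<close>

lemma le_imp_add:
  assumes "x \<sqsubseteq> y" shows "\<exists>z. x \<boxplus> z = y"
proof (rule ccontr)
  assume no: "\<nexists>z. x \<boxplus> z = y"
  have "x \<boxplus> z \<sqsubseteq> y" for z
  proof (rule induct[where Q = "\<lambda>z x y _. x \<boxplus> z \<sqsubseteq> y" and c = undefined])
    show "x \<boxplus> nul \<sqsubseteq> y" using assms by (simp add: add_nul0)
  next
    fix z assume "x \<boxplus> z \<sqsubseteq> y"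
    with no have "x \<boxplus> z \<sqsubset> y" by (auto simp: lt_def)
    then show "x \<boxplus> suc z \<sqsubseteq> y" by (simp add: lt_suc_iff add_suc)
  qed (intro sb_intros dt_intros)
  then have "x \<boxplus> suc y \<sqsubseteq> y" .
  moreover have "suc y \<sqsubseteq> x \<boxplus> suc y"
    using add_le_cancel0[of "suc y" nul x] add_comm0[of x] by (simp add: add_nul0 nul_le)
  ultimately have "suc y \<sqsubseteq> y" using le_trans by blast
  then show False using le_antisym neq_suc le_suc le_total by metis
qed

text \<open>Truncated subtraction, an operation that the class \<open>linordered_semidom\<close>
  demands; with it the library's theory of ordered semirings applies to the model.\<close>

definition diff :: "'a \<Rightarrow> 'a \<Rightarrow> 'a" where
  "diff x y = (if y \<sqsubseteq> x then THE z. y \<boxplus> z = x else nul)"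

lemma add_left_cancel0: "x \<boxplus> y = x \<boxplus> z \<longleftrightarrow> y = z"
  using add_le_cancel0 le_antisym le_total by metis

lemma diff_eq: "y \<boxplus> z = x \<Longrightarrow> diff x y = z"
proof -
  assume *: "y \<boxplus> z = x"
  have "y \<sqsubseteq> y \<boxplus> z" using add_le_cancel0[of y nul z] by (simp add: add_nul0 nul_le)
  with * show ?thesis unfolding diff_def by (auto intro!: the_equality simp: add_left_cancel0)
qed

lemma mul_lt0: assumes "a \<sqsubset> b" "nul \<sqsubset> c" shows "c \<boxtimes> a \<sqsubset> c \<boxtimes> b"
proof -
  have c: "one \<sqsubseteq> c" using assms(2) by (simp add: lt_suc_iff)
  then show ?thesis
    using assms(1) mul_le_cancel0[OF c, of a b] mul_le_cancel0[OF c, of b a] le_antisym le_total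
    unfolding lt_def by metis
qed

lemma diff_nle: "\<not> y \<sqsubseteq> x \<Longrightarrow> diff x y = nul"
  by (simp add: diff_def)

lemma diff_diff: "diff (diff a b) c = diff a (b \<boxplus> c)"
proof (cases "b \<sqsubseteq> a")
  case True
  then obtain y where y: "b \<boxplus> y = a" using le_imp_add by blast
  then have [simp]: "diff a b = y" by (rule diff_eq)
  show ?thesis
  proof (cases "c \<sqsubseteq> y")
    case True
    then obtain z where z: "c \<boxplus> z = y" using le_imp_add by blast
    with y have "b \<boxplus> c \<boxplus> z = a" by (simp add: add_assoc0)
    then show ?thesis using z by (simp add: diff_eq)
  next
    case False
    with y have "\<not> b \<boxplus> c \<sqsubseteq> a" using add_le_cancel0 by blast
    with False show ?thesis by (simp add: diff_nle)
  qed
next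
  case False
  moreover have "b \<sqsubseteq> b \<boxplus> c" using add_le_cancel0[of b nul c] by (simp add: add_nul0 nul_le)
  ultimately have "\<not> b \<boxplus> c \<sqsubseteq> a" using le_trans by blast
  moreover have "diff nul c = nul"
    by (metis add_nul0 diff_eq diff_nle le_antisym nul_le)
  ultimately show ?thesis using False by (simp add: diff_nle)
qed

lemma mul_diff: "a \<boxtimes> diff b c = diff (a \<boxtimes> b) (a \<boxtimes> c)"
proof (cases "c \<sqsubseteq> b")
  case True
  then obtain z where z: "c \<boxplus> z = b" using le_imp_add by blast
  then have "a \<boxtimes> c \<boxplus> a \<boxtimes> z = a \<boxtimes> b" using distrib0 by metis
  with z show ?thesis by (simp add: diff_eq)
next
  case False
  have "diff (a \<boxtimes> b) (a \<boxtimes> c) = nul"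
  proof (cases "a = nul")
    case True
    then show ?thesis using mul_comm0[of nul] by (simp add: mul_nul0 diff_eq add_nul0)
  next
    case a: False
    then have "nul \<sqsubset> a" using nul_le by (auto simp: lt_def)
    moreover have "b \<sqsubset> c" using False le_total by (auto simp: lt_def)
    ultimately have "a \<boxtimes> b \<sqsubset> a \<boxtimes> c" by (rule mul_lt0[rotated])
    then show ?thesis using le_antisym by (auto simp: lt_def intro: diff_nle)
  qed
  with False show ?thesis by (simp add: diff_nle mul_nul0)
qed

sublocale M: linordered_semidom "(\<boxplus>)" diff "(\<sqsubseteq>)" "(\<sqsubset>)" nul "(\<boxtimes>)" one
proof unfold_locales
  fix a b c d :: 'a
  show "nul \<noteq> one" by (rule neq_suc)
  show "a \<boxplus> b \<boxplus> c = a \<boxplus> (b \<boxplus> c)" by (rule add_assoc0)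
  show "a \<boxplus> b = b \<boxplus> a" by (rule add_comm0)
  show "nul \<boxplus> a = a" using add_comm0 add_nul0 by metis
  show "a \<boxtimes> b \<boxtimes> c = a \<boxtimes> (b \<boxtimes> c)" by (rule mul_assoc0)
  show "a \<boxtimes> b = b \<boxtimes> a" by (rule mul_comm0)
  show "one \<boxtimes> a = a" by (metis mul_comm0 mul_suc mul_nul0 add_comm0 add_nul0)
  show "nul \<boxtimes> a = nul" by (metis mul_comm0 mul_nul0)
  show "a \<boxtimes> nul = nul" by (rule mul_nul0)
  show "(a \<boxplus> b) \<boxtimes> c = a \<boxtimes> c \<boxplus> b \<boxtimes> c" by (metis mul_comm0 distrib0)
  show "a \<boxtimes> (b \<boxplus> c) = a \<boxtimes> b \<boxplus> a \<boxtimes> c" by (rule distrib0)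
  show "diff (a \<boxplus> b) a = b" by (rule diff_eq) simp
  show "(a \<sqsubset> b) = (a \<sqsubseteq> b \<and> \<not> b \<sqsubseteq> a)" unfolding lt_def using le_antisym le_total by metis
  show "a \<sqsubseteq> a" using le_total by blast
  show "a \<sqsubseteq> b \<Longrightarrow> b \<sqsubseteq> c \<Longrightarrow> a \<sqsubseteq> c" by (rule le_trans)
  show "a \<sqsubseteq> b \<Longrightarrow> b \<sqsubseteq> a \<Longrightarrow> a = b" by (rule le_antisym)
  show "a \<sqsubseteq> b \<or> b \<sqsubseteq> a" by (rule le_total)
  show "a \<sqsubseteq> b \<Longrightarrow> c \<boxplus> a \<sqsubseteq> c \<boxplus> b" by (simp add: add_le_cancel0)
  show "nul \<sqsubset> one" by (simp add: lt_def nul_le neq_suc)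
  show "a \<sqsubset> b \<Longrightarrow> nul \<sqsubset> c \<Longrightarrow> c \<boxtimes> a \<sqsubset> c \<boxtimes> b" by (rule mul_lt0)
  show "b \<sqsubseteq> a \<Longrightarrow> diff a b \<boxplus> b = a" using le_imp_add diff_eq add_comm0 by metis
  show "diff (diff a b) c = diff a (b \<boxplus> c)" by (rule diff_diff)
  show "a \<boxtimes> diff b c = diff (a \<boxtimes> b) (a \<boxtimes> c)" by (rule mul_diff)
  show "a \<noteq> nul \<Longrightarrow> b \<noteq> nul \<Longrightarrow> a \<boxtimes> b \<noteq> nul"
    using mul_lt0[of nul b a] nul_le unfolding lt_def mul_nul0 by metis
qed


section \<open>Successor, halving and length\<close>

lemma le_nul_iff [simp]: "x \<sqsubseteq> nul \<longleftrightarrow> x = nul"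
  using nul_le le_antisym by auto

lemma neq_nul_iff: "x \<noteq> nul \<longleftrightarrow> nul \<sqsubset> x"
  using nul_le by (auto simp: lt_def)

lemma lt_suc_le: "x \<sqsubset> suc y \<longleftrightarrow> x \<sqsubseteq> y"
  using M.add_le_cancel_right[of x one y] by (simp only: lt_suc_iff suc_eq[symmetric])

lemma suc_le_suc [simp]: "suc x \<sqsubseteq> suc y \<longleftrightarrow> x \<sqsubseteq> y"
  using M.add_le_cancel_right[of x one y] by (simp only: suc_eq[symmetric])

lemma suc_lt_suc [simp]: "suc x \<sqsubset> suc y \<longleftrightarrow> x \<sqsubset> y"
  using M.add_less_cancel_right[of x one y] by (simp only: suc_eq[symmetric])

lemma suc_inject [simp]: "suc x = suc y \<longleftrightarrow> x = y"
  using M.add_right_cancel[of x one y] by (simp only: suc_eq[symmetric])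

lemma suc_neq_nul [simp]: "suc x \<noteq> nul" "nul \<noteq> suc x"
  using lt_suc_le[of nul x] nul_le by (auto simp: lt_def)

lemma lt_suc [simp]: "x \<sqsubset> suc x"
  by (simp add: lt_suc_le)

lemma suc_add [simp]: "suc x \<boxplus> y = suc (x \<boxplus> y)" "x \<boxplus> suc y = suc (x \<boxplus> y)"
  using add_suc[of y x] add_suc[of x y] by (simp_all add: M.add.commute)

lemma suc_mul: "suc x \<boxtimes> y = x \<boxtimes> y \<boxplus> y"
  using mul_suc[of y x] by (simp add: M.mult.commute)

lemma two_mul [simp]: "suc one \<boxtimes> x = x \<boxplus> x"
  by (simp add: suc_mul)

lemma le_add1 [simp]: "x \<sqsubseteq> x \<boxplus> y" "y \<sqsubseteq> x \<boxplus> y"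
  using nul_le by auto

lemma mul_le_cancel: "c \<noteq> nul \<Longrightarrow> c \<boxtimes> a \<sqsubseteq> c \<boxtimes> b \<longleftrightarrow> a \<sqsubseteq> b"
  by (simp add: mul_le_cancel0 neq_nul_iff lt_suc_iff)

lemma mul_cancel: "c \<noteq> nul \<Longrightarrow> c \<boxtimes> a = c \<boxtimes> b \<longleftrightarrow> a = b"
  using mul_le_cancel le_antisym le_total by metis

lemma half_double [simp]: "half (x \<boxplus> x) = x" "half (suc (x \<boxplus> x)) = x"
  using half0[of x "x \<boxplus> x"] half0[of x "suc (x \<boxplus> x)"] by simp_all

lemma half_cases: obtains "x = half x \<boxplus> half x" | "x = suc (half x \<boxplus> half x)"
  using half0[of "half x" x] by auto

lemma half_nul [simp]: "half nul = nul"
  using half_double(1)[of nul] by simp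

lemma half_one [simp]: "half one = nul"
  using half_double(2)[of nul] by simp

lemma half_le [simp]: "half x \<sqsubseteq> x"
  by (cases x rule: half_cases) (metis le_add1(1), metis le_add1(1) le_suc)

lemma len_double [simp]:
  "x \<noteq> nul \<Longrightarrow> len (x \<boxplus> x) = suc (len x)" "len (suc (x \<boxplus> x)) = suc (len x)"
  using len_double0[of x] len_one len_nul by (simp, cases "x = nul") auto

declare len_nul [simp] len_one [simp]

lemma len_eq_nul [simp]: "len x = nul \<longleftrightarrow> x = nul"
  by (metis len_half suc_neq_nul(1) len_nul)

text \<open>For \<open>x \<noteq> nul\<close> the successor lies between \<open>x\<close> and
  \<open>x \<boxplus> x\<close>, whose lengths differ by one. Since lengths climb without gaps,
  ordinary induction on \<open>v\<close> can act as induction on \<open>len v\<close>.\<close>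

lemma len_suc: "len (suc x) = len x \<or> len (suc x) = suc (len x)"
proof (cases "x = nul")
  case False
  then have "one \<sqsubseteq> x" by (simp add: neq_nul_iff lt_suc_iff)
  then have "suc x \<sqsubseteq> x \<boxplus> x" using M.add_left_mono[of one x x] by (simp add: suc_eq[symmetric])
  then have "len (suc x) \<sqsubseteq> suc (len x)" using len_mono False len_double(1) by metis
  moreover have "len x \<sqsubseteq> len (suc x)" by (rule len_mono) (simp add: le_suc)
  ultimately show ?thesis by (metis lt_suc_iff lt_suc_le lt_def le_antisym)
qed simp

lemma len_le [simp]: "len x \<sqsubseteq> x"
proof (rule induct[where Q = "\<lambda>x _ _ _. len x \<sqsubseteq> x" and a = undefined and b = undefined and c = undefined])
  fix x assume "len x \<sqsubseteq> x"
  then show "len (suc x) \<sqsubseteq> suc x" using len_suc[of x] le_suc by auto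
qed (intro sb_intros dt_intros, simp)

lemma len_less: "len x \<sqsubset> len y \<Longrightarrow> x \<sqsubset> y"
  using len_mono M.not_le by metis

text \<open>If \<open>x\<close> exceeded \<open>y \<boxplus> y\<close>, it would be at least
  \<open>suc (y \<boxplus> y)\<close>, which is one bit longer than \<open>y\<close>. This is where
  the doubled bounds come from.\<close>

lemma len_le_imp: "len x \<sqsubseteq> len y \<Longrightarrow> x \<sqsubseteq> y \<boxplus> y"
proof (rule ccontr)
  assume len: "len x \<sqsubseteq> len y" and "\<not> x \<sqsubseteq> y \<boxplus> y"
  then have *: "suc (y \<boxplus> y) \<sqsubseteq> x" by (simp add: M.not_le lt_suc_iff)
  from len_mono[OF this] have "suc (len y) \<sqsubseteq> len x" by simp
  with len have "suc (len y) \<sqsubseteq> len y" using le_trans by blast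
  then show False by (simp add: lt_suc_iff[symmetric])
qed

text \<open>This is 2 to the power \<open>len v\<close>, because 1 has length 1. The value depends
  on \<open>v\<close> only through its length, so \<open>v\<close> serves as a name for the exponent
  \<open>len v\<close>.\<close>

definition pow2 :: "'a \<Rightarrow> 'a" where "pow2 v = smash one v"

lemma dt_pow2: "dt A \<Longrightarrow> dt (\<lambda>\<nu>. pow2 (A \<nu>))"
  unfolding pow2_def by (intro dt_intros)

lemma pow2_nul [simp]: "pow2 nul = one"
  unfolding pow2_def by (metis smash_comm smash_nul)

lemma len_pow2 [simp]: "len (pow2 v) = suc (len v)"
  unfolding pow2_def by (simp add: len_smash)

lemma pow2_neq_nul [simp]: "pow2 v \<noteq> nul"
  using len_pow2[of v] by (metis len_nul suc_neq_nul(1))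

lemma pow2_cong: "len u = len v \<Longrightarrow> pow2 u = pow2 v"
  unfolding pow2_def using smash_cong smash_comm by metis

lemma pow2_add: "len w = len u \<boxplus> len v \<Longrightarrow> pow2 w = pow2 u \<boxtimes> pow2 v"
  unfolding pow2_def using smash_add smash_comm by metis

text \<open>The axioms give the value at 2 both as the double and as the square of the value at 1;
  cancelling one factor leaves 2.\<close>

lemma pow2_one [simp]: "pow2 one = suc one"
proof -
  have "pow2 (suc one) = pow2 one \<boxplus> pow2 one"
    using smash_one0[of one] by (simp add: pow2_def)
  moreover have "pow2 (suc one) = pow2 one \<boxtimes> pow2 one"
    using len_double(1)[of one] by (intro pow2_add) simp
  ultimately have "pow2 one \<boxtimes> pow2 one = pow2 one \<boxtimes> suc one"
    by (simp add: mul_suc)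
  then show ?thesis using mul_cancel[of "pow2 one"] by simp
qed

lemma pow2_double [simp]: "v \<noteq> nul \<Longrightarrow> pow2 (v \<boxplus> v) = pow2 v \<boxplus> pow2 v"
  "pow2 (suc (v \<boxplus> v)) = pow2 v \<boxplus> pow2 v"
  using smash_one0[of v] pow2_one by (simp add: pow2_def, cases "v = nul") (auto simp: pow2_def pow2_nul[unfolded pow2_def])

lemma pow2_suc: "len u = suc (len v) \<Longrightarrow> pow2 u = pow2 v \<boxplus> pow2 v"
  by (metis len_double(2) pow2_cong pow2_double(2))

lemma less_pow2 [simp]: "a \<sqsubset> pow2 a"
  by (rule len_less) simp


section \<open>Evaluation of function symbols in the model\<close>

lemma defining: "wf_pv f \<Longrightarrow> \<phi> \<in> defining_axioms f \<Longrightarrow> sat I L \<nu> \<phi>"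
  using basic by (auto simp: BASIC_def)

lemma map_eval_Var: "length xs = n \<Longrightarrow> map (eval I (\<lambda>i. xs ! i)) (map Var [0..<n]) = xs"
  by (auto simp: comp_def map_nth)

lemma Proj_eq: "i < n \<Longrightarrow> length xs = n \<Longrightarrow> I (Proj n i) xs = xs ! i"
  using defining[of "Proj n i" "App (Proj n i) (map Var [0..<n]) \<doteq> Var i" "\<lambda>i. xs ! i"]
    map_eval_Var[of xs n] by simp

lemma Comp_eq:
  assumes "wf_pv (Comp n f gs)" "length xs = n"
  shows "I (Comp n f gs) xs = I f (map (\<lambda>g. I g xs) gs)"
  using defining[OF assms(1), of "App (Comp n f gs) (map Var [0..<n]) \<doteq>
      App f (map (\<lambda>g. App g (map Var [0..<n])) gs)" "\<lambda>i. xs ! i"]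
    map_eval_Var[OF assms(2)] by (simp add: Let_def comp_def)

lemma wf_fun_of_tm: "wf_tm t \<Longrightarrow> fv_tm t \<subseteq> {..<n} \<Longrightarrow> wf_pv (fun_of_tm n t)"
  "arity (fun_of_tm n t) = n"
proof -
  show ar: "arity (fun_of_tm n t) = n" for t by (cases t) auto
  show "wf_tm t \<Longrightarrow> fv_tm t \<subseteq> {..<n} \<Longrightarrow> wf_pv (fun_of_tm n t)"
    by (induction t) (auto simp: ar UN_subset_iff)
qed

lemma fun_of_tm_eq:
  "wf_tm t \<Longrightarrow> fv_tm t \<subseteq> {..<n} \<Longrightarrow> length xs = n \<Longrightarrow> I (fun_of_tm n t) xs = eval I (\<lambda>i. xs ! i) t"
proof (induction t)
  case (App f ts)
  have "map (\<lambda>t. I (fun_of_tm n t) xs) ts = map (eval I (\<lambda>i. xs ! i)) ts"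
    using App by (intro map_cong) (auto simp: UN_subset_iff)
  moreover have "wf_pv (Comp n f (map (fun_of_tm n) ts))"
    using wf_fun_of_tm(1)[OF App.prems(1,2)] by simp
  ultimately show ?case
    using App.prems(3) by (simp only: fun_of_tm.simps eval.simps Comp_eq map_map comp_def)
qed (simp add: Proj_eq)

definition mn :: "'a \<Rightarrow> 'a \<Rightarrow> 'a" where "mn x y = (if x \<sqsubseteq> y then x else y)"

lemma mn_le [simp]: "mn x y \<sqsubseteq> y"
  by (simp add: mn_def)

lemma sat_is_min: "sat I L \<nu> (is_min r s t) \<longleftrightarrow> eval I \<nu> r = mn (eval I \<nu> s) (eval I \<nu> t)"
  by (auto simp: is_min_def mn_def)

lemma Rec_eq:
  assumes wf: "wf_pv (Rec g h0 h1 k)" and len: "length xs = arity g"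
  shows "I (Rec g h0 h1 k) (nul # xs) = I g xs"
    and "y \<noteq> nul \<Longrightarrow> I (Rec g h0 h1 k) ((y \<boxplus> y) # xs) =
           mn (I h0 (y # I (Rec g h0 h1 k) (y # xs) # xs)) (I k ((y \<boxplus> y) # xs))"
    and "I (Rec g h0 h1 k) (suc (y \<boxplus> y) # xs) =
           mn (I h1 (y # I (Rec g h0 h1 k) (y # xs) # xs)) (I k (suc (y \<boxplus> y) # xs))"
proof -
  have xs: "map (eval I (y ## (\<lambda>i. xs ! i))) (map Var [1..<Suc (arity g)]) = xs"
    by (auto simp: len[symmetric] map_Suc_upt[symmetric] comp_def map_nth simp del: map_Suc_upt upt_Suc)
  have "\<forall>\<phi> \<in> defining_axioms (Rec g h0 h1 k). sat I L (y ## (\<lambda>i. xs ! i)) \<phi>"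
    using defining[OF wf] by blast
  then show "I (Rec g h0 h1 k) (nul # xs) = I g xs"
    "y \<noteq> nul \<Longrightarrow> I (Rec g h0 h1 k) ((y \<boxplus> y) # xs) =
           mn (I h0 (y # I (Rec g h0 h1 k) (y # xs) # xs)) (I k ((y \<boxplus> y) # xs))"
    "I (Rec g h0 h1 k) (suc (y \<boxplus> y) # xs) =
           mn (I h1 (y # I (Rec g h0 h1 k) (y # xs) # xs)) (I k (suc (y \<boxplus> y) # xs))"
    using xs by (simp_all add: Let_def sat_is_min del: map_map upt_Suc)
qed

lemma Rec_half:
  assumes "wf_pv (Rec g h h k)" "length xs = arity g" "y \<noteq> nul"
  shows "I (Rec g h h k) (y # xs) = mn (I h (half y # I (Rec g h h k) (half y # xs) # xs)) (I k (y # xs))"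
proof (cases y rule: half_cases)
  case 1
  moreover from this assms(3) have "half y \<noteq> nul" by auto
  ultimately show ?thesis using Rec_eq(2)[OF assms(1,2), of "half y"] by simp
next
  case 2
  then show ?thesis using Rec_eq(3)[OF assms(1,2), of "half y"] by simp
qed

lemma CondLe_eq: "I CondLe [x, y, u, v] = (if x \<sqsubseteq> y then u else v)"
proof -
  have "\<forall>\<phi> \<in> defining_axioms CondLe. sat I L (x ## y ## u ## v ## \<nu>) \<phi>" for \<nu>
    using defining[of CondLe] by simp
  then show ?thesis by (simp add: Let_def eval_nat_numeral)
qed

text \<open>
  Deriving induction on notation from ordinary induction: as \<open>v\<close> increases by one,
  \<open>halving (pow2 v) a\<close> stays or is halved once more, and it is \<open>0\<close> at \<open>v = a\<close>. The detour through
  \<open>pow2 v\<close> is needed because only along powers of two is the effect of the step from \<open>v\<close> to \<open>v + 1\<close>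
  on \<open>halving\<close> known without induction on notation.
\<close>

definition halving_pv :: pv where
  "halving_pv = Rec (Proj 1 0) (fun_of_tm 3 (half_tm (Var 1))) (fun_of_tm 3 (half_tm (Var 1))) (Proj 2 1)"

definition halving :: "'a \<Rightarrow> 'a \<Rightarrow> 'a" where
  "halving y a = I halving_pv [y, a]"

lemma wf_halving_pv: "wf_pv halving_pv" "arity halving_pv = 2"
  by (simp_all add: halving_pv_def)

lemma dt_halving: "dt A \<Longrightarrow> dt B \<Longrightarrow> dt (\<lambda>\<nu>. halving (A \<nu>) (B \<nu>))"
  unfolding halving_def by (rule dt_app2[OF wf_halving_pv])

lemma halving_nul [simp]: "halving nul a = a"
  using Rec_eq(1)[OF wf_halving_pv(1)[unfolded halving_pv_def], of "[a]"]
  by (simp add: halving_def halving_pv_def Proj_eq)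

lemma halving_eq0: "y \<noteq> nul \<Longrightarrow> halving y a = mn (half (halving (half y) a)) a"
  using Rec_half[OF wf_halving_pv(1)[unfolded halving_pv_def], of "[a]" y]
  by (simp add: halving_def halving_pv_def Proj_eq fun_of_tm_eq del: fun_of_tm.simps)

lemma halving_le: "halving y a \<sqsubseteq> a"
  by (cases "y = nul") (simp_all add: halving_eq0)

lemma halving_eq: "y \<noteq> nul \<Longrightarrow> halving y a = half (halving (half y) a)"
  using halving_eq0[of y a] halving_le[of "half y" a] half_le le_trans mn_def by metis

lemma halving_pow2: "len u = suc (len v) \<Longrightarrow> halving (pow2 u) a = half (halving (pow2 v) a)"
  using halving_eq[OF pow2_neq_nul, of u a] by (simp add: pow2_suc)

text \<open>As \<open>pow2 v\<close> has length \<open>suc (len v)\<close>, that many halvings take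
  place. As long as the result is not 0, each has removed one bit of \<open>a\<close>; for
  \<open>v = a\<close> this would be more bits than \<open>a\<close> has.\<close>

lemma halving_pow2_eq_nul: "halving (pow2 a) a = nul"
proof -
  have "halving (pow2 v) a = nul \<or> len (halving (pow2 v) a) \<boxplus> suc (len v) \<sqsubseteq> len a" for v
  proof (rule induct[where Q = "\<lambda>v a _ _. halving (pow2 v) a = nul \<or>
          len (halving (pow2 v) a) \<boxplus> suc (len v) \<sqsubseteq> len a" and b = undefined and c = undefined])
    show "halving (pow2 nul) a = nul \<or> len (halving (pow2 nul) a) \<boxplus> suc (len nul) \<sqsubseteq> len a"
      using len_half[of a] by (cases "a = nul") (auto simp: halving_eq)
  next
    fix v assume IH: "halving (pow2 v) a = nul \<or> len (halving (pow2 v) a) \<boxplus> suc (len v) \<sqsubseteq> len a"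
    show "halving (pow2 (suc v)) a = nul \<or> len (halving (pow2 (suc v)) a) \<boxplus> suc (len (suc v)) \<sqsubseteq> len a"
    proof (cases "len (suc v) = len v")
      case True
      with IH pow2_cong[OF True] show ?thesis by simp
    next
      case False
      then have s: "len (suc v) = suc (len v)" using len_suc by blast
      show ?thesis
        using IH len_half[of "halving (pow2 v) a"]
        by (cases "halving (pow2 v) a = nul") (auto simp: halving_pow2[OF s] s)
    qed
  qed (intro sb_intros dt_intros dt_pow2 dt_halving)
  then have "halving (pow2 a) a = nul \<or> len (halving (pow2 a) a) \<boxplus> suc (len a) \<sqsubseteq> len a" .
  moreover have "len a \<sqsubset> len (halving (pow2 a) a) \<boxplus> suc (len a)"
    using le_add1(2)[of "suc (len a)"] by (simp only: lt_suc_iff)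
  ultimately show ?thesis using M.not_le by blast
qed

text \<open>By contraposition: failure at \<open>x\<close> implies failure at \<open>half x\<close>.
  Ordinary induction on \<open>v\<close> transports failure from \<open>a\<close> along
  \<open>halving (pow2 v) a\<close> down to 0, where it contradicts the base case.\<close>

lemma pind0:
  assumes sb: "sb P" and base: "P (nul ## \<nu>)" and step: "\<And>x. P (half x ## \<nu>) \<Longrightarrow> P (x ## \<nu>)"
  shows "P (a ## \<nu>)"
proof (rule ccontr)
  assume a: "\<not> P (a ## \<nu>)"
  \<comment> \<open>Variable 0 becomes \<open>v\<close> and variable 1 becomes \<open>a\<close>;
    under this substitution \<open>P\<close> at the halved value is a sharply bounded predicate of
    \<open>v\<close>.\<close>
  define \<sigma> :: "nat \<Rightarrow> (nat \<Rightarrow> 'a) \<Rightarrow> 'a"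
    where "\<sigma> = case_nat (\<lambda>\<nu>. halving (pow2 (\<nu> 0)) (\<nu> 1)) (\<lambda>i \<nu>. \<nu> (Suc (Suc i)))"
  have \<sigma>: "(\<lambda>i. \<sigma> i (v ## a ## \<nu>)) = halving (pow2 v) a ## \<nu>" for v
    by (auto simp: \<sigma>_def split: nat.split)
  have "\<not> P (\<lambda>i. \<sigma> i (v ## a ## \<nu>))" for v
  proof (rule induct0[where P = "\<lambda>\<nu>. \<not> P (\<lambda>i. \<sigma> i \<nu>)"])
    have "dt (\<sigma> i)" for i
      unfolding \<sigma>_def by (cases i) (simp_all add: dt_halving dt_pow2 dt_var)
    then show "sb (\<lambda>\<nu>. \<not> P (\<lambda>i. \<sigma> i \<nu>))" by (rule sb_not[OF sb_subst[OF sb]])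
    show "\<not> P (\<lambda>i. \<sigma> i (nul ## a ## \<nu>))"
      using a step[of a] by (auto simp: \<sigma> halving_eq)
  next
    fix v assume "\<not> P (\<lambda>i. \<sigma> i (v ## a ## \<nu>))"
    then have v: "\<not> P (halving (pow2 v) a ## \<nu>)" by (simp only: \<sigma> not_False_eq_True)
    from len_suc[of v] show "\<not> P (\<lambda>i. \<sigma> i (suc v ## a ## \<nu>))"
      unfolding \<sigma>
    proof
      assume "len (suc v) = len v"
      with v show "\<not> P (halving (pow2 (suc v)) a ## \<nu>)" by (simp add: pow2_cong[of "suc v" v])
    next
      assume "len (suc v) = suc (len v)"
      with v show "\<not> P (halving (pow2 (suc v)) a ## \<nu>)"
        using step[of "halving (pow2 v) a"] halving_pow2[of "suc v" v a] by auto
    qed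
  qed
  from this[of a] base show False by (simp add: \<sigma> halving_pow2_eq_nul)
qed

lemma pind:
  fixes Q :: "'a \<Rightarrow> 'a \<Rightarrow> 'a \<Rightarrow> 'a \<Rightarrow> bool"
  assumes "sb (\<lambda>\<nu>. Q (\<nu> 0) (\<nu> (Suc 0)) (\<nu> (Suc (Suc 0))) (\<nu> (Suc (Suc (Suc 0)))))"
    "Q nul a b c" "\<And>x. x \<noteq> nul \<Longrightarrow> Q (half x) a b c \<Longrightarrow> Q x a b c"
  shows "Q x a b c"
proof -
  have "Q y a b c" if "Q (half y) a b c" for y
    using that assms(2,3) by (cases "y = nul") blast+
  with pind0[OF assms(1), of "a ## b ## c ## undefined" x] assms(2) show ?thesis by simp
qed

text \<open>Induction on notation validates the scheme \<open>PIND\<close>, so the model satisfies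
  PV1. It converts the provability demanded of a bound function into an inequality in the
  model.\<close>

lemma PV1_sound: "PV1 \<turnstile> \<phi> \<Longrightarrow> sat I L \<nu> \<phi>"
proof -
  assume "PV1 \<turnstile> \<phi>"
  moreover have "sat I L \<nu> \<psi>" if "\<psi> \<in> PV1" for \<psi> \<nu>
  proof (cases "\<psi> \<in> BASIC")
    case False
    with that obtain \<phi> where \<phi>: "quantifier_free \<phi>" "\<psi> = PIND \<phi>" by (auto simp: PV1_def)
    have e: "(\<lambda>n. if n = 0 then nul else \<nu> (n - Suc 0)) = nul ## \<nu>"
      "(\<lambda>n. if n = 0 then half x else case n of 0 \<Rightarrow> x | Suc m \<Rightarrow> \<nu> m) = half x ## \<nu>" for x
      by (auto split: nat.split)
    have "sb (\<lambda>\<nu>. sat I L \<nu> \<phi>)"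
      using quantifier_free_sharply_bounded[OF \<phi>(1)] unfolding sb_def by blast
    note pind0[OF this, of \<nu>]
    moreover have "sat I L \<nu> \<psi> \<longleftrightarrow> sat I L (nul ## \<nu>) \<phi> \<and>
        (\<forall>x. sat I L (half x ## \<nu>) \<phi> \<longrightarrow> sat I L (x ## \<nu>) \<phi>) \<longrightarrow> (\<forall>x. sat I L (x ## \<nu>) \<phi>)"
      unfolding \<phi>(2) PIND_def by (simp add: sat_inst e if_distrib cong: if_cong)
    ultimately show ?thesis by blast
  qed (rule basic)
  ultimately show ?thesis
    unfolding proves_def using soundness sat_universal_closures by metis
qed

lemma bound_function_le: "bound_function b \<Longrightarrow> I b [x] \<sqsubseteq> x"
  using PV1_sound[of "App b [Var 0] \<preceq> Var 0" "\<lambda>_. x"] by (simp add: bound_function_def)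

end

section \<open>The coding functions in a model\<close>

text \<open>The recursions inside \<open>msp_pv\<close> and \<open>lsp_pv\<close> receive names, so
  that invariants can be stated for their intermediate values.\<close>

definition msp_step_pv :: pv where
  "msp_step_pv = fun_of_tm 4 (cond_tm (\<S> (len_tm (Var 0))) (Var 3) (half_tm (Var 1)) (Var 1))"

definition msp_rec_pv :: pv where
  "msp_rec_pv = Rec (Proj 2 0) msp_step_pv msp_step_pv (Proj 3 1)"

definition lsp_step_pv :: pv where
  "lsp_step_pv = fun_of_tm 4 (cond_tm (\<S> (len_tm (Var 0))) (Var 3)
     (Var 1 \<oplus> (\<one> \<sharp> Var 0) \<otimes> App parity_pv [App msp_pv [Var 2, len_tm (Var 0)]]) (Var 1))"

definition lsp_rec_pv :: pv where
  "lsp_rec_pv = Rec (Comp 2 Zero []) lsp_step_pv lsp_step_pv (Proj 3 1)"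

lemma msp_pv_eq: "msp_pv = fun_of_tm 2 (App msp_rec_pv [Var 0, Var 0, Var 1])"
  by (simp add: msp_pv_def msp_rec_pv_def msp_step_pv_def Let_def)

lemma lsp_pv_eq: "lsp_pv = fun_of_tm 2 (App lsp_rec_pv [Var 0, Var 0, Var 1])"
  by (simp add: lsp_pv_def lsp_rec_pv_def lsp_step_pv_def Let_def)

lemma wf_coding:
  "wf_pv msp_rec_pv" "arity msp_rec_pv = 3" "wf_pv msp_pv" "arity msp_pv = 2"
  "wf_pv parity_pv" "arity parity_pv = 1" "wf_pv trailing_zeros_pv" "arity trailing_zeros_pv = 1"
  "wf_pv lsp_rec_pv" "arity lsp_rec_pv = 3" "wf_pv lsp_pv" "arity lsp_pv = 2"
  "wf_pv elem_pv" "arity elem_pv = 2"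
  by (simp_all add: msp_pv_eq msp_rec_pv_def msp_step_pv_def parity_pv_def trailing_zeros_pv_def
      lsp_pv_eq lsp_rec_pv_def lsp_step_pv_def elem_pv_def Let_def)

context arith_model
begin

declare nul_le [simp]

lemmas ring = M.distrib_left M.distrib_right M.add.assoc M.add.commute M.add.left_commute
  M.mult.assoc M.mult.commute M.mult.left_commute suc_mul mul_suc

definition msp_rec where "msp_rec y a j = I msp_rec_pv [y, a, j]"
definition msp where "msp a j = I msp_pv [a, j]"
definition parity where "parity a = I parity_pv [a]"
definition trailing_zeros where "trailing_zeros a = I trailing_zeros_pv [a]"
definition lsp_rec where "lsp_rec y a j = I lsp_rec_pv [y, a, j]"
definition lsp where "lsp a j = I lsp_pv [a, j]"
definition elem where "elem w j = I elem_pv [w, j]"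

lemma dt_coding:
  "dt A \<Longrightarrow> dt B \<Longrightarrow> dt C \<Longrightarrow> dt (\<lambda>\<nu>. msp_rec (A \<nu>) (B \<nu>) (C \<nu>))"
  "dt A \<Longrightarrow> dt B \<Longrightarrow> dt (\<lambda>\<nu>. msp (A \<nu>) (B \<nu>))"
  "dt A \<Longrightarrow> dt (\<lambda>\<nu>. parity (A \<nu>))"
  "dt A \<Longrightarrow> dt (\<lambda>\<nu>. trailing_zeros (A \<nu>))"
  "dt A \<Longrightarrow> dt B \<Longrightarrow> dt C \<Longrightarrow> dt (\<lambda>\<nu>. lsp_rec (A \<nu>) (B \<nu>) (C \<nu>))"
  "dt A \<Longrightarrow> dt B \<Longrightarrow> dt (\<lambda>\<nu>. lsp (A \<nu>) (B \<nu>))"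
  "dt A \<Longrightarrow> dt B \<Longrightarrow> dt (\<lambda>\<nu>. elem (A \<nu>) (B \<nu>))"
  unfolding msp_rec_def msp_def parity_def trailing_zeros_def lsp_rec_def lsp_def elem_def
  by (rule dt_app1 dt_app2 dt_app3; simp add: wf_coding)+

lemma msp_eq: "msp a j = msp_rec a a j"
  unfolding msp_def msp_rec_def msp_pv_eq
  by (subst fun_of_tm_eq) (simp_all add: wf_coding)

lemma lsp_eq: "lsp a j = lsp_rec a a j"
  unfolding lsp_def lsp_rec_def lsp_pv_eq
  by (subst fun_of_tm_eq) (simp_all add: wf_coding)

lemma elem_eq: "elem w j = (let l = trailing_zeros w in lsp (msp w (suc l \<boxplus> j \<boxtimes> l)) l)"
  unfolding elem_def elem_pv_def trailing_zeros_def lsp_def msp_def Let_def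
  by (subst fun_of_tm_eq) (simp_all add: wf_coding)

section \<open>Quotients by powers of two\<close>

lemma msp_rec_nul: "msp_rec nul a j = a"
  using Rec_eq(1)[OF wf_coding(1)[unfolded msp_rec_pv_def], of "[a, j]"]
  by (simp add: msp_rec_def msp_rec_pv_def Proj_eq)

lemma msp_step: "I msp_step_pv [y, r, a, j] = (if suc (len y) \<sqsubseteq> j then half r else r)"
  unfolding msp_step_pv_def by (subst fun_of_tm_eq) (simp_all add: CondLe_eq eval_nat_numeral)

lemma msp_rec_eq0:
  "y \<noteq> nul \<Longrightarrow> msp_rec y a j =
     mn (if len y \<sqsubseteq> j then half (msp_rec (half y) a j) else msp_rec (half y) a j) a"
  using Rec_half[OF wf_coding(1)[unfolded msp_rec_pv_def], of "[a, j]" y] len_half[of y]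
  by (simp add: msp_rec_def msp_rec_pv_def Proj_eq msp_step)

lemma msp_rec_le: "msp_rec y a j \<sqsubseteq> a"
  by (cases "y = nul") (simp_all add: msp_rec_eq0 msp_rec_nul)

lemma msp_rec_eq:
  assumes "y \<noteq> nul"
  shows "msp_rec y a j = (if len y \<sqsubseteq> j then half (msp_rec (half y) a j) else msp_rec (half y) a j)"
proof -
  have "half (msp_rec (half y) a j) \<sqsubseteq> a" using half_le msp_rec_le le_trans by blast
  then show ?thesis using msp_rec_eq0[OF assms, of a j] msp_rec_le[of "half y" a j] by (simp add: mn_def)
qed

text \<open>Two inequalities in place of a division function: quantifier free, hence available for
  induction, and determining \<open>q\<close> uniquely.\<close>

definition is_quotient :: "'a \<Rightarrow> 'a \<Rightarrow> 'a \<Rightarrow> bool" where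
  "is_quotient a p q \<longleftrightarrow> q \<boxtimes> p \<sqsubseteq> a \<and> a \<sqsubset> suc q \<boxtimes> p"

lemma is_quotient_unique:
  assumes "is_quotient a p q" "is_quotient a p r" shows "q = r"
proof -
  have *: False if "is_quotient a p q" "is_quotient a p r" "q \<sqsubset> r" for q r
  proof -
    have "suc q \<boxtimes> p \<sqsubseteq> r \<boxtimes> p" using that(3) by (simp add: lt_suc_iff M.mult_right_mono nul_le)
    then show False using that(1,2) unfolding is_quotient_def
      by (meson M.le_less_trans M.less_le_trans M.less_irrefl)
  qed
  from *[OF assms] *[OF assms(2,1)] show ?thesis using M.linorder_cases by blast
qed

lemma is_quotient_half: assumes "is_quotient a p q" shows "is_quotient a (p \<boxplus> p) (half q)"
proof (cases q rule: half_cases)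
  case 1
  define h where "h = half q"
  with 1 have q: "q = h \<boxplus> h" by simp
  have "a \<sqsubset> suc q \<boxtimes> p" using assms by (simp add: is_quotient_def)
  also have "\<dots> \<sqsubseteq> suc h \<boxtimes> (p \<boxplus> p)" by (simp add: q ring)
  finally show ?thesis using assms by (simp add: is_quotient_def h_def[symmetric] q ring)
next
  case 2
  define h where "h = half q"
  with 2 have q: "q = suc (h \<boxplus> h)" by simp
  have "h \<boxtimes> (p \<boxplus> p) \<sqsubseteq> q \<boxtimes> p" by (simp add: q ring)
  then have "h \<boxtimes> (p \<boxplus> p) \<sqsubseteq> a" using assms le_trans by (auto simp: is_quotient_def)
  then show ?thesis using assms by (simp add: is_quotient_def h_def[symmetric] q ring)
qed

lemma is_quotient_nul: "a \<sqsubset> p \<Longrightarrow> is_quotient a p nul"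
  by (simp add: is_quotient_def nul_le)

lemma pow2_mono: "len u \<sqsubseteq> len v \<Longrightarrow> pow2 u \<sqsubseteq> pow2 v"
proof (cases "len u = len v")
  case False
  assume "len u \<sqsubseteq> len v"
  with False have "len (pow2 u) \<sqsubset> len (pow2 v)" by (simp add: lt_def)
  then show ?thesis by (rule M.less_imp_le[OF len_less])
next
  case True
  then show ?thesis using pow2_cong[OF True] by simp
qed

text \<open>At recursion argument \<open>y\<close> exactly the smaller of \<open>len y\<close> and
  \<open>len v\<close> many halvings have happened; the two implications spell out this minimum. The
  halvings stop once \<open>len v\<close> of them are done.\<close>

lemma msp_rec_quotient:
  "(len y \<sqsubseteq> len v \<longrightarrow> is_quotient a (pow2 y) (msp_rec y a (len v))) \<and>
   (len v \<sqsubseteq> len y \<longrightarrow> is_quotient a (pow2 v) (msp_rec y a (len v)))"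
proof (rule pind[where Q = "\<lambda>y a v _. (len y \<sqsubseteq> len v \<longrightarrow> is_quotient a (pow2 y) (msp_rec y a (len v))) \<and>
   (len v \<sqsubseteq> len y \<longrightarrow> is_quotient a (pow2 v) (msp_rec y a (len v)))" and c = undefined])
  show "(len nul \<sqsubseteq> len v \<longrightarrow> is_quotient a (pow2 nul) (msp_rec nul a (len v))) \<and>
   (len v \<sqsubseteq> len nul \<longrightarrow> is_quotient a (pow2 v) (msp_rec nul a (len v)))"
    by (auto simp: msp_rec_nul is_quotient_def suc_mul)
next
  fix y assume "y \<noteq> nul" and
    IH: "(len (half y) \<sqsubseteq> len v \<longrightarrow> is_quotient a (pow2 (half y)) (msp_rec (half y) a (len v))) \<and>
     (len v \<sqsubseteq> len (half y) \<longrightarrow> is_quotient a (pow2 v) (msp_rec (half y) a (len v)))"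
  then have l: "len y = suc (len (half y))" by (simp add: len_half)
  then have p: "pow2 y = pow2 (half y) \<boxplus> pow2 (half y)" by (rule pow2_suc)
  show "(len y \<sqsubseteq> len v \<longrightarrow> is_quotient a (pow2 y) (msp_rec y a (len v))) \<and>
     (len v \<sqsubseteq> len y \<longrightarrow> is_quotient a (pow2 v) (msp_rec y a (len v)))"
  proof (cases "len y \<sqsubseteq> len v")
    case True
    then have "len (half y) \<sqsubseteq> len v" using l by (metis M.less_le_not_le lt_suc_iff)
    with IH have "is_quotient a (pow2 y) (half (msp_rec (half y) a (len v)))"
      unfolding p by (intro is_quotient_half) blast
    moreover have "pow2 v = pow2 y" if "len v \<sqsubseteq> len y"
      using True that by (intro pow2_cong le_antisym)
    ultimately show ?thesis using True \<open>y \<noteq> nul\<close> by (simp add: msp_rec_eq)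
  next
    case False
    then have "len v \<sqsubseteq> len (half y)" by (simp add: l M.not_le lt_suc_le)
    with False IH \<open>y \<noteq> nul\<close> show ?thesis by (simp add: msp_rec_eq)
  qed
qed (unfold is_quotient_def, intro sb_intros dt_intros dt_pow2 dt_coding)

lemma msp_quotient: "is_quotient a (pow2 v) (msp a (len v))"
proof (cases "len v \<sqsubseteq> len a")
  case True
  then show ?thesis using msp_rec_quotient[of a v a] by (simp add: msp_eq)
next
  \<comment> \<open>With more halvings requested than \<open>a\<close> has bits, the recursion on
    \<open>a\<close> performs all \<open>len a\<close> steps and ends at 0, the quotient by the
    larger power as well.\<close>
  case False
  then have "len a \<sqsubseteq> len v" using le_total by blast
  then have "is_quotient a (pow2 a) (msp a (len v))"
    using msp_rec_quotient[of a v a] by (simp add: msp_eq)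
  moreover have "is_quotient a (pow2 a) nul" by (simp add: is_quotient_nul)
  ultimately have "msp a (len v) = nul" by (rule is_quotient_unique)
  moreover have "a \<sqsubset> pow2 v" using pow2_mono[OF \<open>len a \<sqsubseteq> len v\<close>] less_pow2 M.less_le_trans by blast
  ultimately show ?thesis by (simp add: is_quotient_nul)
qed

lemma msp_unique: "is_quotient a (pow2 v) q \<Longrightarrow> msp a (len v) = q"
  using msp_quotient is_quotient_unique by blast

lemma msp_suc: "len u = suc (len v) \<Longrightarrow> msp a (len u) = half (msp a (len v))"
  using is_quotient_half[OF msp_quotient] by (intro msp_unique) (simp add: pow2_suc)

section \<open>Remainders modulo powers of two\<close>

lemma parity_eq: "parity nul = nul" "parity (y \<boxplus> y) = nul" "parity (suc (y \<boxplus> y)) = one"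
proof -
  note R = Rec_eq[OF wf_coding(5)[unfolded parity_pv_def], of "[]"]
  show *: "parity nul = nul" using R(1) by (simp add: parity_def parity_pv_def)
  have f: "I (fun_of_tm 2 \<zero>) [a, b] = nul" "I (fun_of_tm 2 \<one>) [a, b] = one" "I (fun_of_tm (Suc 0) \<one>) [a] = one" for a b
    by (subst fun_of_tm_eq; simp)+
  show "parity (y \<boxplus> y) = nul"
    using R(2)[of y] * by (cases "y = nul") (simp_all add: parity_def parity_pv_def f mn_def nul_le del: fun_of_tm.simps)
  show "parity (suc (y \<boxplus> y)) = one"
    using R(3)[of y] by (simp add: parity_def parity_pv_def f mn_def del: fun_of_tm.simps)
qed

lemma parity: "x = half x \<boxplus> half x \<boxplus> parity x" "parity x \<sqsubseteq> one"
proof -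
  have "x = half x \<boxplus> half x \<boxplus> parity x \<and> parity x \<sqsubseteq> one"
  proof (cases x rule: half_cases)
    case 1
    then have "parity x = nul" using parity_eq(2) by metis
    with 1 show ?thesis by (simp add: nul_le)
  next
    case 2
    then have "parity x = one" using parity_eq(3) by metis
    with 2 show ?thesis by simp
  qed
  then show "x = half x \<boxplus> half x \<boxplus> parity x" "parity x \<sqsubseteq> one" by blast+
qed

lemma lsp_rec_nul: "lsp_rec nul a j = nul"
  using Rec_eq(1)[OF wf_coding(9)[unfolded lsp_rec_pv_def], of "[a, j]"]
  by (simp add: lsp_rec_def lsp_rec_pv_def Comp_eq)

lemma lsp_step:
  "I lsp_step_pv [y, r, a, j] =
     (if suc (len y) \<sqsubseteq> j then r \<boxplus> pow2 y \<boxtimes> parity (msp a (len y)) else r)"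
  unfolding lsp_step_pv_def
  by (subst fun_of_tm_eq) (simp_all add: CondLe_eq eval_nat_numeral wf_coding pow2_def parity_def msp_def)

lemma lsp_rec_eq:
  "y \<noteq> nul \<Longrightarrow> lsp_rec y a j =
     mn (if len y \<sqsubseteq> j then lsp_rec (half y) a j \<boxplus> pow2 (half y) \<boxtimes> parity (msp a (len (half y)))
         else lsp_rec (half y) a j) a"
  using Rec_half[OF wf_coding(9)[unfolded lsp_rec_pv_def], of "[a, j]" y] len_half[of y]
  by (simp add: lsp_rec_def lsp_rec_pv_def Proj_eq lsp_step)

definition is_division :: "'a \<Rightarrow> 'a \<Rightarrow> 'a \<Rightarrow> 'a \<Rightarrow> bool" where
  "is_division a p q r \<longleftrightarrow> r \<sqsubset> p \<and> a = p \<boxtimes> q \<boxplus> r"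

lemma is_division_quotient: "is_division a p q r \<Longrightarrow> is_quotient a p q"
  by (auto simp: is_division_def is_quotient_def ring)

lemma is_division_unique:
  assumes "is_division a p q r" "is_division a p q' r'" shows "q = q'" "r = r'"
proof -
  show "q = q'" using assms is_division_quotient is_quotient_unique by blast
  with assms show "r = r'" by (simp add: is_division_def)
qed

text \<open>Each step takes the lowest bit off the current quotient and adds it, with its weight, to
  the remainder. The quotient is expressed by \<open>msp\<close>, so the invariant is division with
  remainder by the smaller of the two powers.\<close>

lemma lsp_rec_division:
  "(len y \<sqsubseteq> len v \<longrightarrow> is_division a (pow2 y) (msp a (len y)) (lsp_rec y a (len v))) \<and>
   (len v \<sqsubseteq> len y \<longrightarrow> is_division a (pow2 v) (msp a (len v)) (lsp_rec y a (len v)))"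
proof (rule pind[where Q = "\<lambda>y a v _.
    (len y \<sqsubseteq> len v \<longrightarrow> is_division a (pow2 y) (msp a (len y)) (lsp_rec y a (len v))) \<and>
    (len v \<sqsubseteq> len y \<longrightarrow> is_division a (pow2 v) (msp a (len v)) (lsp_rec y a (len v)))" and c = undefined])
  have "msp a (len nul) = a" by (rule msp_unique) (simp add: is_quotient_def suc_mul)
  then have "is_division a (pow2 nul) (msp a (len nul)) (lsp_rec nul a (len v))"
    by (simp add: is_division_def lsp_rec_nul suc_mul)
  then show "(len nul \<sqsubseteq> len v \<longrightarrow> is_division a (pow2 nul) (msp a (len nul)) (lsp_rec nul a (len v))) \<and>
    (len v \<sqsubseteq> len nul \<longrightarrow> is_division a (pow2 v) (msp a (len v)) (lsp_rec nul a (len v)))"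
    by auto
next
  fix y assume "y \<noteq> nul" and
    IH: "(len (half y) \<sqsubseteq> len v \<longrightarrow> is_division a (pow2 (half y)) (msp a (len (half y))) (lsp_rec (half y) a (len v))) \<and>
    (len v \<sqsubseteq> len (half y) \<longrightarrow> is_division a (pow2 v) (msp a (len v)) (lsp_rec (half y) a (len v)))"
  then have l: "len y = suc (len (half y))" by (simp add: len_half)
  then have p: "pow2 y = pow2 (half y) \<boxplus> pow2 (half y)" by (rule pow2_suc)
  show "(len y \<sqsubseteq> len v \<longrightarrow> is_division a (pow2 y) (msp a (len y)) (lsp_rec y a (len v))) \<and>
    (len v \<sqsubseteq> len y \<longrightarrow> is_division a (pow2 v) (msp a (len v)) (lsp_rec y a (len v)))"
  proof (cases "len y \<sqsubseteq> len v")
    case True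
    then have "len (half y) \<sqsubseteq> len v" using l by (metis M.less_le_not_le lt_suc_iff)
    define P R m where "P = pow2 (half y)" and "R = lsp_rec (half y) a (len v)" and "m = msp a (len (half y))"
    have R: "R \<sqsubset> P" "a = P \<boxtimes> m \<boxplus> R"
      using IH \<open>len (half y) \<sqsubseteq> len v\<close> by (auto simp: is_division_def P_def R_def m_def)
    have h: "msp a (len y) = half m" unfolding m_def using l by (rule msp_suc)
    have "a = P \<boxtimes> (half m \<boxplus> half m \<boxplus> parity m) \<boxplus> R" using R(2) parity(1)[of m] by simp
    then have a: "a = (P \<boxplus> P) \<boxtimes> half m \<boxplus> (R \<boxplus> P \<boxtimes> parity m)" by (simp add: ring)
    then have "R \<boxplus> P \<boxtimes> parity m \<sqsubseteq> a" by (metis le_add1(2))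
    then have e: "lsp_rec y a (len v) = R \<boxplus> P \<boxtimes> parity m"
      using True \<open>y \<noteq> nul\<close> by (simp add: lsp_rec_eq mn_def P_def R_def m_def)
    \<comment> \<open>The new bit contributes at most \<open>P\<close>, so the remainder remains
      below the doubled divisor.\<close>
    have "P \<boxtimes> parity m \<sqsubseteq> P \<boxtimes> one" by (rule M.mult_left_mono[OF parity(2) nul_le])
    then have "R \<boxplus> P \<boxtimes> parity m \<sqsubset> P \<boxplus> P"
      using M.add_less_le_mono[OF R(1)] by (simp add: mul_suc)
    with a have "is_division a (pow2 y) (msp a (len y)) (lsp_rec y a (len v))"
      unfolding p P_def[symmetric] e h is_division_def by simp
    moreover have "len v = len y" if "len v \<sqsubseteq> len y" using True that by (intro le_antisym)
    moreover have "pow2 v = pow2 y" if "len v \<sqsubseteq> len y" using True that by (intro pow2_cong le_antisym)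
    ultimately show ?thesis by auto
  next
    case False
    then have "len v \<sqsubseteq> len (half y)" by (simp add: l M.not_le lt_suc_le)
    with IH have *: "is_division a (pow2 v) (msp a (len v)) (lsp_rec (half y) a (len v))" by blast
    then have "lsp_rec (half y) a (len v) \<sqsubseteq> a" unfolding is_division_def by (metis le_add1(2))
    with * False \<open>y \<noteq> nul\<close> show ?thesis by (simp add: lsp_rec_eq mn_def)
  qed
qed (unfold is_division_def, intro sb_intros dt_intros dt_pow2 dt_coding)

lemma division: "is_division a (pow2 v) (msp a (len v)) (lsp a (len v))"
proof (cases "len v \<sqsubseteq> len a")
  case True
  then show ?thesis using lsp_rec_division[of a v a] by (simp add: lsp_eq)
next
  case False
  then have l: "len a \<sqsubseteq> len v" using le_total by blast
  then have "is_division a (pow2 a) (msp a (len a)) (lsp a (len v))"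
    using lsp_rec_division[of a v a] by (simp add: lsp_eq)
  moreover have "is_division a (pow2 a) nul a" by (simp add: is_division_def)
  ultimately have "lsp a (len v) = a" by (rule is_division_unique(2))
  moreover have "a \<sqsubset> pow2 v" using pow2_mono[OF l] less_pow2 M.less_le_trans by blast
  moreover from this have "msp a (len v) = nul" by (intro msp_unique is_quotient_nul)
  ultimately show ?thesis by (simp add: is_division_def)
qed

lemma msp_lsp_unique:
  "is_division a (pow2 v) q r \<Longrightarrow> msp a (len v) = q" "is_division a (pow2 v) q r \<Longrightarrow> lsp a (len v) = r"
  using division is_division_unique by blast+

section \<open>Trailing zeros\<close>

lemma trailing_zeros_eq:
  "y \<noteq> nul \<Longrightarrow> trailing_zeros (y \<boxplus> y) = mn (suc (trailing_zeros y)) (y \<boxplus> y)"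
  "trailing_zeros (suc (y \<boxplus> y)) = nul"
proof -
  note R = Rec_eq[OF wf_coding(7)[unfolded trailing_zeros_pv_def], of "[]"]
  have f: "I (fun_of_tm 2 \<zero>) [a, b] = nul" "I (fun_of_tm 2 (\<S> (Var (Suc 0)))) [a, b] = suc b"
    "I (fun_of_tm (Suc 0) (Var 0)) [a] = a" for a b
    by (subst fun_of_tm_eq; simp)+
  show "y \<noteq> nul \<Longrightarrow> trailing_zeros (y \<boxplus> y) = mn (suc (trailing_zeros y)) (y \<boxplus> y)"
    using R(2)[of y] by (simp add: trailing_zeros_def trailing_zeros_pv_def f del: fun_of_tm.simps)
  show "trailing_zeros (suc (y \<boxplus> y)) = nul"
    using R(3)[of y] by (simp add: trailing_zeros_def trailing_zeros_pv_def f mn_def nul_le del: fun_of_tm.simps)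
qed

text \<open>A positive number is written as a power of two times an odd number. Passing from
  \<open>v\<close> to \<open>suc v\<close> either leaves the power unchanged or doubles it, which
  adds one zero.\<close>

lemma trailing_zeros: "trailing_zeros (pow2 v \<boxtimes> suc (c \<boxplus> c)) = len v"
proof (rule induct[where Q = "\<lambda>v c _ _. trailing_zeros (pow2 v \<boxtimes> suc (c \<boxplus> c)) = len v"
      and b = undefined and c = undefined])
  show "trailing_zeros (pow2 nul \<boxtimes> suc (c \<boxplus> c)) = len nul"
    using trailing_zeros_eq(2)[of c] by (simp add: suc_mul)
next
  fix v assume IH: "trailing_zeros (pow2 v \<boxtimes> suc (c \<boxplus> c)) = len v"
  show "trailing_zeros (pow2 (suc v) \<boxtimes> suc (c \<boxplus> c)) = len (suc v)"
    using len_suc[of v]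
  proof
    assume "len (suc v) = len v" then show ?thesis using IH pow2_cong[of "suc v" v] by simp
  next
    assume l: "len (suc v) = suc (len v)"
    let ?w = "pow2 v \<boxtimes> suc (c \<boxplus> c)"
    have "?w \<noteq> nul" using M.no_zero_divisors by simp
    \<comment> \<open>The count must be compared with the limiting value
      \<open>?w \<boxplus> ?w\<close> of the recursion; it lies below, so the minimum is the
      count.\<close>
    have "suc (len v) \<sqsubseteq> suc v" by simp
    also have "suc v \<sqsubseteq> pow2 v" by (simp add: lt_suc_iff[symmetric])
    also have "pow2 v \<sqsubseteq> ?w" by (simp add: mul_suc)
    also have "?w \<sqsubseteq> ?w \<boxplus> ?w" by simp
    finally have "mn (suc (len v)) (?w \<boxplus> ?w) = suc (len v)" by (simp add: mn_def)
    moreover have "pow2 (suc v) \<boxtimes> suc (c \<boxplus> c) = ?w \<boxplus> ?w"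
      by (simp only: pow2_suc[OF l] M.distrib_right)
    ultimately show ?thesis
      using trailing_zeros_eq(1)[OF \<open>?w \<noteq> nul\<close>] IH l by simp
  qed
qed (intro sb_intros dt_intros dt_pow2 dt_coding)

end

section \<open>Updating codes and majorants\<close>

context arith_model
begin

text \<open>Lengths start at 0 and grow by at most one per successor. If they skipped
  \<open>k\<close>, they would all remain below \<open>k\<close>, against the assumption on
  \<open>z\<close>. This makes bit positions available as exponents.\<close>

lemma len_ex: assumes "k \<sqsubseteq> len z" shows "\<exists>v. len v = k"
proof (rule ccontr)
  assume no: "\<nexists>v. len v = k"
  have "len v \<sqsubset> k" for v
  proof (rule induct[where Q = "\<lambda>v k _ _. len v \<sqsubset> k" and b = undefined and c = undefined])
    show "len nul \<sqsubset> k" using no len_nul by (auto simp: lt_def)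
  next
    fix v assume "len v \<sqsubset> k"
    then have "suc (len v) \<sqsubseteq> k" by (simp add: lt_suc_iff)
    then have "len (suc v) \<sqsubseteq> k" using len_suc[of v] \<open>len v \<sqsubset> k\<close> by (auto simp: lt_def)
    then show "len (suc v) \<sqsubset> k" using no by (auto simp: lt_def)
  qed (intro sb_intros dt_intros)
  with assms show False using M.not_le by blast
qed

text \<open>
  \<open>w = 2 ^ |t|\<close> modulo \<open>2 ^ (|t| + 1)\<close>, that is, \<open>w\<close> has exactly \<open>|t|\<close> trailing zeros and its
  blocks are of length \<open>|t|\<close>.
\<close>

definition well_coded :: "'a \<Rightarrow> 'a \<Rightarrow> bool" where
  "well_coded t w \<longleftrightarrow> lsp w (suc (len t)) = pow2 t"

text \<open>The arguments of \<open>smash\<close> have lengths \<open>len t\<close> + 1 and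
  \<open>len x\<close> + 2, so \<open>z\<close> has length (\<open>len t\<close> +
  1)(\<open>len x\<close> + 2) + 1. This covers the marker of \<open>len t\<close> + 1 bits and the
  blocks 0 to \<open>len x\<close> of \<open>len t\<close> bits each. Doubling turns a comparison of
  lengths into one of numbers.\<close>

definition code_bound :: "'a \<Rightarrow> 'a \<Rightarrow> 'a" where
  "code_bound t x = (let z = smash (suc (t \<boxplus> t)) (suc (suc (x \<boxplus> x) \<boxplus> suc (x \<boxplus> x))) in z \<boxplus> z)"

lemma dt_code_bound: "dt A \<Longrightarrow> dt B \<Longrightarrow> dt (\<lambda>\<nu>. code_bound (A \<nu>) (B \<nu>))"
  unfolding code_bound_def Let_def by (intro dt_intros)

lemma sb_well_coded: "dt A \<Longrightarrow> dt B \<Longrightarrow> sb (\<lambda>\<nu>. well_coded (A \<nu>) (B \<nu>))"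
  unfolding well_coded_def by (intro sb_intros dt_intros dt_coding dt_pow2)

lemma trailing_zeros_well_coded: "well_coded t w \<Longrightarrow> trailing_zeros w = len t"
proof -
  assume "well_coded t w"
  then have "is_division w (pow2 t \<boxplus> pow2 t) (msp w (suc (len t))) (pow2 t)"
    using division[of w "suc (t \<boxplus> t)"] by (simp add: well_coded_def)
  then have "w = pow2 t \<boxtimes> suc (msp w (suc (len t)) \<boxplus> msp w (suc (len t)))"
    unfolding is_division_def by (simp add: ring)
  then show ?thesis using trailing_zeros by metis
qed

lemma well_coded_pow2: "well_coded t (pow2 t)"
proof -
  have "pow2 t \<sqsubset> pow2 t \<boxplus> pow2 t"
    using M.add_less_le_mono[of nul "pow2 t" "pow2 t" "pow2 t"] by (simp add: neq_nul_iff[symmetric])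
  then have "is_division (pow2 t) (pow2 (suc (t \<boxplus> t))) nul (pow2 t)" by (simp add: is_division_def)
  then show ?thesis using msp_lsp_unique(2) len_double(2) unfolding well_coded_def by metis
qed

lemma lsp_add:
  assumes "len v \<sqsubseteq> len u" shows "lsp (pow2 u \<boxtimes> q \<boxplus> r) (len v) = lsp r (len v)"
proof -
  obtain k where k: "len v \<boxplus> k = len u" using le_imp_add[OF assms] by blast
  then obtain d where "len d = k" using len_ex[of k u] by (metis le_add1(2))
  with k have "len u = len v \<boxplus> len d" by simp
  then have p: "pow2 u = pow2 v \<boxtimes> pow2 d" by (rule pow2_add)
  have "is_division r (pow2 v) (msp r (len v)) (lsp r (len v))" by (rule division)
  then have "is_division (pow2 u \<boxtimes> q \<boxplus> r) (pow2 v) (pow2 d \<boxtimes> q \<boxplus> msp r (len v)) (lsp r (len v))"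
    unfolding is_division_def p by (simp add: M.distrib_left M.mult.assoc M.add.assoc)
  then show ?thesis by (rule msp_lsp_unique)
qed

text \<open>A block is the same whether the bits below it or those above it are removed first. Hence
  an entry of a sequence depends only on the bits of the code up to the end of its block.\<close>

lemma lsp_msp:
  assumes "len u = len v \<boxplus> len t"
  shows "lsp (msp a (len v)) (len t) = msp (lsp a (len u)) (len v)"
proof -
  have p: "pow2 u = pow2 v \<boxtimes> pow2 t" using assms by (rule pow2_add)
  define m r where "m = msp a (len v)" and "r = lsp a (len v)"
  define q e where "q = msp m (len t)" and "e = lsp m (len t)"
  have a: "r \<sqsubset> pow2 v" "a = pow2 v \<boxtimes> m \<boxplus> r"
    using division[of a v] by (auto simp: is_division_def m_def r_def)
  have m: "e \<sqsubset> pow2 t" "m = pow2 t \<boxtimes> q \<boxplus> e"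
    using division[of m t] by (auto simp: is_division_def q_def e_def)
  have "pow2 v \<boxtimes> e \<boxplus> r \<sqsubset> pow2 v \<boxtimes> suc e" using a(1) by (simp add: mul_suc)
  also have "pow2 v \<boxtimes> suc e \<sqsubseteq> pow2 u"
    unfolding p using m(1) by (intro M.mult_left_mono) (simp_all add: lt_suc_iff)
  finally have "is_division a (pow2 u) q (pow2 v \<boxtimes> e \<boxplus> r)"
    unfolding is_division_def p a(2) m(2) by (simp add: M.distrib_left M.mult.assoc M.add.assoc)
  then have "lsp a (len u) = pow2 v \<boxtimes> e \<boxplus> r" by (rule msp_lsp_unique)
  moreover have "msp (pow2 v \<boxtimes> e \<boxplus> r) (len v) = e"
    using a(1) by (intro msp_lsp_unique(1)) (simp add: is_division_def)
  ultimately show ?thesis by (simp add: e_def m_def)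
qed

text \<open>The bits of \<open>w\<close> below block \<open>n\<close> are kept, \<open>s\<close> is
  written above them, and everything higher is discarded. Earlier entries and the marker lie in the
  part that is kept, and the new code obeys a bound given by \<open>t\<close> and \<open>x\<close>
  alone, however large \<open>w\<close> was. That uniform bound is what an induction on
  \<open>n\<close> needs.\<close>

lemma update:
  assumes n: "n \<sqsubseteq> len x" and w: "well_coded t w" and s: "len s \<sqsubseteq> len t"
  shows "\<exists>w'. w' \<sqsubseteq> code_bound t x \<and> well_coded t w' \<and>
    (\<forall>j. j \<sqsubset> n \<longrightarrow> elem w' j = elem w j) \<and> elem w' n = s"
proof -
  define z where "z = smash (suc (t \<boxplus> t)) (suc (suc (x \<boxplus> x) \<boxplus> suc (x \<boxplus> x)))"
  define pos where "pos j = suc (len t) \<boxplus> j \<boxtimes> len t" for j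
  have pos_suc: "pos (suc j) = pos j \<boxplus> len t" for j by (simp add: pos_def suc_mul M.add.assoc)
  have pos_mono: "pos i \<sqsubseteq> pos j" if "i \<sqsubseteq> j" for i j
    using that unfolding pos_def by (intro M.add_left_mono M.mult_right_mono nul_le)
  have "pos (suc n) \<sqsubseteq> pos (suc (len x))" using n by (intro pos_mono) simp
  also have "\<dots> \<sqsubseteq> pos (suc (len x)) \<boxplus> suc (len x)" by (rule le_add1)
  also have "\<dots> = suc (len t) \<boxtimes> suc (suc (len x))" by (simp add: pos_def ring)
  finally have pz: "suc (pos (suc n)) \<sqsubseteq> len z" by (simp only: z_def len_smash len_double suc_le_suc)
  \<comment> \<open>Quotients and remainders are understood only at exponents that are lengths;
    \<open>z\<close> is long enough to realize every position up to the end of block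
    \<open>n\<close>.\<close>
  have pos_len: "\<exists>v. len v = pos j" if "j \<sqsubseteq> suc n" for j
    using len_ex[of "pos j" z] pos_mono[OF that] pz le_suc le_trans by metis
  obtain u where u: "len u = pos n" using pos_len[of n] by (auto simp: le_suc)
  obtain V where V: "len V = pos (suc n)" using pos_len[of "suc n"] by auto
  have pV: "pow2 V = pow2 u \<boxtimes> pow2 t" using u V pos_suc by (intro pow2_add) simp
  define q r where "q = msp w (len u)" and "r = lsp w (len u)"
  have r: "r \<sqsubset> pow2 u" "w = pow2 u \<boxtimes> q \<boxplus> r"
    using division[of w u] by (auto simp: is_division_def q_def r_def)
  define w' where "w' = pow2 u \<boxtimes> s \<boxplus> r"
  have lsp: "lsp w' (len v) = lsp w (len v)" if "len v \<sqsubseteq> pos n" for v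
    unfolding w'_def r(2) using lsp_add[of v u] that u by simp
  have "s \<sqsubset> pow2 s" by simp
  also have "pow2 s \<sqsubseteq> pow2 t" using s by (rule pow2_mono)
  finally have s': "s \<sqsubset> pow2 t" .
  have "w' \<sqsubset> pow2 u \<boxtimes> suc s" unfolding w'_def using r(1) by (simp add: mul_suc)
  also have "pow2 u \<boxtimes> suc s \<sqsubseteq> pow2 V"
    unfolding pV using s' by (intro M.mult_left_mono) (simp_all add: lt_suc_iff)
  finally have "len w' \<sqsubseteq> len (pow2 V)" by (intro len_mono) (simp add: lt_def)
  then have "len w' \<sqsubseteq> len z" using pz V le_trans by simp
  then have bound: "w' \<sqsubseteq> code_bound t x"
    unfolding code_bound_def z_def[symmetric] Let_def by (rule len_le_imp)
  have "pos nul \<sqsubseteq> pos n" by (rule pos_mono) simp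
  then have good: "well_coded t w'"
    using w lsp[of "suc (t \<boxplus> t)"] by (simp add: well_coded_def pos_def)
  have e: "elem w' j = lsp (msp w' (pos j)) (len t)" "elem w j = lsp (msp w (pos j)) (len t)" for j
    using trailing_zeros_well_coded[OF good] trailing_zeros_well_coded[OF w]
    by (simp_all add: elem_eq pos_def Let_def)
  have "elem w' j = elem w j" if "j \<sqsubset> n" for j
  proof -
    have "suc j \<sqsubseteq> n" using that by (simp add: lt_suc_iff)
    then have "j \<sqsubseteq> suc n" "suc j \<sqsubseteq> suc n" using le_suc le_trans suc_le_suc by blast+
    then obtain a b where ab: "len a = pos j" "len b = pos (suc j)" using pos_len by metis
    then have *: "len b = len a \<boxplus> len t" by (simp add: pos_suc)
    have "len b \<sqsubseteq> pos n" using ab pos_mono[OF \<open>suc j \<sqsubseteq> n\<close>] by simp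
    from lsp[OF this] show ?thesis
      unfolding e ab(1)[symmetric] lsp_msp[OF *] by simp
  qed
  moreover have "elem w' n = s"
  proof -
    have "msp w' (len u) = s"
      using r(1) by (intro msp_lsp_unique(1)) (simp add: is_division_def w'_def)
    moreover have "lsp s (len t) = s"
      using s' by (intro msp_lsp_unique(2)[of _ _ nul]) (simp add: is_division_def)
    ultimately show ?thesis by (simp add: e u)
  qed
  ultimately show ?thesis using bound good by blast
qed

text \<open>A pair is a sequence coded with blocks as long as the sum \<open>a \<boxplus> b\<close>,
  so that either component fits. As \<open>len one\<close> is \<open>one\<close>, this bound admits
  exactly the indices 0 and 1, and writing entry 1 after entry 0 leaves the latter intact.\<close>

definition pair_bound :: "'a \<Rightarrow> 'a \<Rightarrow> 'a" where
  "pair_bound a b = code_bound (a \<boxplus> b) one"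

lemma dt_pair_bound: "dt A \<Longrightarrow> dt B \<Longrightarrow> dt (\<lambda>\<nu>. pair_bound (A \<nu>) (B \<nu>))"
  unfolding pair_bound_def by (intro dt_code_bound dt_intros)

lemma pair_ex:
  assumes "y \<sqsubseteq> a" "z \<sqsubseteq> b"
  shows "\<exists>p. p \<sqsubseteq> pair_bound a b \<and> elem p nul = y \<and> elem p one = z"
proof -
  have "y \<sqsubseteq> a \<boxplus> b" "z \<sqsubseteq> a \<boxplus> b" using assms le_add1 le_trans by blast+
  then have l: "len y \<sqsubseteq> len (a \<boxplus> b)" "len z \<sqsubseteq> len (a \<boxplus> b)" by (simp_all add: len_mono)
  obtain p where p: "well_coded (a \<boxplus> b) p" "elem p nul = y"
    using update[OF _ well_coded_pow2 l(1), of nul one] by auto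
  obtain p' where "p' \<sqsubseteq> code_bound (a \<boxplus> b) one" "\<forall>j. j \<sqsubset> one \<longrightarrow> elem p' j = elem p j" "elem p' one = z"
    using update[OF _ p(1) l(2), of one one] by auto
  with p(2) show ?thesis unfolding pair_bound_def by (metis lt_suc)
qed

text \<open>
  Two quantifiers are merged by bounding a code of the pair, and this bound may not depend on the
  first of the two variables. Hence every term needs a bound that is monotone in its variables.
\<close>

definition has_majorant :: "pv \<Rightarrow> bool" where
  "has_majorant f \<longleftrightarrow> (\<exists>T. dt T \<and> (\<forall>xs \<nu>. length xs = arity f \<longrightarrow>
     (\<forall>i < arity f. xs ! i \<sqsubseteq> \<nu> i) \<longrightarrow> I f xs \<sqsubseteq> T \<nu>))"

lemma has_majorantI:
  "dt T \<Longrightarrow> (\<And>xs \<nu>. length xs = arity f \<Longrightarrow> (\<And>i. i < arity f \<Longrightarrow> xs ! i \<sqsubseteq> \<nu> i) \<Longrightarrow> I f xs \<sqsubseteq> T \<nu>)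
    \<Longrightarrow> has_majorant f"
  unfolding has_majorant_def by blast

lemma has_majorantI2:
  assumes "arity f = 2" "dt T" "\<And>x y \<nu>. x \<sqsubseteq> \<nu> 0 \<Longrightarrow> y \<sqsubseteq> \<nu> (Suc 0) \<Longrightarrow> I f [x, y] \<sqsubseteq> T \<nu>"
  shows "has_majorant f"
proof (rule has_majorantI[OF assms(2)])
  fix xs \<nu> assume *: "length xs = arity f" "\<And>i. i < arity f \<Longrightarrow> xs ! i \<sqsubseteq> \<nu> i"
  then obtain x y where "xs = [x, y]" using assms(1) by (auto simp: length_Suc_conv numeral_2_eq_2)
  with *(2)[of 0] *(2)[of 1] assms(1) show "I f xs \<sqsubseteq> T \<nu>" by (auto intro: assms(3))
qed

text \<open>The comparison goes through lengths, which fix a number only up to a factor of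
  two.\<close>

lemma smash_mono: "x \<sqsubseteq> a \<Longrightarrow> y \<sqsubseteq> b \<Longrightarrow> smash x y \<sqsubseteq> smash a b \<boxplus> smash a b"
  by (rule len_le_imp) (simp add: len_smash M.mult_mono len_mono)

text \<open>By induction on the symbol. For \<open>Rec\<close> no analysis of the recursion is
  needed: the value is either the initial value or cut off at the limiting function, so the sum of
  the majorants of \<open>g\<close> and \<open>k\<close> suffices. For \<open>CondLe\<close> the sum
  of the two possible results is taken, since the test itself is not monotone.\<close>

lemma has_majorant: "wf_pv f \<Longrightarrow> has_majorant f"
proof (induction f)
  case Zero
  show ?case by (rule has_majorantI[OF dt_nul]) simp
next
  case Succ
  show ?case by (rule has_majorantI[OF dt_suc[OF dt_var[of 0]]]) (auto simp: length_Suc_conv)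
next
  case Add
  have "dt (\<lambda>\<nu>. \<nu> 0 \<boxplus> \<nu> (Suc 0))" by (intro dt_intros)
  then show ?case by (rule has_majorantI2[rotated]) (simp_all add: M.add_mono)
next
  case Mul
  have "dt (\<lambda>\<nu>. \<nu> 0 \<boxtimes> \<nu> (Suc 0))" by (intro dt_intros)
  then show ?case by (rule has_majorantI2[rotated]) (simp_all add: M.mult_mono)
next
  case Half
  show ?case by (rule has_majorantI[OF dt_var[of 0]]) (auto simp: length_Suc_conv intro: le_trans[OF half_le])
next
  case Len
  show ?case by (rule has_majorantI[OF dt_var[of 0]]) (auto simp: length_Suc_conv intro: le_trans[OF len_le])
next
  case Smash
  have "dt (\<lambda>\<nu>. smash (\<nu> 0) (\<nu> (Suc 0)) \<boxplus> smash (\<nu> 0) (\<nu> (Suc 0)))" by (intro dt_intros)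
  then show ?case by (rule has_majorantI2[rotated]) (simp_all add: smash_mono)
next
  case CondLe
  have "dt (\<lambda>\<nu>. \<nu> 2 \<boxplus> \<nu> 3)" by (intro dt_intros)
  then show ?case
  proof (rule has_majorantI)
    fix xs \<nu> assume *: "length xs = arity CondLe" "\<And>i. i < arity CondLe \<Longrightarrow> xs ! i \<sqsubseteq> \<nu> i"
    then obtain x y u v where xs: "xs = [x, y, u, v]" by (auto simp: length_Suc_conv eval_nat_numeral)
    from *(2)[of 2] *(2)[of 3] have "u \<sqsubseteq> \<nu> 2" "v \<sqsubseteq> \<nu> 3" by (simp_all add: xs)
    then show "I CondLe xs \<sqsubseteq> \<nu> 2 \<boxplus> \<nu> 3"
      unfolding xs CondLe_eq by (simp add: le_trans[OF _ le_add1(1)] le_trans[OF _ le_add1(2)])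
  qed
next
  case (Proj n i)
  then show ?case by (intro has_majorantI[OF dt_var[of i]]) (simp add: Proj_eq)
next
  case (Comp n f gs)
  then have "has_majorant f" and gs: "\<forall>g \<in> set gs. has_majorant g" by auto
  then obtain T where T: "dt T" "\<And>xs \<nu>. length xs = arity f \<Longrightarrow> \<forall>i < arity f. xs ! i \<sqsubseteq> \<nu> i \<Longrightarrow> I f xs \<sqsubseteq> T \<nu>"
    unfolding has_majorant_def by blast
  from bchoice[OF gs[unfolded has_majorant_def]]
  obtain B where "\<forall>g \<in> set gs. dt (B g) \<and> (\<forall>xs \<nu>. length xs = arity g \<longrightarrow>
      (\<forall>i < arity g. xs ! i \<sqsubseteq> \<nu> i) \<longrightarrow> I g xs \<sqsubseteq> B g \<nu>)" ..
  then have B: "\<And>g. g \<in> set gs \<Longrightarrow> dt (B g)" "\<And>g xs \<nu>. g \<in> set gs \<Longrightarrow> length xs = arity g \<Longrightarrow>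
      \<forall>i < arity g. xs ! i \<sqsubseteq> \<nu> i \<Longrightarrow> I g xs \<sqsubseteq> B g \<nu>"
    by blast+
  define \<sigma> where "\<sigma> i = (if i < length gs then B (gs ! i) else (\<lambda>\<nu>. \<nu> i))" for i
  have "dt (\<sigma> i)" for i using B(1) by (simp add: \<sigma>_def dt_var)
  with T(1) have "dt (\<lambda>\<nu>. T (\<lambda>i. \<sigma> i \<nu>))" by (rule dt_subst)
  then show ?case
  proof (rule has_majorantI)
    fix xs \<nu> assume xs: "length xs = arity (Comp n f gs)" "\<And>i. i < arity (Comp n f gs) \<Longrightarrow> xs ! i \<sqsubseteq> \<nu> i"
    have "I f (map (\<lambda>g. I g xs) gs) \<sqsubseteq> T (\<lambda>i. \<sigma> i \<nu>)"
      using Comp.prems xs by (intro T(2)) (auto simp: \<sigma>_def intro!: B(2))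
    then show "I (Comp n f gs) xs \<sqsubseteq> T (\<lambda>i. \<sigma> i \<nu>)" using Comp.prems xs by (simp only: Comp_eq arity.simps)
  qed
next
  case (Rec g h0 h1 k)
  then have "has_majorant g" "has_majorant k" by auto
  then obtain G K where G: "dt G" "\<And>xs \<nu>. length xs = arity g \<Longrightarrow> \<forall>i < arity g. xs ! i \<sqsubseteq> \<nu> i \<Longrightarrow> I g xs \<sqsubseteq> G \<nu>"
    and K: "dt K" "\<And>xs \<nu>. length xs = arity k \<Longrightarrow> \<forall>i < arity k. xs ! i \<sqsubseteq> \<nu> i \<Longrightarrow> I k xs \<sqsubseteq> K \<nu>"
    unfolding has_majorant_def by metis
  have "dt (\<lambda>\<nu>. G (\<lambda>i. \<nu> (Suc i)) \<boxplus> K \<nu>)"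
    by (intro dt_add K(1) dt_subst[OF G(1)] dt_var)
  then show ?case
  proof (rule has_majorantI)
    fix xs \<nu>
    assume *: "length xs = arity (Rec g h0 h1 k)" "\<And>i. i < arity (Rec g h0 h1 k) \<Longrightarrow> xs ! i \<sqsubseteq> \<nu> i"
    then obtain y ys where xs: "xs = y # ys" "length ys = arity g" by (auto simp: length_Suc_conv)
    have g: "I g ys \<sqsubseteq> G (\<lambda>i. \<nu> (Suc i))" using *(2)[of "Suc _"] xs by (intro G(2)) auto
    have k: "I k xs \<sqsubseteq> K \<nu>" using * Rec.prems by (intro K(2)) auto
    note R = Rec_eq[OF Rec.prems xs(2)]
    have "I (Rec g h0 h1 k) xs \<sqsubseteq> G (\<lambda>i. \<nu> (Suc i)) \<or> I (Rec g h0 h1 k) xs \<sqsubseteq> K \<nu>"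
    proof (cases "y = nul")
      case True
      with R(1) g show ?thesis by (simp add: xs)
    next
      case y: False
      have "I (Rec g h0 h1 k) xs \<sqsubseteq> I k xs"
      proof (cases y rule: half_cases)
        case 1
        moreover from this y have "half y \<noteq> nul" by auto
        ultimately show ?thesis using R(2)[of "half y"] by (simp add: xs(1))
      next
        case 2
        then show ?thesis using R(3)[of "half y"] by (simp add: xs(1))
      qed
      with k show ?thesis using le_trans by blast
    qed
    then show "I (Rec g h0 h1 k) xs \<sqsubseteq> G (\<lambda>i. \<nu> (Suc i)) \<boxplus> K \<nu>" using le_add1 le_trans by blast
  qed
qed

lemma dt_majorant:
  assumes "dt T"
  obtains B where "dt B" "\<And>\<nu> \<nu>'. (\<And>i. \<nu> i \<sqsubseteq> \<nu>' i) \<Longrightarrow> T \<nu> \<sqsubseteq> B \<nu>'"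
proof -
  have "wf_tm t \<Longrightarrow> \<exists>B. dt B \<and> (\<forall>\<nu> \<nu>'. (\<forall>i. \<nu> i \<sqsubseteq> \<nu>' i) \<longrightarrow> eval I \<nu> t \<sqsubseteq> B \<nu>')" for t
  proof (induction t)
    case (Var n)
    show ?case by (intro exI[of _ "\<lambda>\<nu>. \<nu> n"]) (simp add: dt_var)
  next
    case (App f ts)
    then have "has_majorant f" by (simp add: has_majorant)
    then obtain F where F: "dt F" "\<And>xs \<nu>. length xs = arity f \<Longrightarrow> \<forall>i < arity f. xs ! i \<sqsubseteq> \<nu> i \<Longrightarrow> I f xs \<sqsubseteq> F \<nu>"
      unfolding has_majorant_def by blast
    from App have "\<forall>t \<in> set ts. \<exists>B. dt B \<and> (\<forall>\<nu> \<nu>'. (\<forall>i. \<nu> i \<sqsubseteq> \<nu>' i) \<longrightarrow> eval I \<nu> t \<sqsubseteq> B \<nu>')" by auto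
    then obtain B where B: "\<And>t. t \<in> set ts \<Longrightarrow> dt (B t)"
      "\<And>t \<nu> \<nu>'. t \<in> set ts \<Longrightarrow> \<forall>i. \<nu> i \<sqsubseteq> \<nu>' i \<Longrightarrow> eval I \<nu> t \<sqsubseteq> B t \<nu>'" by metis
    define \<sigma> where "\<sigma> i = (if i < length ts then B (ts ! i) else (\<lambda>\<nu>. \<nu> i))" for i
    have "dt (\<sigma> i)" for i using B(1) by (simp add: \<sigma>_def dt_var)
    with F(1) have "dt (\<lambda>\<nu>. F (\<lambda>i. \<sigma> i \<nu>))" by (rule dt_subst)
    moreover have "eval I \<nu> (App f ts) \<sqsubseteq> F (\<lambda>i. \<sigma> i \<nu>')" if "\<forall>i. \<nu> i \<sqsubseteq> \<nu>' i" for \<nu> \<nu>'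
      unfolding eval.simps using App.prems that by (intro F(2)) (auto simp: \<sigma>_def intro!: B(2))
    ultimately show ?case by blast
  qed
  moreover obtain t where "wf_tm t" "\<And>\<nu>. eval I \<nu> t = T \<nu>" using assms unfolding dt_def by blast
  ultimately show ?thesis using that by metis
qed

end

section \<open>Predicates definable by strict formulas\<close>

context pv_structure
begin

text \<open>Definability by a strict formula in this particular model. Predicates with the same
  truth values count as one, so closure properties may use everything that holds in the
  model.\<close>

definition sg :: "nat \<Rightarrow> ((nat \<Rightarrow> 'a) \<Rightarrow> bool) \<Rightarrow> bool" where
  "sg k P \<longleftrightarrow> (\<exists>\<phi>. sSigma_b k \<phi> \<and> (\<forall>\<nu>. sat I L \<nu> \<phi> = P \<nu>))"

definition pg :: "nat \<Rightarrow> ((nat \<Rightarrow> 'a) \<Rightarrow> bool) \<Rightarrow> bool" where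
  "pg k P \<longleftrightarrow> (\<exists>\<phi>. sPi_b k \<phi> \<and> (\<forall>\<nu>. sat I L \<nu> \<phi> = P \<nu>))"

lemma sg_0: "sg 0 P \<longleftrightarrow> sb P"
  unfolding sg_def sb_def by (metis sSigma_b.cases sSigma_b_sPi_b.intros(1) nat.distinct(1))

lemma pg_0: "pg 0 P \<longleftrightarrow> sb P"
  unfolding pg_def sb_def by (metis sPi_b.cases sSigma_b_sPi_b.intros(3) nat.distinct(1))

lemma sg_SucI:
  assumes "dt T" "pg k Q" "\<And>\<nu>. P \<nu> \<longleftrightarrow> (\<exists>y. y \<sqsubseteq> T \<nu> \<and> Q (y ## \<nu>))"
  shows "sg (Suc k) P"
proof -
  from assms(1,2) obtain t \<phi> where "wf_tm t" "\<And>\<nu>. eval I \<nu> t = T \<nu>" "sPi_b k \<phi>" "\<And>\<nu>. sat I L \<nu> \<phi> = Q \<nu>"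
    unfolding dt_def pg_def by auto
  with assms(3) show ?thesis
    unfolding sg_def by (intro exI[of _ "BEx t \<phi>"]) (auto simp: sat_BEx intro: sSigma_b_sPi_b.intros)
qed

lemma sg_SucE:
  assumes "sg (Suc k) P"
  obtains T Q where "dt T" "pg k Q" "\<And>\<nu>. P \<nu> \<longleftrightarrow> (\<exists>y. y \<sqsubseteq> T \<nu> \<and> Q (y ## \<nu>))"
proof -
  obtain \<phi> where \<phi>: "sSigma_b (Suc k) \<phi>" "\<And>\<nu>. sat I L \<nu> \<phi> = P \<nu>"
    using assms unfolding sg_def by auto
  from \<phi>(1) obtain t \<psi> where "\<phi> = BEx t \<psi>" "wf_tm t" "sPi_b k \<psi>" by (cases rule: sSigma_b.cases) auto
  with \<phi>(2) show ?thesis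
    by (intro that[of "\<lambda>\<nu>. eval I \<nu> t" "\<lambda>\<nu>. sat I L \<nu> \<psi>"]) (auto simp: dt_def pg_def sat_BEx[symmetric])
qed

lemma pg_SucI:
  assumes "dt T" "sg k Q" "\<And>\<nu>. P \<nu> \<longleftrightarrow> (\<forall>y. y \<sqsubseteq> T \<nu> \<longrightarrow> Q (y ## \<nu>))"
  shows "pg (Suc k) P"
proof -
  from assms(1,2) obtain t \<phi> where "wf_tm t" "\<And>\<nu>. eval I \<nu> t = T \<nu>" "sSigma_b k \<phi>" "\<And>\<nu>. sat I L \<nu> \<phi> = Q \<nu>"
    unfolding dt_def sg_def by auto
  with assms(3) show ?thesis
    unfolding pg_def by (intro exI[of _ "BAll t \<phi>"]) (auto simp: sat_BAll intro: sSigma_b_sPi_b.intros)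
qed

lemma pg_SucE:
  assumes "pg (Suc k) P"
  obtains T Q where "dt T" "sg k Q" "\<And>\<nu>. P \<nu> \<longleftrightarrow> (\<forall>y. y \<sqsubseteq> T \<nu> \<longrightarrow> Q (y ## \<nu>))"
proof -
  obtain \<phi> where \<phi>: "sPi_b (Suc k) \<phi>" "\<And>\<nu>. sat I L \<nu> \<phi> = P \<nu>"
    using assms unfolding pg_def by auto
  from \<phi>(1) obtain t \<psi> where "\<phi> = BAll t \<psi>" "wf_tm t" "sSigma_b k \<psi>" by (cases rule: sPi_b.cases) auto
  with \<phi>(2) show ?thesis
    by (intro that[of "\<lambda>\<nu>. eval I \<nu> t" "\<lambda>\<nu>. sat I L \<nu> \<psi>"]) (auto simp: dt_def sg_def sat_BAll[symmetric])
qed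

text \<open>The negation moves inward, exchanging the quantifiers, and ends in the sharply bounded
  matrix, which may be negated. Through it every fact about one class yields the dual fact about the
  other.\<close>

lemma sg_pg_not: "sg k P \<Longrightarrow> pg k (\<lambda>\<nu>. \<not> P \<nu>)" "pg k P \<Longrightarrow> sg k (\<lambda>\<nu>. \<not> P \<nu>)"
proof (induction k arbitrary: P)
  case 0
  { case 1 then show ?case by (simp add: sg_0 pg_0 sb_not) }
  { case 2 then show ?case by (simp add: sg_0 pg_0 sb_not) }
next
  case (Suc k)
  { case 1
    then obtain T Q where "dt T" "pg k Q" "\<And>\<nu>. P \<nu> \<longleftrightarrow> (\<exists>y. y \<sqsubseteq> T \<nu> \<and> Q (y ## \<nu>))" by (rule sg_SucE) blast
    then show ?case by (intro pg_SucI[of T k "\<lambda>\<nu>. \<not> Q \<nu>"] Suc.IH(2)) auto }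
  { case 2
    then obtain T Q where "dt T" "sg k Q" "\<And>\<nu>. P \<nu> \<longleftrightarrow> (\<forall>y. y \<sqsubseteq> T \<nu> \<longrightarrow> Q (y ## \<nu>))" by (rule pg_SucE) blast
    then show ?case by (intro sg_SucI[of T k "\<lambda>\<nu>. \<not> Q \<nu>"] Suc.IH(1)) auto }
qed

lemma pg_iff_sg_not: "pg k P \<longleftrightarrow> sg k (\<lambda>\<nu>. \<not> P \<nu>)"
  using sg_pg_not(1)[of k "\<lambda>\<nu>. \<not> P \<nu>"] sg_pg_not(2)[of k P] by auto

lemma sg_subst: "sg k P \<Longrightarrow> (\<And>i. dt (\<sigma> i)) \<Longrightarrow> sg k (\<lambda>\<nu>. P (\<lambda>i. \<sigma> i \<nu>))"
proof -
  assume P: "sg k P" and *: "\<And>i. dt (\<sigma> i)"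
  then obtain s where "\<And>i. wf_tm (s i) \<and> (\<forall>\<nu>. eval I \<nu> (s i) = \<sigma> i \<nu>)" unfolding dt_def by metis
  moreover obtain \<phi> where "sSigma_b k \<phi>" "\<And>\<nu>. sat I L \<nu> \<phi> = P \<nu>" using P unfolding sg_def by auto
  ultimately show ?thesis
    unfolding sg_def by (intro exI[of _ "subst s \<phi>"]) (auto simp: sat_subst sSigma_b_subst)
qed

lemma pg_subst: "pg k P \<Longrightarrow> (\<And>i. dt (\<sigma> i)) \<Longrightarrow> pg k (\<lambda>\<nu>. P (\<lambda>i. \<sigma> i \<nu>))"
  unfolding pg_iff_sg_not by (rule sg_subst)

lemma ext_eval: "(\<lambda>i. case_nat T \<sigma> i \<nu>) = T \<nu> ## (\<lambda>i. \<sigma> i \<nu>)"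
  by (auto split: nat.split)

lemma dt_case_nat: "dt T \<Longrightarrow> (\<And>i. dt (\<sigma> i)) \<Longrightarrow> dt (case_nat T \<sigma> i)"
  by (cases i) auto

lemma ext:
  assumes "dt T" "\<And>i. dt (\<sigma> i)"
  shows dt_ext: "dt S \<Longrightarrow> dt (\<lambda>\<nu>. S (T \<nu> ## (\<lambda>i. \<sigma> i \<nu>)))"
    and sg_ext: "sg k P \<Longrightarrow> sg k (\<lambda>\<nu>. P (T \<nu> ## (\<lambda>i. \<sigma> i \<nu>)))"
    and pg_ext: "pg k P \<Longrightarrow> pg k (\<lambda>\<nu>. P (T \<nu> ## (\<lambda>i. \<sigma> i \<nu>)))"
proof -
  have d: "dt (case_nat T \<sigma> i)" for i using assms by (rule dt_case_nat)
  show "dt S \<Longrightarrow> dt (\<lambda>\<nu>. S (T \<nu> ## (\<lambda>i. \<sigma> i \<nu>)))"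
    using dt_subst[of S "case_nat T \<sigma>", OF _ d] by (simp add: ext_eval)
  show "sg k P \<Longrightarrow> sg k (\<lambda>\<nu>. P (T \<nu> ## (\<lambda>i. \<sigma> i \<nu>)))"
    using sg_subst[of k P "case_nat T \<sigma>", OF _ d] by (simp add: ext_eval)
  show "pg k P \<Longrightarrow> pg k (\<lambda>\<nu>. P (T \<nu> ## (\<lambda>i. \<sigma> i \<nu>)))"
    using pg_subst[of k P "case_nat T \<sigma>", OF _ d] by (simp add: ext_eval)
qed

lemma ext2:
  assumes "dt T" "dt U" "\<And>i. dt (\<sigma> i)"
  shows sg_ext2: "sg k P \<Longrightarrow> sg k (\<lambda>\<nu>. P (T \<nu> ## U \<nu> ## (\<lambda>i. \<sigma> i \<nu>)))"
    and pg_ext2: "pg k P \<Longrightarrow> pg k (\<lambda>\<nu>. P (T \<nu> ## U \<nu> ## (\<lambda>i. \<sigma> i \<nu>)))"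
proof -
  have d: "dt (case_nat U \<sigma> i)" for i using assms(2,3) by (rule dt_case_nat)
  show "sg k P \<Longrightarrow> sg k (\<lambda>\<nu>. P (T \<nu> ## U \<nu> ## (\<lambda>i. \<sigma> i \<nu>)))"
    using sg_ext[of T "case_nat U \<sigma>", OF assms(1) d] by (simp add: ext_eval)
  show "pg k P \<Longrightarrow> pg k (\<lambda>\<nu>. P (T \<nu> ## U \<nu> ## (\<lambda>i. \<sigma> i \<nu>)))"
    using pg_ext[of T "case_nat U \<sigma>", OF assms(1) d] by (simp add: ext_eval)
qed

end

section \<open>Closure properties of the strict classes\<close>

context arith_model
begin

text \<open>Strict formulas have an exact number of quantifiers, so vacuous ones bounded by 0 are
  put in front; the matrix is shifted past the new variable, and negation supplies the passage
  between the two classes.\<close>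

lemma sb_sg: "sb P \<Longrightarrow> sg k P"
  and sb_pg: "sb P \<Longrightarrow> pg k P"
proof -
  have *: "sb P \<Longrightarrow> sg k P" for P
  proof (induction k arbitrary: P)
    case 0 then show ?case by (simp add: sg_0)
  next
    case (Suc k)
    then have "pg k P" by (simp add: pg_iff_sg_not sb_not)
    then have "pg k (\<lambda>\<nu>. P (\<lambda>i. \<nu> (Suc i)))" by (rule pg_subst[OF _ dt_var])
    then show ?case by (rule sg_SucI[OF dt_nul]) auto
  qed
  show "sb P \<Longrightarrow> sg k P" by (rule *)
  show "sb P \<Longrightarrow> pg k P" unfolding pg_iff_sg_not by (intro * sb_not)
qed

text \<open>For a conjunction both witnesses are packed into one code, and the matrix rechecks their
  bounds because an arbitrary number may decode to anything. For a disjunction one witness below the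
  sum of the bounds serves either side. The matrices are combined by the dual of the induction
  hypothesis.\<close>

lemma sg_conj_disj:
  "sg k P \<Longrightarrow> sg k Q \<Longrightarrow> sg k (\<lambda>\<nu>. P \<nu> \<and> Q \<nu>) \<and> sg k (\<lambda>\<nu>. P \<nu> \<or> Q \<nu>)"
proof (induction k arbitrary: P Q)
  case 0 then show ?case by (simp add: sg_0 sb_conj sb_disj)
next
  case (Suc k)
  have pg_conj: "pg k (\<lambda>\<nu>. P \<nu> \<and> Q \<nu>)" and pg_disj: "pg k (\<lambda>\<nu>. P \<nu> \<or> Q \<nu>)" if "pg k P" "pg k Q" for P Q
    using Suc.IH[of "\<lambda>\<nu>. \<not> P \<nu>" "\<lambda>\<nu>. \<not> Q \<nu>"] that by (simp_all add: pg_iff_sg_not)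
  from Suc.prems(1) obtain S A where A: "dt S" "pg k A" "\<And>\<nu>. P \<nu> \<longleftrightarrow> (\<exists>y. y \<sqsubseteq> S \<nu> \<and> A (y ## \<nu>))"
    by (rule sg_SucE) blast
  from Suc.prems(2) obtain T B where B: "dt T" "pg k B" "\<And>\<nu>. Q \<nu> \<longleftrightarrow> (\<exists>y. y \<sqsubseteq> T \<nu> \<and> B (y ## \<nu>))"
    by (rule sg_SucE) blast
  have tail: "dt (\<lambda>\<mu>. R (\<lambda>i. \<mu> (Suc i)))" if "dt R" for R
    using dt_subst[OF that dt_var] .
  have e1: "dt (\<lambda>\<mu>. elem (\<mu> 0) nul)" and e2: "dt (\<lambda>\<mu>. elem (\<mu> 0) one)"
    by (intro dt_coding dt_intros)+
  show ?case
  proof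
    let ?M = "\<lambda>\<mu>. (elem (\<mu> 0) nul \<sqsubseteq> S (\<lambda>i. \<mu> (Suc i)) \<and> elem (\<mu> 0) one \<sqsubseteq> T (\<lambda>i. \<mu> (Suc i))) \<and>
      A (elem (\<mu> 0) nul ## (\<lambda>i. \<mu> (Suc i))) \<and> B (elem (\<mu> 0) one ## (\<lambda>i. \<mu> (Suc i)))"
    have "pg k ?M"
      by (rule pg_conj[OF sb_pg[OF sb_conj[OF sb_le[OF e1 tail[OF A(1)]] sb_le[OF e2 tail[OF B(1)]]]]
            pg_conj[OF pg_ext[OF e1 dt_var A(2)] pg_ext[OF e2 dt_var B(2)]]])
    then show "sg (Suc k) (\<lambda>\<nu>. P \<nu> \<and> Q \<nu>)"
    proof (rule sg_SucI[OF dt_pair_bound[OF A(1) B(1)]])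
      fix \<nu>
      show "P \<nu> \<and> Q \<nu> \<longleftrightarrow> (\<exists>p. p \<sqsubseteq> pair_bound (S \<nu>) (T \<nu>) \<and> ?M (p ## \<nu>))"
        unfolding A(3) B(3) using pair_ex[of _ "S \<nu>" _ "T \<nu>"] by simp metis
    qed
  next
    let ?M = "\<lambda>\<mu>. (\<mu> 0 \<sqsubseteq> S (\<lambda>i. \<mu> (Suc i)) \<and> A \<mu>) \<or> (\<mu> 0 \<sqsubseteq> T (\<lambda>i. \<mu> (Suc i)) \<and> B \<mu>)"
    have "pg k ?M"
      by (rule pg_disj[OF pg_conj[OF sb_pg[OF sb_le[OF dt_var tail[OF A(1)]]] A(2)]
            pg_conj[OF sb_pg[OF sb_le[OF dt_var tail[OF B(1)]]] B(2)]])
    then show "sg (Suc k) (\<lambda>\<nu>. P \<nu> \<or> Q \<nu>)"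
    proof (rule sg_SucI[OF dt_add[OF A(1) B(1)]])
      fix \<nu>
      have "y \<sqsubseteq> S \<nu> \<Longrightarrow> y \<sqsubseteq> S \<nu> \<boxplus> T \<nu>" "y \<sqsubseteq> T \<nu> \<Longrightarrow> y \<sqsubseteq> S \<nu> \<boxplus> T \<nu>" for y
        using le_add1 le_trans by blast+
      then show "P \<nu> \<or> Q \<nu> \<longleftrightarrow> (\<exists>p. p \<sqsubseteq> S \<nu> \<boxplus> T \<nu> \<and> ?M (p ## \<nu>))"
        unfolding A(3) B(3) by simp blast
    qed
  qed
qed

lemma sg_conj: "sg k P \<Longrightarrow> sg k Q \<Longrightarrow> sg k (\<lambda>\<nu>. P \<nu> \<and> Q \<nu>)"
  and sg_disj: "sg k P \<Longrightarrow> sg k Q \<Longrightarrow> sg k (\<lambda>\<nu>. P \<nu> \<or> Q \<nu>)"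
  using sg_conj_disj by blast+

lemma pg_conj: "pg k P \<Longrightarrow> pg k Q \<Longrightarrow> pg k (\<lambda>\<nu>. P \<nu> \<and> Q \<nu>)"
  and pg_disj: "pg k P \<Longrightarrow> pg k Q \<Longrightarrow> pg k (\<lambda>\<nu>. P \<nu> \<or> Q \<nu>)"
  using sg_conj_disj[of k "\<lambda>\<nu>. \<not> P \<nu>" "\<lambda>\<nu>. \<not> Q \<nu>"] by (simp_all add: pg_iff_sg_not)

text \<open>Substituting \<open>T \<nu>\<close> for the bounded variable in a majorant of
  \<open>S\<close> gives a bound free of that variable.\<close>

lemma majorant_ext:
  assumes "dt S" "dt T"
  obtains B where "dt B" "\<And>x \<nu>. x \<sqsubseteq> T \<nu> \<Longrightarrow> S (x ## \<nu>) \<sqsubseteq> B \<nu>"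
proof -
  obtain B where B: "dt B" "\<And>\<nu> \<nu>'. (\<And>i. \<nu> i \<sqsubseteq> \<nu>' i) \<Longrightarrow> S \<nu> \<sqsubseteq> B \<nu>'"
    using dt_majorant[OF assms(1)] by blast
  have "dt (\<lambda>\<nu>. B (T \<nu> ## (\<lambda>i. \<nu> i)))" by (rule dt_ext[OF assms(2) dt_var B(1)])
  moreover have "S (x ## \<nu>) \<sqsubseteq> B (T \<nu> ## (\<lambda>i. \<nu> i))" if "x \<sqsubseteq> T \<nu>" for x \<nu>
    by (rule B(2)) (use that in \<open>auto split: nat.split\<close>)
  ultimately show ?thesis using that by blast
qed

text \<open>The new quantifier meets the leading existential one, and the two are replaced by a
  single quantifier over pairs. The inner bound may mention the outer variable, so the pair is
  bounded with a majorant and the true bound is moved into the matrix.\<close>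

lemma sg_bex:
  assumes "dt T" "sg (Suc k) P"
  shows "sg (Suc k) (\<lambda>\<nu>. \<exists>x. x \<sqsubseteq> T \<nu> \<and> P (x ## \<nu>))"
proof -
  from assms(2) obtain S A where A: "dt S" "pg k A" "\<And>\<nu>. P \<nu> \<longleftrightarrow> (\<exists>y. y \<sqsubseteq> S \<nu> \<and> A (y ## \<nu>))"
    by (rule sg_SucE) blast
  obtain B where B: "dt B" "\<And>x \<nu>. x \<sqsubseteq> T \<nu> \<Longrightarrow> S (x ## \<nu>) \<sqsubseteq> B \<nu>"
    using majorant_ext[OF A(1) assms(1)] by blast
  have e1: "dt (\<lambda>\<mu>. elem (\<mu> 0) nul)" and e2: "dt (\<lambda>\<mu>. elem (\<mu> 0) one)"
    by (intro dt_coding dt_intros)+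
  let ?M = "\<lambda>\<mu>. (elem (\<mu> 0) nul \<sqsubseteq> T (\<lambda>i. \<mu> (Suc i)) \<and>
      elem (\<mu> 0) one \<sqsubseteq> S (elem (\<mu> 0) nul ## (\<lambda>i. \<mu> (Suc i)))) \<and>
      A (elem (\<mu> 0) one ## elem (\<mu> 0) nul ## (\<lambda>i. \<mu> (Suc i)))"
  have "pg k ?M"
    by (rule pg_conj[OF sb_pg[OF sb_conj[OF sb_le[OF e1 dt_subst[OF assms(1) dt_var]]
            sb_le[OF e2 dt_ext[OF e1 dt_var A(1)]]]] pg_ext2[OF e2 e1 dt_var A(2)]])
  then show ?thesis
  proof (rule sg_SucI[OF dt_pair_bound[OF assms(1) B(1)]])
    fix \<nu>
    show "(\<exists>x. x \<sqsubseteq> T \<nu> \<and> P (x ## \<nu>)) \<longleftrightarrow> (\<exists>p. p \<sqsubseteq> pair_bound (T \<nu>) (B \<nu>) \<and> ?M (p ## \<nu>))"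
    proof
      assume "\<exists>x. x \<sqsubseteq> T \<nu> \<and> P (x ## \<nu>)"
      then obtain x y where *: "x \<sqsubseteq> T \<nu>" "y \<sqsubseteq> S (x ## \<nu>)" "A (y ## x ## \<nu>)" unfolding A(3) by blast
      then have "y \<sqsubseteq> B \<nu>" using B(2) le_trans by blast
      from pair_ex[OF *(1) this] * show "\<exists>p. p \<sqsubseteq> pair_bound (T \<nu>) (B \<nu>) \<and> ?M (p ## \<nu>)" by auto
    qed (auto simp: A(3))
  qed
qed

lemma pg_ball:
  assumes "dt T" "pg (Suc k) P"
  shows "pg (Suc k) (\<lambda>\<nu>. \<forall>x. x \<sqsubseteq> T \<nu> \<longrightarrow> P (x ## \<nu>))"
  using sg_bex[OF assms(1), of k "\<lambda>\<nu>. \<not> P \<nu>"] assms(2) by (simp add: pg_iff_sg_not)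

end

section \<open>Collection in models of length induction\<close>

text \<open>The parameter \<open>k\<close> is the index i of the theorem: length induction is
  available for formulas with one more leading quantifier than the matrices in
  \<open>pg k\<close>.\<close>

locale lind_model = arith_model +
  fixes b :: pv and k :: nat
  assumes wf_b: "wf_pv b" and arity_b: "arity b = 1" and b_le: "I b [x] \<sqsubseteq> x"
    and LIND: "sSigma_b (Suc k) \<phi> \<Longrightarrow> sat I L \<nu> (LIND b \<phi>)"
begin

definition bl :: "'a \<Rightarrow> 'a" where "bl x = I b [len x]"

lemma dt_bl: "dt T \<Longrightarrow> dt (\<lambda>\<nu>. bl (T \<nu>))"
  unfolding bl_def by (intro dt_app1 wf_b arity_b dt_len)

lemma bl_le: "bl x \<sqsubseteq> len x"
  unfolding bl_def by (rule b_le)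

lemma lind:
  assumes "sg (Suc k) P" "P (nul ## \<nu>)" "\<And>n. n \<sqsubset> bl x \<Longrightarrow> P (n ## \<nu>) \<Longrightarrow> P (suc n ## \<nu>)"
  shows "P (bl x ## \<nu>)"
proof -
  obtain \<phi> where \<phi>: "sSigma_b (Suc k) \<phi>" "\<And>\<nu>. sat I L \<nu> \<phi> = P \<nu>" using assms(1) unfolding sg_def by auto
  have e: "(\<lambda>m. if m = 0 then n else (y ## \<nu>) m) = n ## \<nu>" for n y
    by (auto split: nat.split)
  have "sat I L \<nu> (LIND b \<phi>)" by (rule LIND[OF \<phi>(1)])
  then have "P (nul ## \<nu>) \<and> (\<forall>n. n \<sqsubset> bl x \<longrightarrow> P (n ## \<nu>) \<longrightarrow> P (suc n ## \<nu>)) \<longrightarrow> P (bl x ## \<nu>)"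
    by (simp add: LIND_def sat_inst \<phi>(2) bl_def lt_def e cong: if_cong)
  then show ?thesis using assms(2,3) by blast
qed

text \<open>The variables \<open>0, 1, 2\<close> of \<open>collects Q\<close> are \<open>n\<close>, \<open>t\<close> and \<open>x\<close>, the parameters of \<open>Q\<close> follow.\<close>

definition collects :: "((nat \<Rightarrow> 'a) \<Rightarrow> bool) \<Rightarrow> (nat \<Rightarrow> 'a) \<Rightarrow> bool" where
  "collects Q \<mu> \<longleftrightarrow> (\<exists>w. w \<sqsubseteq> code_bound (\<mu> 1) (\<mu> 2) \<and> well_coded (\<mu> 1) w \<and>
     (\<forall>j. j \<sqsubseteq> bl (\<mu> 2) \<longrightarrow> \<not> j \<sqsubset> \<mu> 0 \<or> elem w j \<sqsubseteq> \<mu> 1 \<and> Q (j ## elem w j ## (\<lambda>i. \<mu> (i + 3)))))"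

text \<open>Induction on the number \<open>n\<close> of entries already chosen; a code for
  \<open>n\<close> entries is updated with a witness for entry \<open>n\<close>. Everything thus
  rests on the definability of \<open>collects Q\<close>, which is left as a premise so that the
  lemma can be applied both to \<Pi> matrices and to \<Sigma> predicates.\<close>

lemma collection:
  assumes sg: "sg (Suc k) (collects Q)" and Q: "\<And>j. j \<sqsubseteq> bl x \<Longrightarrow> \<exists>y. y \<sqsubseteq> t \<and> Q (j ## y ## \<nu>)"
  shows "\<exists>w. w \<sqsubseteq> code_bound t x \<and> (\<forall>j. j \<sqsubseteq> bl x \<longrightarrow> elem w j \<sqsubseteq> t \<and> Q (j ## elem w j ## \<nu>))"
proof -
  define G where "G n w \<longleftrightarrow> w \<sqsubseteq> code_bound t x \<and> well_coded t w \<and>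
     (\<forall>j. j \<sqsubseteq> bl x \<longrightarrow> \<not> j \<sqsubset> n \<or> elem w j \<sqsubseteq> t \<and> Q (j ## elem w j ## \<nu>))" for n w
  have e: "collects Q (n ## t ## x ## \<nu>) \<longleftrightarrow> (\<exists>w. G n w)" for n
  proof -
    have "(\<lambda>i. (n ## t ## x ## \<nu>) (i + 3)) = \<nu>" by (auto simp: eval_nat_numeral)
    then show ?thesis unfolding collects_def G_def by (simp add: eval_nat_numeral)
  qed
  have step: "\<exists>w. G (suc n) w" if n: "n \<sqsubseteq> bl x" and w: "G n w" for n w
  proof -
    obtain y where y: "y \<sqsubseteq> t" "Q (n ## y ## \<nu>)" using Q[OF n] by blast
    \<comment> \<open>The inequality b(x) \<le> x enters here: \<open>code_bound t x\<close> has
      room for the indices up to \<open>len x\<close>.\<close>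
    have "n \<sqsubseteq> len x" using n bl_le le_trans by blast
    from update[OF this _ len_mono[OF y(1)], of w] w
    obtain w' where w': "w' \<sqsubseteq> code_bound t x" "well_coded t w'"
      "\<And>j. j \<sqsubset> n \<Longrightarrow> elem w' j = elem w j" "elem w' n = y" unfolding G_def by blast
    have "elem w' j \<sqsubseteq> t \<and> Q (j ## elem w' j ## \<nu>)" if j: "j \<sqsubseteq> bl x" "j \<sqsubset> suc n" for j
    proof (cases "j = n")
      case True with y w'(4) show ?thesis by simp
    next
      case False
      moreover from j(2) have "j \<sqsubseteq> n" by (simp only: lt_suc_le)
      ultimately have "j \<sqsubset> n" by (simp add: lt_def)
      with w j(1) w'(3) show ?thesis by (simp add: G_def)
    qed
    with w'(1,2) show ?thesis unfolding G_def by blast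
  qed
  have "collects Q (bl x ## t ## x ## \<nu>)"
  proof (rule lind[OF sg])
    obtain w where "w \<sqsubseteq> code_bound t x" "well_coded t w"
      using update[of nul x t "pow2 t" nul] well_coded_pow2 by auto
    then show "collects Q (nul ## t ## x ## \<nu>)" unfolding e G_def by (auto simp: lt_def)
  next
    fix n assume "n \<sqsubset> bl x" "collects Q (n ## t ## x ## \<nu>)"
    then show "collects Q (suc n ## t ## x ## \<nu>)" unfolding e using step by (auto simp: lt_def)
  qed
  then obtain w where "G (bl x) w" unfolding e by blast
  \<comment> \<open>The induction ends with the entries below \<open>bl x\<close>, whereas
    collection includes the index \<open>bl x\<close> itself; one further step supplies it.\<close>
  from step[OF _ this] obtain w where "G (suc (bl x)) w" by auto
  then show ?thesis unfolding G_def lt_suc_le by blast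
qed

text \<open>Stated for an abstract class \<open>C\<close>, to be used for \<open>pg k\<close> and
  again for \<open>sg (Suc k)\<close>. The index ranges over all
  \<open>j \<sqsubseteq> bl (\<mu> 3)\<close> with the restriction
  \<open>j \<sqsubset> \<mu> 1\<close> inside, so that the quantifier has the b-sharply bounded form
  under which \<open>C\<close> is closed.\<close>

lemma collects_body:
  fixes C :: "((nat \<Rightarrow> 'a) \<Rightarrow> bool) \<Rightarrow> bool"
  assumes "\<And>P. sb P \<Longrightarrow> C P"
    and "\<And>P Q. C P \<Longrightarrow> C Q \<Longrightarrow> C (\<lambda>\<nu>. P \<nu> \<and> Q \<nu>)"
    and "\<And>P Q. C P \<Longrightarrow> C Q \<Longrightarrow> C (\<lambda>\<nu>. P \<nu> \<or> Q \<nu>)"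
    and "\<And>P T. C P \<Longrightarrow> dt T \<Longrightarrow> C (\<lambda>\<nu>. \<forall>x. x \<sqsubseteq> bl (T \<nu>) \<longrightarrow> P (x ## \<nu>))"
    and "\<And>P T U \<sigma>. dt T \<Longrightarrow> dt U \<Longrightarrow> (\<And>i. dt (\<sigma> i)) \<Longrightarrow> C P \<Longrightarrow> C (\<lambda>\<nu>. P (T \<nu> ## U \<nu> ## (\<lambda>i. \<sigma> i \<nu>)))"
    and "C Q"
  shows "C (\<lambda>\<mu>. well_coded (\<mu> 2) (\<mu> 0) \<and> (\<forall>j. j \<sqsubseteq> bl (\<mu> 3) \<longrightarrow>
     \<not> j \<sqsubset> \<mu> 1 \<or> elem (\<mu> 0) j \<sqsubseteq> \<mu> 2 \<and> Q (j ## elem (\<mu> 0) j ## (\<lambda>i. \<mu> (i + 4)))))"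
proof -
  let ?P = "\<lambda>\<mu>. \<not> \<mu> 0 \<sqsubset> \<mu> 2 \<or> elem (\<mu> 1) (\<mu> 0) \<sqsubseteq> \<mu> 3 \<and>
    Q (\<mu> 0 ## elem (\<mu> 1) (\<mu> 0) ## (\<lambda>i. \<mu> (i + 5)))"
  have e: "dt (\<lambda>\<mu>. elem (\<mu> 1) (\<mu> 0))" by (intro dt_coding dt_var)
  have "C ?P"
    by (rule assms(3)[OF assms(1)[OF sb_not[OF sb_lt[OF dt_var dt_var]]]
          assms(2)[OF assms(1)[OF sb_le[OF e dt_var]] assms(5)[OF dt_var e dt_var assms(6)]]])
  from assms(4)[OF this dt_var[of 3]]
  have "C (\<lambda>\<mu>. \<forall>j. j \<sqsubseteq> bl (\<mu> 3) \<longrightarrow> \<not> j \<sqsubset> \<mu> 1 \<or> elem (\<mu> 0) j \<sqsubseteq> \<mu> 2 \<and>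
    Q (j ## elem (\<mu> 0) j ## (\<lambda>i. \<mu> (i + 4))))"
    by (simp add: eval_nat_numeral)
  from assms(2)[OF assms(1)[OF sb_well_coded[OF dt_var dt_var]] this] show ?thesis .
qed

lemma collects_alt:
  "collects Q \<mu> \<longleftrightarrow> (\<exists>w. w \<sqsubseteq> code_bound (\<mu> 1) (\<mu> 2) \<and>
     (\<lambda>\<mu>. well_coded (\<mu> 2) (\<mu> 0) \<and> (\<forall>j. j \<sqsubseteq> bl (\<mu> 3) \<longrightarrow>
       \<not> j \<sqsubset> \<mu> 1 \<or> elem (\<mu> 0) j \<sqsubseteq> \<mu> 2 \<and> Q (j ## elem (\<mu> 0) j ## (\<lambda>i. \<mu> (i + 4))))) (w ## \<mu>))"
  unfolding collects_def by (simp add: eval_nat_numeral)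

section \<open>Closure under b-sharply bounded universal quantification\<close>

lemma pg_ball_bl:
  assumes "pg n P" "dt T" shows "pg n (\<lambda>\<nu>. \<forall>x. x \<sqsubseteq> bl (T \<nu>) \<longrightarrow> P (x ## \<nu>))"
proof (cases n)
  case 0
  \<comment> \<open>A bound b(|t|) is not of the form |t|: the quantifier is widened to a sharply
    bounded one and the original bound becomes a guard. At higher levels the quantifier merges with
    the leading universal one.\<close>
  have "sb (\<lambda>\<mu>. \<mu> 0 \<sqsubseteq> bl (T (\<lambda>i. \<mu> (Suc i))) \<longrightarrow> P \<mu>)"
    using assms(1) sb_imp[OF sb_le[OF dt_var dt_bl[OF dt_subst[OF assms(2) dt_var]]]] by (simp add: 0 pg_0)
  from sb_BAll[OF assms(2) this]
  have "sb (\<lambda>\<nu>. \<forall>x. x \<sqsubseteq> len (T \<nu>) \<longrightarrow> x \<sqsubseteq> bl (T \<nu>) \<longrightarrow> P (x ## \<nu>))" by simp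
  moreover have "(\<lambda>\<nu>. \<forall>x. x \<sqsubseteq> len (T \<nu>) \<longrightarrow> x \<sqsubseteq> bl (T \<nu>) \<longrightarrow> P (x ## \<nu>)) =
    (\<lambda>\<nu>. \<forall>x. x \<sqsubseteq> bl (T \<nu>) \<longrightarrow> P (x ## \<nu>))"
    using bl_le le_trans by blast
  ultimately show ?thesis by (simp add: 0 pg_0)
next
  case (Suc m)
  with pg_ball[OF dt_bl[OF assms(2)]] assms(1) show ?thesis by simp
qed

lemma sg_collects_pg: "pg k Q \<Longrightarrow> sg (Suc k) (collects Q)"
  by (rule sg_SucI[OF dt_code_bound[OF dt_var dt_var] _ collects_alt], rule collects_body)
    (assumption | rule sb_pg pg_conj pg_disj pg_ball_bl pg_ext2)+

text \<open>Collection for the \<Pi> matrix exchanges the universal quantifier over indices with the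
  existential one over witnesses. What remains is one bounded code followed by a matrix that absorbs
  the universal quantifier.\<close>

lemma sg_ball_bl:
  assumes "sg (Suc k) P" "dt T" shows "sg (Suc k) (\<lambda>\<nu>. \<forall>x. x \<sqsubseteq> bl (T \<nu>) \<longrightarrow> P (x ## \<nu>))"
proof -
  from assms(1) obtain S A where A: "dt S" "pg k A" "\<And>\<nu>. P \<nu> \<longleftrightarrow> (\<exists>y. y \<sqsubseteq> S \<nu> \<and> A (y ## \<nu>))"
    by (rule sg_SucE) blast
  obtain B where B: "dt B" "\<And>x \<nu>. x \<sqsubseteq> bl (T \<nu>) \<Longrightarrow> S (x ## \<nu>) \<sqsubseteq> B \<nu>"
    using majorant_ext[OF A(1) dt_bl[OF assms(2)]] by blast
  \<comment> \<open>Collection limits all witnesses by the uniform bound \<open>B \<nu>\<close>; the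
    bound belonging to the individual index \<open>j\<close> is therefore made part of
    \<open>Q\<close>.\<close>
  define Q where "Q \<mu> \<longleftrightarrow> \<mu> 1 \<sqsubseteq> S (\<mu> 0 ## (\<lambda>i. \<mu> (i + 2))) \<and> A (\<mu> 1 ## \<mu> 0 ## (\<lambda>i. \<mu> (i + 2)))" for \<mu>
  have Q: "pg k Q" unfolding Q_def
    by (rule pg_conj[OF sb_pg[OF sb_le[OF dt_var dt_ext[OF dt_var dt_var A(1)]]] pg_ext2[OF dt_var dt_var dt_var A(2)]])
  have Q_eq: "Q (j ## y ## \<nu>) \<longleftrightarrow> y \<sqsubseteq> S (j ## \<nu>) \<and> A (y ## j ## \<nu>)" for j y \<nu>
    by (simp add: Q_def)
  let ?M = "\<lambda>\<mu>. \<forall>j. j \<sqsubseteq> bl (T (\<lambda>i. \<mu> (Suc i))) \<longrightarrow> Q (j ## elem (\<mu> 0) j ## (\<lambda>i. \<mu> (Suc i)))"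
  have "pg k (\<lambda>\<mu>. Q (\<mu> 0 ## elem (\<mu> 1) (\<mu> 0) ## (\<lambda>i. \<mu> (Suc (Suc i)))))"
    by (rule pg_ext2[OF dt_var dt_coding(7)[OF dt_var dt_var] dt_var Q])
  from pg_ball_bl[OF this dt_subst[OF assms(2) dt_var]] have "pg k ?M" by simp
  then show ?thesis
  proof (rule sg_SucI[OF dt_code_bound[OF B(1) assms(2)]])
    fix \<nu>
    show "(\<forall>x. x \<sqsubseteq> bl (T \<nu>) \<longrightarrow> P (x ## \<nu>)) \<longleftrightarrow> (\<exists>w. w \<sqsubseteq> code_bound (B \<nu>) (T \<nu>) \<and> ?M (w ## \<nu>))"
    proof
      assume *: "\<forall>x. x \<sqsubseteq> bl (T \<nu>) \<longrightarrow> P (x ## \<nu>)"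
      have "\<exists>y. y \<sqsubseteq> B \<nu> \<and> Q (j ## y ## \<nu>)" if "j \<sqsubseteq> bl (T \<nu>)" for j
        using * that B(2)[OF that] le_trans unfolding A(3) Q_eq by blast
      from collection[where x = "T \<nu>" and t = "B \<nu>", OF sg_collects_pg[OF Q] this]
      show "\<exists>w. w \<sqsubseteq> code_bound (B \<nu>) (T \<nu>) \<and> ?M (w ## \<nu>)" by auto
    next
      assume "\<exists>w. w \<sqsubseteq> code_bound (B \<nu>) (T \<nu>) \<and> ?M (w ## \<nu>)"
      then show "\<forall>x. x \<sqsubseteq> bl (T \<nu>) \<longrightarrow> P (x ## \<nu>)" unfolding A(3) Q_eq by auto
    qed
  qed
qed

text \<open>Now the body itself is only in \<open>sg (Suc k)\<close>, by the closure just obtained,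
  and the quantifier over the code is merged into its leading existential quantifier. With this,
  collection holds for all predicates in the class.\<close>

lemma sg_collects: assumes "sg (Suc k) Q" shows "sg (Suc k) (collects Q)"
  unfolding collects_alt[abs_def]
  by (rule sg_bex[OF dt_code_bound[OF dt_var dt_var]], rule collects_body)
    (assumption | rule assms sb_sg sg_conj sg_disj sg_ball_bl sg_ext2)+

lemma bSigma_b_sg: "bSigma_b b (Suc k) \<phi> \<Longrightarrow> sg (Suc k) (\<lambda>\<nu>. sat I L \<nu> \<phi>)"
proof (induction rule: bSigma_b.induct)
  case (1 \<phi>) then show ?case by (auto simp: sg_def)
next
  case (2 \<phi> \<psi>) then show ?case by (simp add: sg_conj)
next
  case (3 \<phi> \<psi>) then show ?case by (simp add: sg_disj)
next
  case (4 t \<phi>)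
  have "dt (\<lambda>\<nu>. eval I \<nu> t)" using 4 unfolding dt_def by blast
  from sg_bex[OF dt_bl[OF this] 4(3)] show ?case by (simp add: sat_BEx bl_def)
next
  case (5 t \<phi>)
  have "dt (\<lambda>\<nu>. eval I \<nu> t)" using 5 unfolding dt_def by blast
  from sg_ball_bl[OF 5(3) this] show ?case by (simp add: sat_BAll bl_def)
qed

lemma BB_sound: assumes "bSigma_b b (Suc k) \<phi>" shows "sat I L \<nu> (BB b \<phi>)"
proof -
  \<comment> \<open>In both places four quantified variables precede the parameters of
    \<open>\<phi>\<close>: \<open>y\<close>, \<open>j\<close>, \<open>t\<close>, \<open>x\<close> in
    the hypothesis and \<open>j\<close>, \<open>w\<close>, \<open>t\<close>, \<open>x\<close> in the
    conclusion.\<close>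
  have e: "sat I L (y ## j ## t ## x ## \<nu>) (inst [Var 1, Var 0] 4 \<phi>) = sat I L (j ## y ## \<nu>) \<phi>"
    "sat I L (j ## w ## t ## x ## \<nu>) (inst [Var 0, App elem_pv [Var 1, Var 0]] 4 \<phi>) =
      sat I L (j ## elem w j ## \<nu>) \<phi>" for y j t x w
    unfolding sat_inst
    by (rule arg_cong[of _ _ "\<lambda>\<mu>. sat I L \<mu> \<phi>"];
      auto simp: fun_eq_iff elem_def less_Suc_eq eval_nat_numeral split: nat.split)+
  have "sat I L \<nu> (BB b \<phi>) \<longleftrightarrow> (\<forall>x t. (\<forall>j. j \<sqsubseteq> bl x \<longrightarrow> (\<exists>y. y \<sqsubseteq> t \<and> sat I L (j ## y ## \<nu>) \<phi>)) \<longrightarrow>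
    (\<exists>w. \<forall>j. j \<sqsubseteq> bl x \<longrightarrow> sat I L (j ## elem w j ## \<nu>) \<phi>))"
    by (simp add: BB_def sat_BAll sat_BEx e bl_def del: One_nat_def) (simp add: eval_nat_numeral)
  then show ?thesis
    using collection[OF sg_collects[OF bSigma_b_sg[OF assms]]] by blast
qed

end

section \<open>Transfer to provability\<close>

text \<open>Lifting does not change a closed context. The lifted quantified formula instantiated
  with \<open>Var 0\<close> is the original body, its variable 0 now being free.\<close>

lemma derives_Forall_elim:
  assumes "\<And>\<phi>. \<phi> \<in> \<Gamma> \<Longrightarrow> fv \<phi> = {}" "derives \<Gamma> (Forall \<psi>)"
  shows "derives \<Gamma> \<psi>"
proof -
  have "subst (\<lambda>n. Var (Suc n)) \<phi> = subst Var \<phi>" if "\<phi> \<in> \<Gamma>" for \<phi>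
    by (rule subst_cong) (simp add: assms(1)[OF that])
  then have "subst (\<lambda>n. Var (Suc n)) ` \<Gamma> = \<Gamma>" by simp
  with derives_subst[OF assms(2), of "\<lambda>n. Var (Suc n)"]
  have "derives \<Gamma> (Forall (subst (up (\<lambda>n. Var (Suc n))) \<psi>))" by simp
  then have "derives \<Gamma> (inst [Var 0] 0 (subst (up (\<lambda>n. Var (Suc n))) \<psi>))" by (rule derives.ForallE)
  moreover have "inst [Var 0] 0 (subst (up (\<lambda>n. Var (Suc n))) \<psi>) = subst Var \<psi>"
    unfolding inst1 subst_subst
    by (rule subst_cong) (auto simp: up_def lift_tm_def split: nat.split)
  ultimately show ?thesis by simp
qed

lemma derives_instance:
  assumes "\<phi> \<in> A"
  shows "derives (universal_closures A) (subst \<sigma> \<phi>)"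
proof -
  let ?\<Gamma> = "universal_closures A"
  obtain n where "fv \<phi> \<subseteq> {..<n}" using finite_fv by (metis finite_nat_iff_bounded)
  with assms have "(Forall ^^ n) \<phi> \<in> ?\<Gamma>" by (auto simp: universal_closures_def)
  then have "derives ?\<Gamma> ((Forall ^^ n) \<phi>)" by (rule derives.Assm)
  then have "derives ?\<Gamma> \<phi>"
  proof (induction n)
    case (Suc n)
    from Suc.prems have "derives ?\<Gamma> (Forall ((Forall ^^ n) \<phi>))" by simp
    with universal_closures_fv have "derives ?\<Gamma> ((Forall ^^ n) \<phi>)" by (rule derives_Forall_elim)
    then show ?case by (rule Suc.IH)
  qed simp
  then have "derives (subst \<sigma> ` ?\<Gamma>) (subst \<sigma> \<phi>)" by (rule derives_subst)
  moreover have "subst \<sigma> \<psi> = subst Var \<psi>" if "\<psi> \<in> ?\<Gamma>" for \<psi>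
    by (rule subst_cong) (simp add: universal_closures_fv[OF that])
  ultimately show ?thesis by simp
qed

text \<open>Provides the infinity requirement of \<open>completeness\<close>. The order axioms
  suffice: the numeral for \<open>m + 1\<close> is provably at most that for \<open>n\<close>, and
  \<open>\<S> s \<preceq> t\<close> entails that \<open>s\<close> and \<open>t\<close>
  differ.\<close>

lemma numerals_distinct:
  assumes "BASIC \<subseteq> A" "m < n"
  shows "derives (universal_closures A) (\<^bold>\<not> ((\<S> ^^ m) \<zero> \<doteq> (\<S> ^^ n) \<zero>))"
proof -
  let ?\<Gamma> = "universal_closures A"
  have B: "derives ?\<Gamma> (subst \<sigma> \<phi>)" if "\<phi> \<in> Buss_axioms" for \<phi> \<sigma>
    using derives_instance[of \<phi> A \<sigma>] assms(1) that by (auto simp: BASIC_def)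
  have refl: "derives ?\<Gamma> (t \<preceq> t)" for t
  proof -
    have "derives ?\<Gamma> (t \<preceq> t \<^bold>\<or> t \<preceq> t)"
      using B[of "Var 1 \<preceq> Var 0 \<^bold>\<or> Var 0 \<preceq> Var 1" "\<lambda>_. t"] by (simp add: Buss_axioms_def Let_def)
    then show ?thesis by (rule derives.DisjE) (simp_all add: derives.Assm)
  qed
  have suc: "derives ?\<Gamma> (s \<preceq> \<S> t)" if "derives ?\<Gamma> (s \<preceq> t)" for s t
  proof (rule derives.ImpE[OF _ that])
    show "derives ?\<Gamma> (s \<preceq> t \<^bold>\<longrightarrow> s \<preceq> \<S> t)"
      using B[of "Var 1 \<preceq> Var 0 \<^bold>\<longrightarrow> Var 1 \<preceq> \<S> (Var 0)" "case_nat t (\<lambda>_. s)"]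
      by (simp add: Buss_axioms_def Let_def)
  qed
  have less: "derives ?\<Gamma> (\<^bold>\<not> (s \<doteq> t))" if "derives ?\<Gamma> (\<S> s \<preceq> t)" for s t
  proof -
    have "derives ?\<Gamma> ((s \<preceq> t \<^bold>\<and> \<^bold>\<not> (s \<doteq> t)) \<^bold>\<longleftrightarrow> \<S> s \<preceq> t)"
      using B[of "(Var 0 \<preceq> Var 1 \<^bold>\<and> \<^bold>\<not> (Var 0 \<doteq> Var 1)) \<^bold>\<longleftrightarrow> \<S> (Var 0) \<preceq> Var 1" "case_nat s (\<lambda>_. t)"]
      by (simp add: Buss_axioms_def Let_def)
    then have "derives ?\<Gamma> (\<S> s \<preceq> t \<^bold>\<longrightarrow> (s \<preceq> t \<^bold>\<and> \<^bold>\<not> (s \<doteq> t)))" by (rule derives.ConjE2)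
    then show ?thesis using that by (rule derives.ConjE2[OF derives.ImpE])
  qed
  have "derives ?\<Gamma> ((\<S> ^^ Suc m) \<zero> \<preceq> (\<S> ^^ n) \<zero>)"
    using assms(2)
  proof (induction n)
    case (Suc n)
    then show ?case using refl suc by (cases "m = n") auto
  qed simp
  then show ?thesis by (intro less) simp
qed

theorem theorem2p9:
  fixes i :: nat and b :: pv
  assumes "bound_function b"
  shows "\<forall>\<phi>. bSigma_b b (Suc i) \<phi> \<longrightarrow>
           (T2 i \<union> LIND b ` {\<psi>. sSigma_b (Suc i) \<psi>} \<turnstile> BB b \<phi>)"
proof (intro allI impI)
  fix \<phi> assume \<phi>: "bSigma_b b (Suc i) \<phi>"
  let ?A = "T2 i \<union> LIND b ` {\<psi>. sSigma_b (Suc i) \<psi>}"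
  show "?A \<turnstile> BB b \<phi>"
    unfolding proves_def
  proof (rule completeness)
    fix I :: "pv \<Rightarrow> nat list \<Rightarrow> nat" and L \<nu>
    assume "\<And>\<psi> \<nu>. \<psi> \<in> universal_closures ?A \<Longrightarrow> sat I L \<nu> \<psi>"
    then have "\<forall>\<psi> \<in> universal_closures ?A. \<forall>\<nu>. sat I L \<nu> \<psi>" by blast
    then have "\<forall>\<psi> \<in> ?A. \<forall>\<nu>. sat I L \<nu> \<psi>" by (rule sat_universal_closures[THEN iffD1])
    then have A: "sat I L \<nu> \<psi>" if "\<psi> \<in> ?A" for \<psi> \<nu> using that by blast
    interpret arith_model I L
    proof
      show "\<psi> \<in> BASIC \<Longrightarrow> sat I L \<nu> \<psi>" for \<psi> \<nu> by (rule A) (simp add: T2_def)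
      \<comment> \<open>Sharply bounded formulas belong to every level of the hierarchy, so
        \<open>T2 i\<close> contains these instances for each \<open>i\<close>.\<close>
      show "sharply_bounded \<psi> \<Longrightarrow> sat I L \<nu> (IND \<psi>)" for \<psi> \<nu>
        by (rule A) (simp add: T2_def sharply_bounded_Sigma_b)
    qed
    interpret lind_model I L b i
    proof
      show "wf_pv b" "arity b = 1" using assms by (simp_all add: bound_function_def)
      show "L (I b [x]) x" for x by (rule bound_function_le[OF assms])
      show "sSigma_b (Suc i) \<psi> \<Longrightarrow> sat I L \<nu> (LIND b \<psi>)" for \<psi> \<nu> by (rule A) simp
    qed
    show "sat I L \<nu> (BB b \<phi>)" by (rule BB_sound[OF \<phi>])
  next
    show "fv \<psi> = {}" if "\<psi> \<in> universal_closures ?A" for \<psi>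
      using that by (rule universal_closures_fv)
  next
    have "BASIC \<subseteq> ?A" by (auto simp: T2_def)
    then show "derives (universal_closures ?A) (\<^bold>\<not> ((\<S> ^^ m) \<zero> \<doteq> (\<S> ^^ n) \<zero>))" if "m < n" for m n
      using that by (rule numerals_distinct)
  qed
qed

end
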